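(* Let $T>0$. Let $b,\sigma:\mathbb{R}\times\mathcal{P}_2(\mathbb{R})\to\mathbb{R}$ satisfy, for some constant $K>0$, $|b(x,\mu)-b(y,\nu)|+|\sigma(x,\mu)-\sigma(y,\nu)|\le K(|x-y|+\mathcal{W}_2(\mu,\nu))$ for all $x,y\in\mathbb{R}$, $\mu,\nu\in\mathcal{P}_2(\mathbb{R})$, and let $h:\mathbb{R}\to\mathbb{R}$ be increasing with $m|x-y|\le|h(x)-h(y)|\le M|x-y|$ for all $x,y$, for some $0<m\le M$. For $\xi\in\mathbb{R}$ with $h(\xi)\ge0$, let $(X^\xi,K^\xi)$ be the unique deterministic flat solution of the mean reflected McKean-Vlasov SDE with coefficients $b,\sigma$, constraint function $h$ and initial condition $\xi$. Then the mapping $$\Xi:\{\xi\in\mathbb{R}:h(\xi)\ge0\}\to L^2(\Omega,\mathcal{C}([0,T],\mathbb{R})),\qquad \Xi(\xi)=(X^\xi_t)_{t\in[0,T]},$$ is continuous.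
   Context: $(\Omega,\mathcal{F},\{\mathcal{F}_t\},\mathbb{P})$ is a complete filtered probability space with a standard one-dimensional $\{\mathcal{F}_t\}$-Brownian motion $B$; $\mathcal{L}_Z$ is the law of $Z$; $\mathcal{P}_2(\mathbb{R})$ is the set of probability measures on $\mathbb{R}$ with finite second moment, $\mathcal{W}_2$ the 2-Wasserstein distance. The mean reflected McKean-Vlasov SDE is $$X_t=\xi+\int_0^tb(X_s,\mathcal{L}_{X_s})ds+\int_0^t\sigma(X_s,\mathcal{L}_{X_s})dB_s+K_t,\quad \mathbb{E}[h(X_t)]\ge0,\quad\int_0^t\mathbb{E}[h(X_s)]dK_s=0,\quad t\ge0,$$ with $X$ continuous adapted and $K$ a non-decreasing continuous deterministic function, $K_0=0$; the unique such pair is called the deterministic flat solution. $\mathcal{C}([0,T],\mathbb{R})$ carries the supremum norm, so the norm on $L^2(\Omega,\mathcal{C}([0,T],\mathbb{R}))$ is $(\mathbb{E}[\sup_{t\le T}|X_t|^2])^{1/2}$. *)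

theory Defs
  imports "HOL-Probability.Probability"
begin

section \<open>Filtered probability spaces and Brownian motion\<close>

text \<open>
  Time is \<open>[0,\<infinity>)\<close>, embedded in \<^typ>\<open>real\<close>; values of a filtration or a process at negative
  times are never used. Processes are curried: \<open>X t \<omega>\<close>. Only the space and the sets of \<open>F t\<close> matter.
  Completeness means that \<open>M\<close> is complete and that every null set lies in \<open>F 0\<close>; right-continuity
  of the filtration is not required.
\<close>

locale complete_filtered_prob_space = prob_space M + complete_measure M
  for M :: "'a measure" +
  fixes F :: "real \<Rightarrow> 'a measure"
  assumes subalgebra_F: "\<And>t. 0 \<le> t \<Longrightarrow> subalgebra M (F t)"
    and sets_F_mono: "\<And>s t. 0 \<le> s \<Longrightarrow> s \<le> t \<Longrightarrow> sets (F s) \<subseteq> sets (F t)"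
    and null_sets_F: "null_sets M \<subseteq> sets (F 0)"

definition adapted_process :: "(real \<Rightarrow> 'a measure) \<Rightarrow> (real \<Rightarrow> 'a \<Rightarrow> real) \<Rightarrow> bool" where
  "adapted_process F X \<longleftrightarrow> (\<forall>t\<ge>0. X t \<in> borel_measurable (F t))"

definition progressive_process :: "(real \<Rightarrow> 'a measure) \<Rightarrow> (real \<Rightarrow> 'a \<Rightarrow> real) \<Rightarrow> bool" where
  "progressive_process F H \<longleftrightarrow>
    (\<forall>t\<ge>0. (\<lambda>(s, \<omega>). H s \<omega>) \<in> borel_measurable (restrict_space borel {0..t} \<Otimes>\<^sub>M F t))"

definition brownian_motion ::
    "'a measure \<Rightarrow> (real \<Rightarrow> 'a measure) \<Rightarrow> (real \<Rightarrow> 'a \<Rightarrow> real) \<Rightarrow> bool" where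
  "brownian_motion M F B \<longleftrightarrow>
     adapted_process F B \<and>
     (AE \<omega> in M. B 0 \<omega> = 0) \<and>
     (AE \<omega> in M. continuous_on {0..} (\<lambda>t. B t \<omega>)) \<and>
     (\<forall>s t. 0 \<le> s \<longrightarrow> s < t \<longrightarrow>
        distributed M lborel (\<lambda>\<omega>. B t \<omega> - B s \<omega>) (normal_density 0 (sqrt (t - s))) \<and>
        prob_space.indep_set M (sets (F s))
          {(\<lambda>\<omega>. B t \<omega> - B s \<omega>) -` A \<inter> space M | A. A \<in> sets borel})"

section \<open>The Ito integral\<close>

text \<open>
  A simple integrand is \<open>H s \<omega> = (\<Sum>i<n. \<eta> i \<omega> * indicator {\<tau> i<..\<tau> (Suc i)} s)\<close> with deterministic
  times \<open>\<tau> 0 \<le> \<dots> \<le> \<tau> n\<close> and bounded \<open>F (\<tau> i)\<close>-measurable weights \<open>\<eta> i\<close>. It is handled through the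
  data \<open>(n, \<tau>, \<eta>)\<close> that represent it.
\<close>

definition simple_integrand ::
    "(real \<Rightarrow> 'a measure) \<Rightarrow> nat \<Rightarrow> (nat \<Rightarrow> real) \<Rightarrow> (nat \<Rightarrow> 'a \<Rightarrow> real) \<Rightarrow> bool" where
  "simple_integrand F n \<tau> \<eta> \<longleftrightarrow>
     0 \<le> \<tau> 0 \<and> mono_on {..n} \<tau> \<and>
     (\<forall>i<n. \<eta> i \<in> borel_measurable (F (\<tau> i)) \<and> (\<exists>C. \<forall>\<omega>\<in>space (F (\<tau> i)). \<bar>\<eta> i \<omega>\<bar> \<le> C))"

definition simple_process ::
    "nat \<Rightarrow> (nat \<Rightarrow> real) \<Rightarrow> (nat \<Rightarrow> 'a \<Rightarrow> real) \<Rightarrow> real \<Rightarrow> 'a \<Rightarrow> real" where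
  "simple_process n \<tau> \<eta> s \<omega> = (\<Sum>i<n. \<eta> i \<omega> * indicator {\<tau> i<..\<tau> (Suc i)} s)"

definition simple_integral ::
    "(real \<Rightarrow> 'a \<Rightarrow> real) \<Rightarrow> nat \<Rightarrow> (nat \<Rightarrow> real) \<Rightarrow> (nat \<Rightarrow> 'a \<Rightarrow> real) \<Rightarrow> real \<Rightarrow> 'a \<Rightarrow> real" where
  "simple_integral B n \<tau> \<eta> t \<omega> =
     (\<Sum>i<n. \<eta> i \<omega> * (B (min (\<tau> (Suc i)) t) \<omega> - B (min (\<tau> i) t) \<omega>))"

text \<open>
  \<open>ito_integral M F B H I\<close>: the process \<open>I\<close> is (a continuous version of) \<open>t \<mapsto> \<integral>\<^sub>0\<^sup>t H dB\<close>. The integrand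
  is progressively measurable with \<open>\<integral>\<^sub>0\<^sup>t H\<^sup>2 ds < \<infinity>\<close> almost surely, the general class for which the
  integral exists, and \<open>I\<close> is the limit, uniformly on compacts in probability, of the integrals of
  simple integrands \<open>H\<^sub>k\<close> such that \<open>\<integral>\<^sub>0\<^sup>t (H - H\<^sub>k)\<^sup>2 ds \<rightarrow> 0\<close> in probability for every \<open>t\<close>.
\<close>

definition ito_integral ::
    "'a measure \<Rightarrow> (real \<Rightarrow> 'a measure) \<Rightarrow> (real \<Rightarrow> 'a \<Rightarrow> real) \<Rightarrow>
     (real \<Rightarrow> 'a \<Rightarrow> real) \<Rightarrow> (real \<Rightarrow> 'a \<Rightarrow> real) \<Rightarrow> bool" where
  "ito_integral M F B H I \<longleftrightarrow>
     progressive_process F H \<and>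
     (AE \<omega> in M. \<forall>t\<ge>0. set_integrable lborel {0..t} (\<lambda>s. (H s \<omega>)\<^sup>2)) \<and>
     adapted_process F I \<and>
     (\<forall>\<omega>\<in>space M. continuous_on {0..} (\<lambda>t. I t \<omega>)) \<and>
     (\<exists>n \<tau> \<eta>.
        (\<forall>k. simple_integrand F (n k) (\<tau> k) (\<eta> k)) \<and>
        (\<forall>t\<ge>0. \<forall>\<epsilon>>0.
           (\<lambda>k. measure M {\<omega>\<in>space M.
              (\<integral>\<^sup>+ s\<in>{0..t}. ennreal ((H s \<omega> - simple_process (n k) (\<tau> k) (\<eta> k) s \<omega>)\<^sup>2) \<partial>lborel)
                > ennreal \<epsilon>}) \<longlonglongrightarrow> 0 \<and>
           (\<lambda>k. measure M {\<omega>\<in>space M.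
              \<exists>s\<in>{0..t}. \<bar>I s \<omega> - simple_integral B (n k) (\<tau> k) (\<eta> k) s \<omega>\<bar> > \<epsilon>}) \<longlonglongrightarrow> 0))"

section \<open>Laws and the Wasserstein distance\<close>

definition law :: "'a measure \<Rightarrow> ('a \<Rightarrow> real) \<Rightarrow> real measure" where
  "law M Z = distr M borel Z"

definition P2 :: "real measure set" where
  "P2 = {\<mu>. prob_space \<mu> \<and> sets \<mu> = sets borel \<and> integrable \<mu> (\<lambda>x. x\<^sup>2)}"

definition couplings :: "real measure \<Rightarrow> real measure \<Rightarrow> (real \<times> real) measure set" where
  "couplings \<mu> \<nu> = {\<gamma>. sets \<gamma> = sets (borel \<Otimes>\<^sub>M borel) \<and>
     distr \<gamma> borel fst = \<mu> \<and> distr \<gamma> borel snd = \<nu>}"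

text \<open>Used on \<^const>\<open>P2\<close> only, where the product coupling exists and all costs are integrable.\<close>

definition W2 :: "real measure \<Rightarrow> real measure \<Rightarrow> real" where
  "W2 \<mu> \<nu> = sqrt (INF \<gamma>\<in>couplings \<mu> \<nu>. (\<integral>(x, y). (x - y)\<^sup>2 \<partial>\<gamma>))"

section \<open>Mean reflected McKean--Vlasov equations\<close>

text \<open>
  In the flatness condition, \<open>dK\<close> is the Lebesgue--Stieltjes measure of \<open>K\<close>, extended to negative times
  by \<open>K 0\<close>. The integrand is nonnegative by the constraint, so the integral is taken in \<open>[0,\<infinity>]\<close> and no
  default value for non-integrable functions can interfere.
\<close>

definition deterministic_flat_solution ::
    "'a measure \<Rightarrow> (real \<Rightarrow> 'a measure) \<Rightarrow> (real \<Rightarrow> 'a \<Rightarrow> real) \<Rightarrow>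
     (real \<Rightarrow> real measure \<Rightarrow> real) \<Rightarrow> (real \<Rightarrow> real measure \<Rightarrow> real) \<Rightarrow> (real \<Rightarrow> real) \<Rightarrow> real \<Rightarrow>
     (real \<Rightarrow> 'a \<Rightarrow> real) \<Rightarrow> (real \<Rightarrow> real) \<Rightarrow> bool" where
  "deterministic_flat_solution M F B b \<sigma> h \<xi> X K \<longleftrightarrow>
     adapted_process F X \<and>
     (\<forall>\<omega>\<in>space M. continuous_on {0..} (\<lambda>t. X t \<omega>)) \<and>
     (\<forall>t\<ge>0. law M (X t) \<in> P2) \<and>
     K 0 = 0 \<and> mono_on {0..} K \<and> continuous_on {0..} K \<and>
     (\<exists>I. ito_integral M F B (\<lambda>s \<omega>. \<sigma> (X s \<omega>) (law M (X s))) I \<and>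
        (AE \<omega> in M. \<forall>t\<ge>0.
           set_integrable lborel {0..t} (\<lambda>s. b (X s \<omega>) (law M (X s))) \<and>
           X t \<omega> = \<xi> + (LINT s:{0..t}|lborel. b (X s \<omega>) (law M (X s))) + I t \<omega> + K t)) \<and>
     (\<forall>t\<ge>0. (\<integral>\<omega>. h (X t \<omega>) \<partial>M) \<ge> 0) \<and>
     (\<forall>t\<ge>0. (\<integral>\<^sup>+ s\<in>{0..t}. ennreal (\<integral>\<omega>. h (X s \<omega>) \<partial>M)
        \<partial>(interval_measure (\<lambda>s. K (max 0 s)))) = 0)"

section \<open>The space \<open>L\<^sup>2(\<Omega>, C([0,T], \<real>))\<close>\<close>

text \<open>
  A process stands for its restriction to \<open>[0,T]\<close>. Elements are not identified up to almost sure
  equality, so \<open>L2C_norm\<close> is a seminorm. The Borel sets of \<open>C([0,T], \<real>)\<close> are generated by the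
  evaluations, whence measurability is required of each \<open>X t\<close>.
\<close>

definition L2C :: "'a measure \<Rightarrow> real \<Rightarrow> (real \<Rightarrow> 'a \<Rightarrow> real) set" where
  "L2C M T = {X. (\<forall>t\<in>{0..T}. X t \<in> borel_measurable M) \<and>
     (\<forall>\<omega>\<in>space M. continuous_on {0..T} (\<lambda>t. X t \<omega>)) \<and>
     integrable M (\<lambda>\<omega>. SUP t\<in>{0..T}. \<bar>X t \<omega>\<bar>\<^sup>2)}"

definition L2C_norm :: "'a measure \<Rightarrow> real \<Rightarrow> (real \<Rightarrow> 'a \<Rightarrow> real) \<Rightarrow> real" where
  "L2C_norm M T X = sqrt (\<integral>\<omega>. (SUP t\<in>{0..T}. \<bar>X t \<omega>\<bar>\<^sup>2) \<partial>M)"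

end

theory Submission
  imports Defs
begin

text \<open>
  The difference of the unreflected parts \<open>X - K\<close> of two solutions is controlled by the Lipschitz condition
  and Doob's inequality. Flatness forces \<open>m * (K t - K' t)\<close> below \<open>M'\<close> times the largest mean difference of
  the unreflected parts: after the last time at which \<open>K - K'\<close> is small, \<open>E (h (X s))\<close> is positive, so \<open>K\<close>
  cannot grow. Gronwall's inequality for \<open>E ((X s - Y s)\<^sup>2)\<close> then gives Lipschitz dependence on the initial
  condition.

  A solution is only assumed to have a finite second moment at each time; the bound that is uniform in time
  follows by localisation along the bracket \<open>\<integral>\<^sub>0\<^sup>t \<sigma>\<^sup>2 ds\<close>. Ito integrals are accessed through their
  approximating simple integrals only: Doob's inequality holds for these by its pathwise form and independence
  of increments, and passes to the limit by Fatou's lemma.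
\<close>

section \<open>Deterministic inequalities\<close>

text \<open>The estimate closes on the whole of [0,T] at once: the reflection difference is
  deterministic and bounded by mean differences of the unreflected parts, which are bounded by the
  initial gap and the time integral of E ((X s - Y s)^2). Reflection thus only multiplies the
  classical estimate by \<open>1 + (M' / m)\<^sup>2\<close>. The obstacle is that Gronwall's
  inequality asks for a function known beforehand to be bounded. Finiteness at each single time does
  not give this, and a Doob estimate of the solution is vacuous while its bracket may have infinite
  mean. The bracket is therefore truncated. Since an Ito integral is known only as a limit in
  probability of simple integrals, the truncation happens on the simple integrals, where the bracket
  up to the next grid point is known one step ahead, and the truncated inequality is what survives
  the limit. It bounds the truncated maximum by the mean of \<open>min R A\<close> with the bracket
  \<open>A\<close>; writing this minimum as a time integral with a moving cutoff gives an integral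
  inequality for the truncated moments themselves, with constants that do not depend on R.\<close>

text \<open>The integrals of \<open>g\<close> enter through measurable majorants, so \<open>g\<close> need not be measurable.\<close>

lemma gronwall_majorant:
  fixes g :: "real \<Rightarrow> ennreal" and a C G T :: real
  assumes nonneg: "0 \<le> a" "0 < C" "0 \<le> G"
    and bounded: "\<And>t. t \<in> {0..T} \<Longrightarrow> g t \<le> ennreal G"
    and step: "\<And>t k. t \<in> {0..T} \<Longrightarrow> k \<in> borel_measurable borel \<Longrightarrow> (\<And>s. s \<in> {0..t} \<Longrightarrow> g s \<le> k s) \<Longrightarrow>
      g t \<le> ennreal a + ennreal C * (\<integral>\<^sup>+s\<in>{0..t}. k s \<partial>lborel)"
    and t: "t \<in> {0..T}"
  shows "g t \<le> ennreal (2 * a * exp (2 * C * t))"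
proof -
  \<comment> \<open>Inserting the bound \<open>S * exp (2 * C * s)\<close> into the hypothesis
    returns half of it plus \<open>a\<close>, because integrating the exponential divides by
    \<open>2 * C\<close>. The iteration halves the a priori part \<open>G\<close>; the fixed point
    of S -> a + S/2 is \<open>2 * a\<close>.\<close>
  have bound: "g t \<le> ennreal ((2 * a + G / 2 ^ n) * exp (2 * C * t))" if "t \<in> {0..T}" for n t
    using that
  proof (induction n arbitrary: t)
    case 0
    have "G * 1 \<le> (2 * a + G) * exp (2 * C * t)"
      using nonneg 0 by (intro mult_mono) auto
    then show ?case using bounded[OF 0] by (auto intro: order_trans ennreal_leI)
  next
    case (Suc n)
    define S where "S = 2 * a + G / 2 ^ n"
    have S: "0 \<le> S" using nonneg by (simp add: S_def)
    have "(\<integral>\<^sup>+s\<in>{0..t}. ennreal (S * exp (2 * C * s)) \<partial>lborel) = ennreal (S / (2 * C) * exp (2 * C * t) - S / (2 * C) * exp (2 * C * 0))"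
      using Suc.prems S nonneg
      by (intro nn_integral_FTC_Icc[where F="\<lambda>s. S / (2 * C) * exp (2 * C * s)"])
        (auto intro!: derivative_eq_intros)
    moreover have "g t \<le> ennreal a + ennreal C * (\<integral>\<^sup>+s\<in>{0..t}. ennreal (S * exp (2 * C * s)) \<partial>lborel)"
      using Suc by (intro step) (auto simp: S_def)
    ultimately have "g t \<le> ennreal a + ennreal C *
        ennreal (S / (2 * C) * exp (2 * C * t) - S / (2 * C) * exp (2 * C * 0))"
      by simp
    also have "\<dots> = ennreal (a + C * (S / (2 * C) * exp (2 * C * t) - S / (2 * C) * exp (2 * C * 0)))"
    proof -
      have "S / (2 * C) * exp (2 * C * t) - S / (2 * C) * exp (2 * C * 0)
          = S / (2 * C) * (exp (2 * C * t) - 1)"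
        by (simp add: algebra_simps)
      moreover have "0 \<le> S / (2 * C) * (exp (2 * C * t) - 1)"
        using Suc.prems S nonneg by (intro mult_nonneg_nonneg) auto
      ultimately have "0 \<le> S / (2 * C) * exp (2 * C * t) - S / (2 * C) * exp (2 * C * 0)"
        by simp
      then show ?thesis using nonneg by (simp only: ennreal_plus ennreal_mult mult_nonneg_nonneg less_imp_le)
    qed
    also have "\<dots> \<le> ennreal ((2 * a + G / 2 ^ Suc n) * exp (2 * C * t))"
    proof (rule ennreal_leI)
      have "1 \<le> exp (2 * C * t)" using Suc.prems nonneg by simp
      moreover have "C * (S / (2 * C) * exp (2 * C * t) - S / (2 * C) * exp (2 * C * 0))
          = S / 2 * exp (2 * C * t) - S / 2"
        using nonneg by (simp add: field_simps)
      moreover have "a * 1 \<le> a * exp (2 * C * t)" using calculation(1) nonneg(1)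
        by (intro mult_left_mono) auto
      moreover have "(2 * a + G / 2 ^ Suc n) * exp (2 * C * t) = a * exp (2 * C * t) + S / 2 * exp (2 * C * t)"
        by (simp add: S_def field_simps)
      ultimately show "a + C * (S / (2 * C) * exp (2 * C * t) - S / (2 * C) * exp (2 * C * 0))
          \<le> (2 * a + G / 2 ^ Suc n) * exp (2 * C * t)"
        using S by linarith
    qed
    finally show ?case .
  qed
  have "(\<lambda>n. G * (1 / 2) ^ n) \<longlonglongrightarrow> G * 0"
    by (intro tendsto_intros LIMSEQ_power_zero) auto
  then have "(\<lambda>n. ennreal ((2 * a + G / 2 ^ n) * exp (2 * C * t)))
      \<longlonglongrightarrow> ennreal ((2 * a + 0) * exp (2 * C * t))"
    by (intro tendsto_ennrealI tendsto_intros) (simp add: power_divide)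
  then show ?thesis
    using bound[OF t] by (intro LIMSEQ_le_const[of _ "ennreal (2 * a * exp (2 * C * t))"]) auto
qed

text \<open>\<open>nn_integral\<close> is monotone for arbitrary functions, so the integral of
  \<open>g\<close> lies below that of each of its majorants and the hypothesis here implies the one
  for majorants.\<close>

lemma gronwall:
  fixes g :: "real \<Rightarrow> ennreal" and a C G T :: real
  assumes "0 \<le> a" "0 < C" "0 \<le> G"
    and "\<And>t. t \<in> {0..T} \<Longrightarrow> g t \<le> ennreal G"
    and step: "\<And>t. t \<in> {0..T} \<Longrightarrow>
      g t \<le> ennreal a + ennreal C * (\<integral>\<^sup>+s\<in>{0..t}. g s \<partial>lborel)"
    and "t \<in> {0..T}"
  shows "g t \<le> ennreal (2 * a * exp (2 * C * t))"
proof (rule gronwall_majorant[OF assms(1-4) _ assms(6)])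
  fix t k assume t: "t \<in> {0..T}" and k: "\<And>s. s \<in> {0..t} \<Longrightarrow> g s \<le> (k s :: ennreal)"
  have "(\<integral>\<^sup>+s\<in>{0..t}. g s \<partial>lborel) \<le> (\<integral>\<^sup>+s\<in>{0..t}. k s \<partial>lborel)"
    using k by (intro nn_integral_mono) (auto split: split_indicator)
  then show "g t \<le> ennreal a + ennreal C * (\<integral>\<^sup>+s\<in>{0..t}. k s \<partial>lborel)"
    using step[OF t] by (meson add_left_mono mult_left_mono order_trans zero_le)
qed

section \<open>Running maxima and Doob's inequality along a single path\<close>

fun running_max :: "(nat \<Rightarrow> real) \<Rightarrow> nat \<Rightarrow> real" where
  "running_max s 0 = s 0"
| "running_max s (Suc n) = max (running_max s n) (s (Suc n))"

lemma le_running_max: "i \<le> n \<Longrightarrow> s i \<le> running_max s n"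
  by (induction n) (auto simp: le_Suc_eq max.coboundedI1)

lemma running_max_nonneg: "(\<And>i. 0 \<le> s i) \<Longrightarrow> 0 \<le> running_max s n"
  by (induction n) (auto simp: max.coboundedI1)

lemma running_max_cong: "(\<And>i. i \<le> n \<Longrightarrow> s i = s' i) \<Longrightarrow> running_max s n = running_max s' n"
  by (induction n) auto

lemma running_max_power2:
  "(\<And>i. 0 \<le> s i) \<Longrightarrow> (running_max s n)\<^sup>2 = running_max (\<lambda>i. (s i)\<^sup>2) n"
proof (induction n)
  case (Suc n)
  have "(max x y)\<^sup>2 = max (x\<^sup>2) (y\<^sup>2)" if "0 \<le> x" "0 \<le> y" for x y :: real
    using that by (simp add: max_def)
  then show ?case using Suc running_max_nonneg[of s n] by simp
qed simp

text \<open>The pathwise form of Doob's inequality due to Acciaio, Beiglboeck et al.: for a martingale \<open>N\<close>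
  the sum on the right has expectation zero.\<close>

lemma pathwise_doob:
  fixes N :: "nat \<Rightarrow> real"
  assumes "N 0 = 0"
  defines "S \<equiv> running_max (\<lambda>i. \<bar>N i\<bar>)"
  shows "(S n)\<^sup>2 \<le> 4 * (N n)\<^sup>2 - 4 * (\<Sum>i<n. S i * sgn (N i) * (N (Suc i) - N i))"
proof -
  \<comment> \<open>Summation by parts. The induction step comes down to the fact that x -> 4 x |N|
    - 2 x^2 increases up to x = |N|: the running maximum changes only by moving up to exactly this
    point.\<close>
  have sum: "4 * (\<Sum>i<n. S i * (\<bar>N (Suc i)\<bar> - \<bar>N i\<bar>)) \<le> 4 * S n * \<bar>N n\<bar> - 2 * (S n)\<^sup>2"
  proof (induction n)
    case 0
    then show ?case using assms by simp
  next
    case (Suc n)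
    have S: "S (Suc n) = max (S n) \<bar>N (Suc n)\<bar>" by (simp add: S_def)
    have "4 * S n * \<bar>N (Suc n)\<bar> - 2 * (S n)\<^sup>2 \<le> 4 * S (Suc n) * \<bar>N (Suc n)\<bar> - 2 * (S (Suc n))\<^sup>2"
    proof (cases "\<bar>N (Suc n)\<bar> \<le> S n")
      case False
      then have "S (Suc n) = \<bar>N (Suc n)\<bar>" by (simp add: S)
      moreover have "0 \<le> (\<bar>N (Suc n)\<bar> - S n)\<^sup>2" by simp
      ultimately show ?thesis
        by (simp only: power2_eq_square) (simp add: algebra_simps)
    qed (simp add: S max_def)
    then show ?case using Suc by (simp add: algebra_simps)
  qed
  \<comment> \<open>\<open>sgn x\<close> is a subgradient of the absolute value at \<open>x\<close>,
    including the value 0 at x = 0.\<close>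
  have "sgn x * (y - x) \<le> \<bar>y\<bar> - \<bar>x\<bar>" for x y :: real
    by (auto simp: sgn_if)
  moreover have "0 \<le> S i" for i by (simp add: S_def running_max_nonneg)
  ultimately have "S i * sgn (N i) * (N (Suc i) - N i) \<le> S i * (\<bar>N (Suc i)\<bar> - \<bar>N i\<bar>)" for i
    by (metis mult.assoc mult_left_mono)
  then have "(\<Sum>i<n. S i * sgn (N i) * (N (Suc i) - N i)) \<le> (\<Sum>i<n. S i * (\<bar>N (Suc i)\<bar> - \<bar>N i\<bar>))"
    by (intro sum_mono)
  moreover have "(S n)\<^sup>2 + (2 * \<bar>N n\<bar> - S n)\<^sup>2 = 4 * (N n)\<^sup>2 - (4 * S n * \<bar>N n\<bar> - 2 * (S n)\<^sup>2)"
    by (simp add: power2_eq_square algebra_simps)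
  moreover have "0 \<le> (2 * \<bar>N n\<bar> - S n)\<^sup>2" by simp
  ultimately show ?thesis using sum by linarith
qed

text \<open>In the application \<open>e s\<close> is E (h (X s)) and \<open>c\<close> is
  \<open>M'\<close> times a bound for the unreflected difference. The lower bound on
  \<open>e\<close> is asked only where \<open>K'\<close> lies below \<open>K\<close>: there the
  increasing \<open>h\<close> turns the gap between the reflections into a gain of at least
  \<open>m\<close> times the gap.\<close>

lemma reflection_le:
  fixes K K' e :: "real \<Rightarrow> real"
  assumes K: "K 0 = 0" "mono_on {0..} K" "continuous_on {0..} K"
    and K': "K' 0 = 0" "mono_on {0..} K'" "continuous_on {0..} K'"
    and flat: "(\<integral>\<^sup>+s\<in>{0..t}. ennreal (e s) \<partial>interval_measure (\<lambda>s. K (max 0 s))) = 0"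
    and lower: "\<And>s. s \<in> {0..t} \<Longrightarrow> K' s \<le> K s \<Longrightarrow> m * (K s - K' s) - c \<le> e s"
    and "0 < m" "0 \<le> c" "0 \<le> t"
  shows "m * (K t - K' t) \<le> c"
proof (rule ccontr)
  assume neg: "\<not> m * (K t - K' t) \<le> c"
  define f where "f s = m * (K (max 0 s) - K' (max 0 s)) - c" for s
  have contK: "continuous_on UNIV (\<lambda>s. K (max 0 s))" "continuous_on UNIV (\<lambda>s. K' (max 0 s))"
    by (auto intro!: continuous_on_compose2[OF K(3)] continuous_on_compose2[OF K'(3)] continuous_intros)
  then have contf: "continuous_on UNIV f" unfolding f_def by (intro continuous_intros)
  \<comment> \<open>\<open>Z\<close> contains 0, since both reflections start at 0 and
    \<open>0 \<le> c\<close>; so a last time \<open>r\<close> exists. Beyond it \<open>f\<close> is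
    strictly positive, which puts \<open>K'\<close> below \<open>K\<close> and makes
    \<open>f\<close> a minorant of \<open>e\<close>.\<close>
  define Z where "Z = {s\<in>{0..t}. f s \<le> 0}"
  have "closed {s. f s \<le> 0}" using contf by (intro closed_Collect_le continuous_intros)
  moreover have "Z = {0..t} \<inter> {s. f s \<le> 0}" by (auto simp: Z_def)
  ultimately have "compact Z" by (auto intro: compact_Int_closed)
  moreover have "0 \<in> Z" using assms by (simp add: Z_def f_def)
  ultimately obtain r where r: "r \<in> Z" "\<And>s. s \<in> Z \<Longrightarrow> s \<le> r"
    by (metis compact_attains_sup empty_iff)
  then have rt: "0 \<le> r" "r \<le> t" "f r \<le> 0" by (auto simp: Z_def)
  have pos: "0 < f s" if "s \<in> {r<..t}" for s
    using r(2)[of s] that rt by (fastforce simp: Z_def)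
  let ?\<mu> = "interval_measure (\<lambda>s. K (max 0 s))"
  have "(\<integral>\<^sup>+s\<in>{r<..t}. ennreal (f s) \<partial>?\<mu>) \<le> (\<integral>\<^sup>+s\<in>{0..t}. ennreal (e s) \<partial>?\<mu>)"
  proof (rule nn_integral_mono)
    fix s
    have "f s \<le> e s" if "s \<in> {r<..t}"
    proof -
      have "0 < m * (K s - K' s)" using pos[OF that] that rt \<open>0 \<le> c\<close> by (simp add: f_def)
      then have "K' s \<le> K s" using \<open>0 < m\<close> by (simp add: zero_less_mult_iff)
      then show ?thesis using lower[of s] that rt by (simp add: f_def)
    qed
    then show "ennreal (f s) * indicator {r<..t} s \<le> ennreal (e s) * indicator {0..t} s"
      using rt by (auto split: split_indicator intro: ennreal_leI)
  qed
  then have "(\<integral>\<^sup>+s\<in>{r<..t}. ennreal (f s) \<partial>?\<mu>) = 0" using flat by simp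
  moreover have [measurable]: "f \<in> borel_measurable borel"
    using contf by (rule borel_measurable_continuous_onI)
  ultimately have "AE s in ?\<mu>. ennreal (f s) * indicator {r<..t} s = 0"
    by (subst (asm) nn_integral_0_iff_AE) auto
  then have "AE s in ?\<mu>. s \<notin> {r<..t}"
    by eventually_elim (use pos in \<open>force split: split_indicator_asm simp: ennreal_eq_0_iff\<close>)
  moreover have "{s. r < s \<and> s \<le> t} = {r<..t}" by auto
  ultimately have "emeasure ?\<mu> {r<..t} = 0"
    by (subst (asm) AE_iff_measurable[OF _ refl]) auto
  moreover have "emeasure ?\<mu> {r<..t} = K (max 0 t) - K (max 0 r)"
  proof (rule emeasure_interval_measure_Ioc[OF rt(2)])
    show "K (max 0 x) \<le> K (max 0 y)" if "x \<le> y" for x y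
      using that by (intro mono_onD[OF K(2)]) auto
    show "continuous (at_right a) (\<lambda>s. K (max 0 s))" for a
      using contK(1) by (auto simp: continuous_on_eq_continuous_within
        intro: continuous_within_subset)
  qed
  ultimately have "K t \<le> K r" using rt by (simp add: ennreal_eq_0_iff)
  moreover have "K' r \<le> K' t" using rt by (intro mono_onD[OF K'(2)]) auto
  ultimately have "m * (K t - K' t) \<le> m * (K r - K' r)" using \<open>0 < m\<close> by simp
  then show False using neg rt by (simp add: f_def)
qed

text \<open>The joint law of the two variables is one of the couplings in the infimum, and
  nonnegative costs keep the infimum bounded below.\<close>

lemma W2_law_le:
  assumes "prob_space M" "X \<in> borel_measurable M" "Y \<in> borel_measurable M"
  shows "W2 (law M X) (law M Y) \<le> sqrt (\<integral>\<omega>. (X \<omega> - Y \<omega>)\<^sup>2 \<partial>M)"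
proof -
  let ?\<gamma> = "distr M (borel \<Otimes>\<^sub>M borel) (\<lambda>\<omega>. (X \<omega>, Y \<omega>))"
  have "?\<gamma> \<in> couplings (law M X) (law M Y)"
    using assms by (auto simp: couplings_def law_def distr_distr comp_def)
  then have "(INF \<gamma>\<in>couplings (law M X) (law M Y). (\<integral>(x, y). (x - y)\<^sup>2 \<partial>\<gamma>)) \<le> (\<integral>(x, y). (x - y)\<^sup>2 \<partial>?\<gamma>)"
    by (intro cINF_lower bdd_belowI2[where m=0]) (auto intro!: Bochner_Integration.integral_nonneg)
  also have "\<dots> = (\<integral>\<omega>. (X \<omega> - Y \<omega>)\<^sup>2 \<partial>M)"
    using assms by (subst integral_distr) auto
  finally show ?thesis by (simp add: W2_def)
qed

section \<open>Discrete martingale transforms of Brownian motion\<close>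

locale filtered_brownian = complete_filtered_prob_space M F
  for M :: "'a measure" and F +
  fixes B :: "real \<Rightarrow> 'a \<Rightarrow> real"
  assumes brownian: "brownian_motion M F B"
begin

lemma space_F: "0 \<le> s \<Longrightarrow> space (F s) = space M"
  using subalgebra_F by (simp add: subalgebra_def)

lemma measurable_F_M: "0 \<le> s \<Longrightarrow> Z \<in> borel_measurable (F s) \<Longrightarrow> Z \<in> borel_measurable M"
  using measurable_from_subalg subalgebra_F by blast

lemma measurable_F_mono:
  "0 \<le> s \<Longrightarrow> s \<le> u \<Longrightarrow> Z \<in> borel_measurable (F s) \<Longrightarrow> Z \<in> borel_measurable (F u)"
  using sets_F_mono[of s u] space_F[of s] space_F[of u] by (auto simp: measurable_def)

lemma measurable_B_F: "0 \<le> s \<Longrightarrow> B s \<in> borel_measurable (F s)"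
  using brownian by (simp add: brownian_motion_def adapted_process_def)

lemma measurable_B: "0 \<le> s \<Longrightarrow> B s \<in> borel_measurable M"
  using measurable_B_F measurable_F_M by blast

lemma indep_var_increment:
  assumes "0 \<le> s" "s < u" "Z \<in> borel_measurable (F s)"
  shows "indep_var borel Z borel (\<lambda>\<omega>. B u \<omega> - B s \<omega>)"
proof -
  let ?D = "\<lambda>\<omega>. B u \<omega> - B s \<omega>"
  let ?G = "{?D -` A \<inter> space M | A. A \<in> sets borel}"
  have Z: "Z \<in> borel_measurable M" using assms measurable_F_M by blast
  have D: "?D \<in> borel_measurable M"
    using assms by (intro borel_measurable_diff measurable_B) auto
  have indep: "indep_set (sets (F s)) ?G"
    using brownian assms unfolding brownian_motion_def by blast
  \<comment> \<open>Preimages of Borel sets already form a sigma-algebra, so the sigma-algebra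
    generated by the increment is the family in the definition of Brownian motion.\<close>
  have "sigma_sets (space M) ?G = ?G"
    using sets_vimage_algebra[of "space M" ?D borel] sets_vimage_algebra2[of ?D "space M" borel] by auto
  moreover have "sigma_sets (space M) {Z -` A \<inter> space M | A. A \<in> sets borel} \<subseteq> sets (F s)"
    using assms by (simp only: space_F[OF assms(1), symmetric], intro sets.sigma_sets_subset)
      (auto intro: measurable_sets)
  ultimately show ?thesis
    unfolding indep_var_eq using Z D indep unfolding indep_set_def
    by (auto elim!: indep_sets_mono_sets split: bool.split_asm)
qed

lemma increment_moments:
  assumes "0 \<le> s" "s < u"
  shows "integrable M (\<lambda>\<omega>. B u \<omega> - B s \<omega>)" "(\<integral>\<omega>. B u \<omega> - B s \<omega> \<partial>M) = 0"
    "integrable M (\<lambda>\<omega>. (B u \<omega> - B s \<omega>)\<^sup>2)" "(\<integral>\<omega>. (B u \<omega> - B s \<omega>)\<^sup>2 \<partial>M) = u - s"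
proof -
  let ?s = "sqrt (u - s)"
  have D: "distributed M lborel (\<lambda>\<omega>. B u \<omega> - B s \<omega>) (normal_density 0 ?s)"
    using brownian assms unfolding brownian_motion_def by blast
  have s: "0 < ?s" using assms by simp
  show "integrable M (\<lambda>\<omega>. B u \<omega> - B s \<omega>)"
    using integrable_normal_moment[OF s, of 0 1] distributed_integrable[OF D, of "\<lambda>x. x"] by simp
  show mean: "(\<integral>\<omega>. B u \<omega> - B s \<omega> \<partial>M) = 0"
    using normal_distributed_expectation[OF s D] .
  show "integrable M (\<lambda>\<omega>. (B u \<omega> - B s \<omega>)\<^sup>2)"
    using integrable_normal_moment[OF s, of 0 2] distributed_integrable[OF D, of "\<lambda>x. x\<^sup>2"] by simp
  show "(\<integral>\<omega>. (B u \<omega> - B s \<omega>)\<^sup>2 \<partial>M) = u - s"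
    using normal_distributed_variance[OF s D] assms unfolding mean by simp
qed

lemma mult_increment_moments:
  assumes "0 \<le> s" "s \<le> u" "Z \<in> borel_measurable (F s)" "integrable M Z"
  shows "integrable M (\<lambda>\<omega>. Z \<omega> * (B u \<omega> - B s \<omega>))" "(\<integral>\<omega>. Z \<omega> * (B u \<omega> - B s \<omega>) \<partial>M) = 0"
    "integrable M (\<lambda>\<omega>. Z \<omega> * (B u \<omega> - B s \<omega>)\<^sup>2)"
    "(\<integral>\<omega>. Z \<omega> * (B u \<omega> - B s \<omega>)\<^sup>2 \<partial>M) = (u - s) * (\<integral>\<omega>. Z \<omega> \<partial>M)"
proof (atomize (full), cases "s = u")
  case False
  then have su: "s < u" using assms by simp
  have i: "indep_var borel Z borel (\<lambda>\<omega>. B u \<omega> - B s \<omega>)"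
    using indep_var_increment[OF assms(1) su assms(3)] .
  have i2: "indep_var borel Z borel (\<lambda>\<omega>. (B u \<omega> - B s \<omega>)\<^sup>2)"
    using indep_var_compose[OF i, of "\<lambda>x. x" borel "\<lambda>x. x\<^sup>2" borel] by (simp add: comp_def)
  note m = increment_moments[OF assms(1) su]
  show "(integrable M (\<lambda>\<omega>. Z \<omega> * (B u \<omega> - B s \<omega>)) \<and> (\<integral>\<omega>. Z \<omega> * (B u \<omega> - B s \<omega>) \<partial>M) = 0) \<and>
    integrable M (\<lambda>\<omega>. Z \<omega> * (B u \<omega> - B s \<omega>)\<^sup>2) \<and>
    (\<integral>\<omega>. Z \<omega> * (B u \<omega> - B s \<omega>)\<^sup>2 \<partial>M) = (u - s) * (\<integral>\<omega>. Z \<omega> \<partial>M)"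
    using indep_var_integrable[OF i assms(4) m(1)] indep_var_lebesgue_integral[OF i assms(4) m(1)]
      indep_var_integrable[OF i2 assms(4) m(3)] indep_var_lebesgue_integral[OF i2 assms(4) m(3)] m
    by simp
qed simp

end

text \<open>The grid is an infinite, weakly increasing sequence. A finite partition is continued by
  repeating its last point, where all increments vanish, so indices never run out of range.\<close>

locale brownian_transform = filtered_brownian +
  fixes t :: "nat \<Rightarrow> real" and G :: "nat \<Rightarrow> 'a \<Rightarrow> real"
  assumes grid_nonneg: "0 \<le> t 0" and grid_mono: "mono t"
    and weight_measurable: "\<And>i. G i \<in> borel_measurable (F (t i))"
    and weight_bounded: "\<And>i. \<exists>C. \<forall>\<omega>\<in>space M. \<bar>G i \<omega>\<bar> \<le> C"
begin

definition transform :: "nat \<Rightarrow> 'a \<Rightarrow> real" where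
  "transform n \<omega> = (\<Sum>i<n. G i \<omega> * (B (t (Suc i)) \<omega> - B (t i) \<omega>))"

definition bracket :: "nat \<Rightarrow> 'a \<Rightarrow> real" where
  "bracket n \<omega> = (\<Sum>i<n. (G i \<omega>)\<^sup>2 * (t (Suc i) - t i))"

lemma grid: "0 \<le> t i" "t i \<le> t (Suc i)" "i \<le> j \<Longrightarrow> t i \<le> t j"
  using grid_nonneg grid_mono by (auto simp: mono_def intro: order_trans[of 0 "t 0"])

lemma weight_measurable_later: "i \<le> j \<Longrightarrow> G i \<in> borel_measurable (F (t j))"
  using measurable_F_mono[OF grid(1) grid(3) weight_measurable] .

lemma weight_measurable_M [measurable]: "G i \<in> borel_measurable M"
  using measurable_F_M[OF grid(1) weight_measurable] .

lemma measurable_B_grid [measurable]: "B (t i) \<in> borel_measurable M"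
  using measurable_B[OF grid(1)] .

lemma transform_measurable: "transform n \<in> borel_measurable (F (t n))"
  unfolding transform_def
  by (intro borel_measurable_sum borel_measurable_times borel_measurable_diff weight_measurable_later
      measurable_F_mono[OF grid(1) grid(3) measurable_B_F[OF grid(1)]]) auto

lemma transform_measurable_M [measurable]: "transform n \<in> borel_measurable M"
  using measurable_F_M[OF grid(1) transform_measurable] .

lemma bracket_measurable: "bracket (Suc n) \<in> borel_measurable (F (t n))"
  unfolding bracket_def
  by (intro borel_measurable_sum borel_measurable_times borel_measurable_power weight_measurable_later) auto

lemma bracket_measurable_M [measurable]: "bracket n \<in> borel_measurable M"
  unfolding bracket_def by measurable

lemma bracket_mono: "i \<le> j \<Longrightarrow> bracket i \<omega> \<le> bracket j \<omega>"
  unfolding bracket_def using grid by (intro sum_mono2) auto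

lemma bracket_nonneg: "0 \<le> bracket i \<omega>"
  unfolding bracket_def using grid by (intro sum_nonneg) auto

lemma integrable_mult_weight:
  assumes "integrable M Z" shows "integrable M (\<lambda>\<omega>. Z \<omega> * G i \<omega>)"
proof -
  obtain C where C: "\<forall>\<omega>\<in>space M. \<bar>G i \<omega>\<bar> \<le> C" using weight_bounded by blast
  show ?thesis
  proof (rule Bochner_Integration.integrable_bound)
    show "integrable M (\<lambda>\<omega>. Z \<omega> * C)" using assms by simp
    show "AE \<omega> in M. norm (Z \<omega> * G i \<omega>) \<le> norm (Z \<omega> * C)"
      using C by (intro AE_I2) (auto simp: abs_mult intro!: mult_left_mono[OF _ abs_ge_zero] order_trans[OF _ abs_ge_self])
  qed (use assms in simp)
qed

lemma integrable_weight_power2: "integrable M (\<lambda>\<omega>. (G i \<omega>)\<^sup>2)"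
  using integrable_mult_weight[OF integrable_mult_weight[OF integrable_const[of 1]], of i i]
  by (simp add: power2_eq_square)

lemma integrable_bracket: "integrable M (bracket n)"
  unfolding bracket_def by (intro Bochner_Integration.integrable_sum integrable_mult_left integrable_weight_power2)

text \<open>Discrete Ito isometry. In the square of the next sum the mixed term has a factor known
  at \<open>t n\<close> and an increment of mean zero; in the quadratic term the squared increment
  is independent of the weight and contributes its mean \<open>t (Suc n) - t n\<close>.\<close>

lemma transform_second_moment:
  "integrable M (\<lambda>\<omega>. (transform n \<omega>)\<^sup>2) \<and> (\<integral>\<omega>. (transform n \<omega>)\<^sup>2 \<partial>M) = (\<integral>\<omega>. bracket n \<omega> \<partial>M)"
proof (induction n)
  case 0
  then show ?case by (simp add: transform_def bracket_def)
next
  case (Suc n)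
  let ?D = "\<lambda>\<omega>. B (t (Suc n)) \<omega> - B (t n) \<omega>"
  have N: "integrable M (transform n)"
    by (rule square_integrable_imp_integrable[OF transform_measurable_M conjunct1[OF Suc]])
  have "integrable M (\<lambda>\<omega>. 2 * (transform n \<omega> * G n \<omega>))"
    using integrable_mult_weight[OF N] by simp
  then have 1: "integrable M (\<lambda>\<omega>. 2 * (transform n \<omega> * G n \<omega>) * ?D \<omega>)"
      "(\<integral>\<omega>. 2 * (transform n \<omega> * G n \<omega>) * ?D \<omega> \<partial>M) = 0"
    using mult_increment_moments[OF grid(1) grid(2), of "\<lambda>\<omega>. 2 * (transform n \<omega> * G n \<omega>)" n]
      transform_measurable[of n] weight_measurable[of n] by simp_all
  have 2: "integrable M (\<lambda>\<omega>. (G n \<omega>)\<^sup>2 * (?D \<omega>)\<^sup>2)"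
      "(\<integral>\<omega>. (G n \<omega>)\<^sup>2 * (?D \<omega>)\<^sup>2 \<partial>M) = (t (Suc n) - t n) * (\<integral>\<omega>. (G n \<omega>)\<^sup>2 \<partial>M)"
    using mult_increment_moments[OF grid(1) grid(2), of "\<lambda>\<omega>. (G n \<omega>)\<^sup>2" n]
      weight_measurable[of n] integrable_weight_power2 by simp_all
  have "(transform (Suc n) \<omega>)\<^sup>2 = (transform n \<omega>)\<^sup>2
      + (2 * (transform n \<omega> * G n \<omega>) * ?D \<omega> + (G n \<omega>)\<^sup>2 * (?D \<omega>)\<^sup>2)" for \<omega>
    by (simp add: transform_def power2_eq_square algebra_simps)
  moreover have "bracket (Suc n) \<omega> = bracket n \<omega> + (t (Suc n) - t n) * (G n \<omega>)\<^sup>2" for \<omega>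
    by (simp add: bracket_def)
  ultimately show ?case
    using Suc 1 2 integrable_bracket[of n] integrable_weight_power2[of n] by simp
qed

text \<open>The sum in \<open>pathwise_doob\<close> is again a transform, with weights
  \<open>Z i\<close> known at \<open>t i\<close>, so its expectation vanishes. What remains is four
  times the second moment, which the isometry turns into the bracket.\<close>

lemma doob_transform:
  "integrable M (\<lambda>\<omega>. (running_max (\<lambda>i. \<bar>transform i \<omega>\<bar>) n)\<^sup>2) \<and>
   (\<integral>\<omega>. (running_max (\<lambda>i. \<bar>transform i \<omega>\<bar>) n)\<^sup>2 \<partial>M) \<le> 4 * (\<integral>\<omega>. bracket n \<omega> \<partial>M)"
proof -
  define S where "S n \<omega> = running_max (\<lambda>i. \<bar>transform i \<omega>\<bar>) n" for n \<omega>
  let ?D = "\<lambda>i \<omega>. B (t (Suc i)) \<omega> - B (t i) \<omega>"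
  have S_meas: "S n \<in> borel_measurable (F (t n))" for n
  proof (induction n)
    case 0
    then show ?case using transform_measurable[of 0] by (simp add: S_def)
  next
    case (Suc n)
    have "S (Suc n) = (\<lambda>\<omega>. max (S n \<omega>) \<bar>transform (Suc n) \<omega>\<bar>)" by (auto simp: S_def)
    then show ?case
      using measurable_F_mono[OF grid(1) grid(2) Suc] transform_measurable[of "Suc n"] by simp
  qed
  have S_meas_M[measurable]: "S n \<in> borel_measurable M" for n
    using measurable_F_M[OF grid(1) S_meas] .
  have S_nonneg: "0 \<le> S n \<omega>" for n \<omega> by (simp add: S_def running_max_nonneg)
  have S2_int: "integrable M (\<lambda>\<omega>. (S n \<omega>)\<^sup>2)" for n
  proof (induction n)
    case 0
    then show ?case by (simp add: S_def transform_def)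
  next
    case (Suc n)
    have "integrable M (\<lambda>\<omega>. (S n \<omega>)\<^sup>2 + (transform (Suc n) \<omega>)\<^sup>2)"
      using Suc transform_second_moment[of "Suc n"] by simp
    then show ?case
      by (rule Bochner_Integration.integrable_bound) (measurable, auto simp: S_def max_def)
  qed
  have S_int: "integrable M (S n)" for n
    by (rule square_integrable_imp_integrable[OF S_meas_M S2_int])
  define Z where "Z i \<omega> = S i \<omega> * sgn (transform i \<omega>) * G i \<omega>" for i \<omega>
  have Z_meas: "Z i \<in> borel_measurable (F (t i))" for i
    unfolding Z_def using S_meas[of i] transform_measurable[of i] weight_measurable[of i] by measurable
  have Z_int: "integrable M (Z i)" for i
    unfolding Z_def
    by (intro integrable_mult_weight, rule Bochner_Integration.integrable_bound[OF S_int[of i]])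
      (auto simp: abs_mult sgn_if)
  have Z: "integrable M (\<lambda>\<omega>. Z i \<omega> * ?D i \<omega>)" "(\<integral>\<omega>. Z i \<omega> * ?D i \<omega> \<partial>M) = 0" for i
    using mult_increment_moments[OF grid(1) grid(2) Z_meas Z_int] by auto
  have "(S n \<omega>)\<^sup>2 \<le> 4 * (transform n \<omega>)\<^sup>2 - 4 * (\<Sum>i<n. Z i \<omega> * ?D i \<omega>)" for \<omega>
    using pathwise_doob[of "\<lambda>i. transform i \<omega>" n]
    by (simp add: S_def Z_def transform_def mult.assoc)
  then have "(\<integral>\<omega>. (S n \<omega>)\<^sup>2 \<partial>M)
      \<le> (\<integral>\<omega>. 4 * (transform n \<omega>)\<^sup>2 - 4 * (\<Sum>i<n. Z i \<omega> * ?D i \<omega>) \<partial>M)"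
    using S2_int transform_second_moment Z by (intro integral_mono) auto
  also have "\<dots> = 4 * (\<integral>\<omega>. (transform n \<omega>)\<^sup>2 \<partial>M)"
    using transform_second_moment Z by simp
  finally show ?thesis using S2_int transform_second_moment by (simp add: S_def)
qed

text \<open>Localisation without stopping times: \<open>bracket (Suc i)\<close> is known at time \<open>t i\<close>, so the weights can be
  switched off before the bracket exceeds \<open>R\<close>.\<close>

lemma doob_transform_localized:
  assumes "0 \<le> R"
  shows "(\<integral>\<^sup>+\<omega>. ennreal (indicator {..R} (bracket n \<omega>) * running_max (\<lambda>i. (transform i \<omega>)\<^sup>2) n) \<partial>M)
    \<le> 4 * (\<integral>\<^sup>+\<omega>. ennreal (min R (bracket n \<omega>)) \<partial>M)"
proof -
  define G' where "G' i \<omega> = G i \<omega> * indicator {..R} (bracket (Suc i) \<omega>)" for i \<omega>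
  interpret loc: brownian_transform M F B t G'
  proof
    fix i
    show "G' i \<in> borel_measurable (F (t i))"
      unfolding G'_def using weight_measurable[of i] bracket_measurable[of i] by measurable
    obtain C where "\<forall>\<omega>\<in>space M. \<bar>G i \<omega>\<bar> \<le> C" using weight_bounded by blast
    then have "\<forall>\<omega>\<in>space M. \<bar>G' i \<omega>\<bar> \<le> max C 0"
      by (force simp: G'_def split: split_indicator)
    then show "\<exists>C. \<forall>\<omega>\<in>space M. \<bar>G' i \<omega>\<bar> \<le> C" by blast
  qed (use grid_nonneg grid_mono in auto)
  \<comment> \<open>A step is counted only if the full bracket after it is still at most
    \<open>R\<close>, so the truncated bracket cannot overshoot.\<close>
  have bracket_le: "loc.bracket n \<omega> \<le> min R (bracket n \<omega>)" for n \<omega>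
  proof (induction n)
    case 0
    then show ?case using assms by (simp add: loc.bracket_def bracket_def)
  next
    case (Suc n)
    have "loc.bracket (Suc n) \<omega>
        = loc.bracket n \<omega> + indicator {..R} (bracket (Suc n) \<omega>) * ((G n \<omega>)\<^sup>2 * (t (Suc n) - t n))"
      by (simp add: loc.bracket_def G'_def split: split_indicator)
    moreover have "bracket (Suc n) \<omega> = bracket n \<omega> + (G n \<omega>)\<^sup>2 * (t (Suc n) - t n)"
      by (simp add: bracket_def)
    ultimately show ?case
      using Suc bracket_mono[of n "Suc n" \<omega>] by (auto split: split_indicator)
  qed
  \<comment> \<open>The bracket increases, so if its final value is at most \<open>R\<close>, no
    weight before \<open>n\<close> has been switched off.\<close>
  have eq: "loc.transform i \<omega> = transform i \<omega>" if "bracket n \<omega> \<le> R" "i \<le> n" for i \<omega>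
    unfolding loc.transform_def transform_def
  proof (intro sum.cong refl)
    fix j assume "j \<in> {..<i}"
    then have "bracket (Suc j) \<omega> \<le> R" using bracket_mono[of "Suc j" n \<omega>] that by auto
    then show "G' j \<omega> * (B (t (Suc j)) \<omega> - B (t j) \<omega>) = G j \<omega> * (B (t (Suc j)) \<omega> - B (t j) \<omega>)"
      by (simp add: G'_def)
  qed
  let ?S = "\<lambda>\<omega>. (running_max (\<lambda>i. \<bar>loc.transform i \<omega>\<bar>) n)\<^sup>2"
  have "indicator {..R} (bracket n \<omega>) * running_max (\<lambda>i. (transform i \<omega>)\<^sup>2) n \<le> ?S \<omega>" for \<omega>
  proof (cases "bracket n \<omega> \<le> R")
    case True
    then have "?S \<omega> = (running_max (\<lambda>i. \<bar>transform i \<omega>\<bar>) n)\<^sup>2"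
      using running_max_cong[of n "\<lambda>i. \<bar>loc.transform i \<omega>\<bar>" "\<lambda>i. \<bar>transform i \<omega>\<bar>"] eq by simp
    then show ?thesis using True by (simp add: running_max_power2)
  qed simp
  then have "(\<integral>\<^sup>+\<omega>. ennreal (indicator {..R} (bracket n \<omega>) * running_max (\<lambda>i. (transform i \<omega>)\<^sup>2) n) \<partial>M)
      \<le> (\<integral>\<^sup>+\<omega>. ennreal (?S \<omega>) \<partial>M)"
    by (intro nn_integral_mono ennreal_leI)
  also have "\<dots> = ennreal (\<integral>\<omega>. ?S \<omega> \<partial>M)"
    using loc.doob_transform[of n] by (intro nn_integral_eq_integral) auto
  also have "\<dots> \<le> ennreal (4 * (\<integral>\<omega>. loc.bracket n \<omega> \<partial>M))"
    using loc.doob_transform[of n] by (intro ennreal_leI) auto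
  also have "\<dots> = 4 * (\<integral>\<^sup>+\<omega>. ennreal (loc.bracket n \<omega>) \<partial>M)"
    using loc.integrable_bracket[of n] loc.bracket_nonneg
    by (subst nn_integral_eq_integral) (auto simp: ennreal_mult'')
  also have "\<dots> \<le> 4 * (\<integral>\<^sup>+\<omega>. ennreal (min R (bracket n \<omega>)) \<partial>M)"
    by (intro mult_left_mono nn_integral_mono ennreal_leI bracket_le) auto
  finally show ?thesis .
qed

end

section \<open>Elementary integrals\<close>

context filtered_brownian
begin

text \<open>An elementary pair is an integrand that is piecewise constant on a deterministic partition, together
  with its integral. Describing it by increments rather than by a representing sum makes it closed
  under linear combinations without a common refinement.\<close>

definition elementary :: "(real \<Rightarrow> 'a \<Rightarrow> real) \<Rightarrow> (real \<Rightarrow> 'a \<Rightarrow> real) \<Rightarrow> bool" where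
  "elementary H N \<longleftrightarrow>
    (\<lambda>(s, \<omega>). H s \<omega>) \<in> borel_measurable (borel \<Otimes>\<^sub>M M) \<and>
    (\<forall>s\<ge>0. N s \<in> borel_measurable M) \<and> (\<forall>\<omega>. N 0 \<omega> = 0) \<and>
    (\<exists>P. finite P \<and> (\<forall>s u. 0 \<le> s \<longrightarrow> s < u \<longrightarrow> P \<inter> {s<..<u} = {} \<longrightarrow>
      H u \<in> borel_measurable (F s) \<and> (\<exists>C. \<forall>\<omega>\<in>space M. \<bar>H u \<omega>\<bar> \<le> C) \<and>
      (\<forall>r\<in>{s<..u}. \<forall>\<omega>. H r \<omega> = H u \<omega>) \<and>
      (\<forall>\<omega>. N u \<omega> - N s \<omega> = H u \<omega> * (B u \<omega> - B s \<omega>))))"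

lemma elementary_zero: "elementary (\<lambda>_ _. 0) (\<lambda>_ _. 0)"
  unfolding elementary_def by (auto intro!: exI[of _ "{}"])

lemma elementary_linear:
  assumes 1: "elementary H\<^sub>1 N\<^sub>1" and 2: "elementary H\<^sub>2 N\<^sub>2"
  shows "elementary (\<lambda>s \<omega>. H\<^sub>1 s \<omega> + c * H\<^sub>2 s \<omega>) (\<lambda>s \<omega>. N\<^sub>1 s \<omega> + c * N\<^sub>2 s \<omega>)"
proof -
  obtain P\<^sub>1 where P1: "finite P\<^sub>1" "\<And>s u. 0 \<le> s \<Longrightarrow> s < u \<Longrightarrow> P\<^sub>1 \<inter> {s<..<u} = {} \<Longrightarrow>
      H\<^sub>1 u \<in> borel_measurable (F s) \<and> (\<exists>C. \<forall>\<omega>\<in>space M. \<bar>H\<^sub>1 u \<omega>\<bar> \<le> C) \<and>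
      (\<forall>r\<in>{s<..u}. \<forall>\<omega>. H\<^sub>1 r \<omega> = H\<^sub>1 u \<omega>) \<and>
      (\<forall>\<omega>. N\<^sub>1 u \<omega> - N\<^sub>1 s \<omega> = H\<^sub>1 u \<omega> * (B u \<omega> - B s \<omega>))"
    using 1 unfolding elementary_def by blast
  obtain P\<^sub>2 where P2: "finite P\<^sub>2" "\<And>s u. 0 \<le> s \<Longrightarrow> s < u \<Longrightarrow> P\<^sub>2 \<inter> {s<..<u} = {} \<Longrightarrow>
      H\<^sub>2 u \<in> borel_measurable (F s) \<and> (\<exists>C. \<forall>\<omega>\<in>space M. \<bar>H\<^sub>2 u \<omega>\<bar> \<le> C) \<and>
      (\<forall>r\<in>{s<..u}. \<forall>\<omega>. H\<^sub>2 r \<omega> = H\<^sub>2 u \<omega>) \<and>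
      (\<forall>\<omega>. N\<^sub>2 u \<omega> - N\<^sub>2 s \<omega> = H\<^sub>2 u \<omega> * (B u \<omega> - B s \<omega>))"
    using 2 unfolding elementary_def by blast
  have [measurable]: "(\<lambda>(s, \<omega>). H\<^sub>1 s \<omega>) \<in> borel_measurable (borel \<Otimes>\<^sub>M M)"
    "(\<lambda>(s, \<omega>). H\<^sub>2 s \<omega>) \<in> borel_measurable (borel \<Otimes>\<^sub>M M)"
    using 1 2 by (auto simp: elementary_def)
  show ?thesis
    unfolding elementary_def
  proof (intro conjI exI[of _ "P\<^sub>1 \<union> P\<^sub>2"] allI impI)
    fix s u :: real assume su: "0 \<le> s" "s < u" "(P\<^sub>1 \<union> P\<^sub>2) \<inter> {s<..<u} = {}"
    then have "P\<^sub>1 \<inter> {s<..<u} = {}" "P\<^sub>2 \<inter> {s<..<u} = {}" by auto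
    note h1 = P1(2)[OF su(1,2) this(1)] and h2 = P2(2)[OF su(1,2) this(2)]
    show "(\<lambda>\<omega>. H\<^sub>1 u \<omega> + c * H\<^sub>2 u \<omega>) \<in> borel_measurable (F s)"
      using h1 h2 by (intro borel_measurable_add borel_measurable_times) auto
    obtain C\<^sub>1 C\<^sub>2 where C: "\<forall>\<omega>\<in>space M. \<bar>H\<^sub>1 u \<omega>\<bar> \<le> C\<^sub>1" "\<forall>\<omega>\<in>space M. \<bar>H\<^sub>2 u \<omega>\<bar> \<le> C\<^sub>2"
      using h1 h2 by blast
    show "\<exists>C. \<forall>\<omega>\<in>space M. \<bar>H\<^sub>1 u \<omega> + c * H\<^sub>2 u \<omega>\<bar> \<le> C"
    proof (intro exI[of _ "C\<^sub>1 + \<bar>c\<bar> * C\<^sub>2"] ballI)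
      fix \<omega> assume "\<omega> \<in> space M"
      then have "\<bar>H\<^sub>1 u \<omega>\<bar> \<le> C\<^sub>1" "\<bar>c * H\<^sub>2 u \<omega>\<bar> \<le> \<bar>c\<bar> * C\<^sub>2"
        using C by (auto simp: abs_mult mult_left_mono)
      then show "\<bar>H\<^sub>1 u \<omega> + c * H\<^sub>2 u \<omega>\<bar> \<le> C\<^sub>1 + \<bar>c\<bar> * C\<^sub>2" by linarith
    qed
    show "\<forall>r\<in>{s<..u}. \<forall>\<omega>. H\<^sub>1 r \<omega> + c * H\<^sub>2 r \<omega> = H\<^sub>1 u \<omega> + c * H\<^sub>2 u \<omega>"
    proof (intro ballI allI)
      fix r \<omega> assume "r \<in> {s<..u}"
      then have "H\<^sub>1 r \<omega> = H\<^sub>1 u \<omega>" "H\<^sub>2 r \<omega> = H\<^sub>2 u \<omega>" using h1 h2 by blast+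
      then show "H\<^sub>1 r \<omega> + c * H\<^sub>2 r \<omega> = H\<^sub>1 u \<omega> + c * H\<^sub>2 u \<omega>" by simp
    qed
    fix \<omega>
    have "N\<^sub>1 u \<omega> - N\<^sub>1 s \<omega> = H\<^sub>1 u \<omega> * (B u \<omega> - B s \<omega>)" "N\<^sub>2 u \<omega> - N\<^sub>2 s \<omega> = H\<^sub>2 u \<omega> * (B u \<omega> - B s \<omega>)"
      using h1 h2 by blast+
    moreover have "N\<^sub>1 u \<omega> + c * N\<^sub>2 u \<omega> - (N\<^sub>1 s \<omega> + c * N\<^sub>2 s \<omega>)
        = (N\<^sub>1 u \<omega> - N\<^sub>1 s \<omega>) + c * (N\<^sub>2 u \<omega> - N\<^sub>2 s \<omega>)" by (simp add: algebra_simps)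
    ultimately show "N\<^sub>1 u \<omega> + c * N\<^sub>2 u \<omega> - (N\<^sub>1 s \<omega> + c * N\<^sub>2 s \<omega>)
        = (H\<^sub>1 u \<omega> + c * H\<^sub>2 u \<omega>) * (B u \<omega> - B s \<omega>)" by (simp only: distrib_right mult.assoc)
  next
    fix s :: real assume "0 \<le> s"
    then have "N\<^sub>1 s \<in> borel_measurable M" "N\<^sub>2 s \<in> borel_measurable M"
      using 1 2 unfolding elementary_def by blast+
    then show "(\<lambda>\<omega>. N\<^sub>1 s \<omega> + c * N\<^sub>2 s \<omega>) \<in> borel_measurable M" by simp
  next
    show "N\<^sub>1 0 \<omega> + c * N\<^sub>2 0 \<omega> = 0" for \<omega>
      using 1 2 by (simp add: elementary_def)
  qed (use P1(1) P2(1) in auto)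
qed

lemma elementary_single:
  assumes "0 \<le> a" "a \<le> b" "\<eta> \<in> borel_measurable (F a)" "\<exists>C. \<forall>\<omega>\<in>space M. \<bar>\<eta> \<omega>\<bar> \<le> C"
  shows "elementary (\<lambda>s \<omega>. \<eta> \<omega> * indicator {a<..b} s) (\<lambda>s \<omega>. \<eta> \<omega> * (B (min b s) \<omega> - B (min a s) \<omega>))"
proof -
  have [measurable]: "\<eta> \<in> borel_measurable M" using assms measurable_F_M by blast
  obtain C where C: "\<forall>\<omega>\<in>space M. \<bar>\<eta> \<omega>\<bar> \<le> C" using assms by blast
  show ?thesis
    unfolding elementary_def
  proof (intro conjI exI[of _ "{a, b}"] allI impI)
    fix s u :: real assume su: "0 \<le> s" "s < u" "{a, b} \<inter> {s<..<u} = {}"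
    then have a: "a \<le> s \<or> u \<le> a" and b: "b \<le> s \<or> u \<le> b" by (auto simp: not_less)
    \<comment> \<open>An interval with neither \<open>a\<close> nor \<open>b\<close> in its interior
      lies to one side of each. To the right of \<open>a\<close> the weight is known at
      \<open>s\<close>; to the left the indicator is zero and measurability is trivial.\<close>
    have \<eta>: "\<eta> \<in> borel_measurable (F s)" if "a < u"
      using measurable_F_mono[OF assms(1) _ assms(3)] a that by auto
    show "(\<lambda>\<omega>. \<eta> \<omega> * indicator {a<..b} u) \<in> borel_measurable (F s)"
      using \<eta> by (cases "a < u") auto
    show "\<exists>C. \<forall>\<omega>\<in>space M. \<bar>\<eta> \<omega> * indicator {a<..b} u\<bar> \<le> C"
      using C by (intro exI[of _ "max C 0"]) (force split: split_indicator)
    show "\<forall>r\<in>{s<..u}. \<forall>\<omega>. \<eta> \<omega> * indicator {a<..b} r = \<eta> \<omega> * indicator {a<..b} u"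
      using a b by (auto split: split_indicator)
    show "\<eta> \<omega> * (B (min b u) \<omega> - B (min a u) \<omega>) - \<eta> \<omega> * (B (min b s) \<omega> - B (min a s) \<omega>)
        = \<eta> \<omega> * indicator {a<..b} u * (B u \<omega> - B s \<omega>)" for \<omega>
      using a b su assms(2)
      by (auto simp: min_absorb1 min_absorb2 algebra_simps split: split_indicator)
  next
    fix s :: real assume "0 \<le> s"
    then have [measurable]: "B (min b s) \<in> borel_measurable M" "B (min a s) \<in> borel_measurable M"
      using assms by (auto intro: measurable_B)
    show "(\<lambda>\<omega>. \<eta> \<omega> * (B (min b s) \<omega> - B (min a s) \<omega>)) \<in> borel_measurable M" by measurable
  qed (use assms in \<open>auto simp: min_absorb2\<close>)
qed

lemma elementary_simple:
  assumes "simple_integrand F n \<tau> \<eta>"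
  shows "elementary (simple_process n \<tau> \<eta>) (simple_integral B n \<tau> \<eta>)"
proof -
  have nonneg: "0 \<le> \<tau> i" "\<tau> i \<le> \<tau> (Suc i)" if "i < n" for i
    using assms that mono_onD[of "{..n}" \<tau> 0 i] mono_onD[of "{..n}" \<tau> i "Suc i"]
    by (auto simp: simple_integrand_def intro: order_trans[of 0 "\<tau> 0"])
  have "k \<le> n \<Longrightarrow> elementary (simple_process k \<tau> \<eta>) (simple_integral B k \<tau> \<eta>)" for k
  proof (induction k)
    case 0
    then show ?case using elementary_zero by (simp add: simple_process_def[abs_def] simple_integral_def[abs_def])
  next
    case (Suc k)
    have "elementary (\<lambda>s \<omega>. \<eta> k \<omega> * indicator {\<tau> k<..\<tau> (Suc k)} s)
        (\<lambda>s \<omega>. \<eta> k \<omega> * (B (min (\<tau> (Suc k)) s) \<omega> - B (min (\<tau> k) s) \<omega>))"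
      using Suc.prems assms nonneg[of k] space_F[of "\<tau> k"]
      by (intro elementary_single) (auto simp: simple_integrand_def Suc_le_eq dest!: spec[of _ k])
    from elementary_linear[OF Suc.IH this, of 1] Suc.prems show ?case
      unfolding simple_process_def[abs_def] simple_integral_def[abs_def] sum.lessThan_Suc mult_1 by simp
  qed
  then show ?thesis by blast
qed

text \<open>The times in \<open>S\<close>, the break points of \<open>H\<close> and the two end
  points together form one grid. On it \<open>N\<close> is a discrete transform, its running maximum
  dominates the supremum over \<open>S\<close>, and its bracket at the last point is the whole time
  integral \<open>A\<close>.\<close>

lemma doob_elementary:
  assumes "elementary H N" "finite S" "S \<subseteq> {0..T}" "0 \<le> T" "0 \<le> R"
  defines "A \<equiv> \<lambda>\<omega>. \<integral>\<^sup>+s\<in>{0..T}. ennreal ((H s \<omega>)\<^sup>2) \<partial>lborel"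
  shows "(\<integral>\<^sup>+\<omega>. indicator {..ennreal R} (A \<omega>) * (SUP s\<in>S. ennreal ((N s \<omega>)\<^sup>2)) \<partial>M)
    \<le> 4 * (\<integral>\<^sup>+\<omega>. min (ennreal R) (A \<omega>) \<partial>M)"
proof -
  obtain P where P: "finite P" "\<And>s u. 0 \<le> s \<Longrightarrow> s < u \<Longrightarrow> P \<inter> {s<..<u} = {} \<Longrightarrow>
      H u \<in> borel_measurable (F s) \<and> (\<exists>C. \<forall>\<omega>\<in>space M. \<bar>H u \<omega>\<bar> \<le> C) \<and>
      (\<forall>r\<in>{s<..u}. \<forall>\<omega>. H r \<omega> = H u \<omega>) \<and>
      (\<forall>\<omega>. N u \<omega> - N s \<omega> = H u \<omega> * (B u \<omega> - B s \<omega>))"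
    and N0: "\<And>\<omega>. N 0 \<omega> = 0"
    and H[measurable]: "(\<lambda>(s, \<omega>). H s \<omega>) \<in> borel_measurable (borel \<Otimes>\<^sub>M M)"
    using assms(1) unfolding elementary_def by blast
  define S' where "S' = insert 0 (insert T (S \<union> (P \<inter> {0..T})))"
  have S': "finite S'" "S' \<subseteq> {0..T}" "0 \<in> S'" "T \<in> S'" "S \<subseteq> S'" "P \<inter> {0..T} \<subseteq> S'"
    using assms P by (auto simp: S'_def)
  define xs where "xs = sorted_list_of_set S'"
  have xs: "set xs = S'" "sorted xs" "distinct xs" "xs \<noteq> []" using S' by (auto simp: xs_def)
  define n where "n = length xs - 1"
  define t where "t i = xs ! min i n" for i
  have len: "min i n < length xs" for i using xs(4) by (cases xs) (auto simp: n_def)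
  have t_in: "t i \<in> S'" for i using nth_mem[OF len[of i]] xs(1) by (auto simp: t_def)
  have t_mono: "mono t"
    unfolding mono_def t_def using xs(2) len by (auto intro!: sorted_nth_mono)
  have t_surj: "\<exists>i\<le>n. t i = s" if s: "s \<in> S'" for s
  proof -
    obtain i where "i < length xs" "xs ! i = s" using s unfolding xs(1)[symmetric] in_set_conv_nth by blast
    then show ?thesis by (intro exI[of _ i]) (auto simp: n_def t_def min_absorb1)
  qed
  have t_nonneg: "0 \<le> t i" for i using t_in[of i] S' by auto
  have t0: "t 0 = 0"
  proof -
    obtain i where "t i = 0" using t_surj[OF S'(3)] by blast
    then show ?thesis using t_nonneg[of 0] monoD[OF t_mono, of 0 i] by simp
  qed
  have tn: "t n = T"
  proof -
    obtain i where "i \<le> n" "t i = T" using t_surj[OF S'(4)] by blast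
    then show ?thesis using t_in[of n] S'(2) monoD[OF t_mono, of i n] by force
  qed
  have gap: "P \<inter> {t i<..<t (Suc i)} = {}" for i
  proof (rule ccontr)
    assume "P \<inter> {t i<..<t (Suc i)} \<noteq> {}"
    then obtain p where p: "p \<in> P" "t i < p" "p < t (Suc i)" by auto
    have "t (Suc i) \<le> T" using t_in[of "Suc i"] S'(2) by auto
    then have "p \<in> S'" using p t_nonneg[of i] S'(6) by auto
    then obtain j where "t j = p" using t_surj by blast
    moreover have "j \<le> i \<or> Suc i \<le> j" by linarith
    ultimately show False using p monoD[OF t_mono, of j i] monoD[OF t_mono, of "Suc i" j] by auto
  qed
  \<comment> \<open>\<open>elementary\<close> speaks of proper intervals only, so on a repeated grid
    point \<open>H\<close> need not be measurable at \<open>t i\<close>. The weight 0 is chosen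
    there; the increment of \<open>B\<close> is zero anyway.\<close>
  define G where "G i \<omega> = (if t i < t (Suc i) then H (t (Suc i)) \<omega> else 0)" for i \<omega>
  have step: "H (t (Suc i)) \<in> borel_measurable (F (t i))"
    "\<exists>C. \<forall>\<omega>\<in>space M. \<bar>H (t (Suc i)) \<omega>\<bar> \<le> C"
    "r \<in> {t i<..t (Suc i)} \<Longrightarrow> H r \<omega> = H (t (Suc i)) \<omega>"
    "N (t (Suc i)) \<omega> - N (t i) \<omega> = H (t (Suc i)) \<omega> * (B (t (Suc i)) \<omega> - B (t i) \<omega>)"
    if "t i < t (Suc i)" for i r \<omega>
    using P(2)[OF t_nonneg that gap] by blast+
  interpret brownian_transform M F B t G
  proof
    show "mono t" "0 \<le> t 0" using t_mono t0 by auto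
    fix i
    show "G i \<in> borel_measurable (F (t i))"
      using step(1)[of i] by (cases "t i < t (Suc i)") (simp_all add: G_def[abs_def])
    show "\<exists>C. \<forall>\<omega>\<in>space M. \<bar>G i \<omega>\<bar> \<le> C"
    proof (cases "t i < t (Suc i)")
      case True
      then show ?thesis using step(2)[of i] by (simp add: G_def)
    qed (auto simp: G_def)
  qed
  have transform: "transform i \<omega> = N (t i) \<omega>" for i \<omega>
  proof (induction i)
    case 0
    then show ?case by (simp add: transform_def t0 N0)
  next
    case (Suc i)
    have "N (t (Suc i)) \<omega> - N (t i) \<omega> = G i \<omega> * (B (t (Suc i)) \<omega> - B (t i) \<omega>)"
    proof (cases "t i < t (Suc i)")
      case True
      then show ?thesis using step(4)[of i \<omega>] by (simp add: G_def)
    next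
      case False
      then have "t i = t (Suc i)" using grid(2)[of i] by simp
      then show ?thesis by simp
    qed
    then show ?case using Suc by (simp add: transform_def)
  qed
  have bracket: "ennreal (bracket i \<omega>) = (\<integral>\<^sup>+s\<in>{0..t i}. ennreal ((H s \<omega>)\<^sup>2) \<partial>lborel)"
    if [measurable]: "\<omega> \<in> space M" for i \<omega>
  proof (induction i)
    case 0
    have "(\<integral>\<^sup>+s\<in>{0::real}. ennreal ((H s \<omega>)\<^sup>2) \<partial>lborel) = 0"
      by (intro nn_integral_null_set) auto
    then show ?case by (simp add: bracket_def t0)
  next
    case (Suc i)
    have "(\<integral>\<^sup>+s\<in>{t i<..t (Suc i)}. ennreal ((H s \<omega>)\<^sup>2) \<partial>lborel)
        = (\<integral>\<^sup>+s. ennreal ((G i \<omega>)\<^sup>2) * indicator {t i<..t (Suc i)} s \<partial>lborel)"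
    proof (intro nn_integral_cong)
      fix s
      show "ennreal ((H s \<omega>)\<^sup>2) * indicator {t i<..t (Suc i)} s
          = ennreal ((G i \<omega>)\<^sup>2) * indicator {t i<..t (Suc i)} s"
      proof (cases "s \<in> {t i<..t (Suc i)}")
        case True
        then have "H s \<omega> = G i \<omega>" using step(3)[of i s \<omega>] by (simp add: G_def)
        then show ?thesis by simp
      qed simp
    qed
    also have "\<dots> = ennreal ((G i \<omega>)\<^sup>2 * (t (Suc i) - t i))"
      using grid(2)[of i] by (subst nn_integral_cmult_indicator) (simp_all add: ennreal_mult)
    finally have piece: "(\<integral>\<^sup>+s\<in>{t i<..t (Suc i)}. ennreal ((H s \<omega>)\<^sup>2) \<partial>lborel)
        = ennreal ((G i \<omega>)\<^sup>2 * (t (Suc i) - t i))" .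
    have "{0..t (Suc i)} = {0..t i} \<union> {t i<..t (Suc i)}" using grid(2)[of i] t_nonneg[of i] by auto
    then have "(\<integral>\<^sup>+s\<in>{0..t (Suc i)}. ennreal ((H s \<omega>)\<^sup>2) \<partial>lborel)
        = (\<integral>\<^sup>+s\<in>{0..t i}. ennreal ((H s \<omega>)\<^sup>2) \<partial>lborel) + (\<integral>\<^sup>+s\<in>{t i<..t (Suc i)}. ennreal ((H s \<omega>)\<^sup>2) \<partial>lborel)"
      by (simp only:) (intro nn_integral_disjoint_pair, auto)
    also have "\<dots> = ennreal (bracket (Suc i) \<omega>)"
      unfolding Suc[symmetric] piece using bracket_nonneg[of i \<omega>] grid(2)[of i]
      by (subst ennreal_plus[symmetric]) (simp_all add: bracket_def del: ennreal_plus)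
    finally show ?case ..
  qed
  have A: "A \<omega> = ennreal (bracket n \<omega>)" if "\<omega> \<in> space M" for \<omega>
    using bracket[OF that, of n] by (simp add: A_def tn)
  have "(\<integral>\<^sup>+\<omega>. indicator {..ennreal R} (A \<omega>) * (SUP s\<in>S. ennreal ((N s \<omega>)\<^sup>2)) \<partial>M)
      \<le> (\<integral>\<^sup>+\<omega>. ennreal (indicator {..R} (bracket n \<omega>) * running_max (\<lambda>i. (transform i \<omega>)\<^sup>2) n) \<partial>M)"
  proof (rule nn_integral_mono)
    fix \<omega> assume \<omega>: "\<omega> \<in> space M"
    have "(SUP s\<in>S. ennreal ((N s \<omega>)\<^sup>2)) \<le> ennreal (running_max (\<lambda>i. (transform i \<omega>)\<^sup>2) n)"
    proof (rule SUP_least, rule ennreal_leI)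
      fix s assume "s \<in> S"
      then obtain i where "i \<le> n" "t i = s" using t_surj S' by blast
      then show "(N s \<omega>)\<^sup>2 \<le> running_max (\<lambda>i. (transform i \<omega>)\<^sup>2) n"
        using le_running_max[of i n "\<lambda>i. (transform i \<omega>)\<^sup>2"] by (simp add: transform)
    qed
    then show "indicator {..ennreal R} (A \<omega>) * (SUP s\<in>S. ennreal ((N s \<omega>)\<^sup>2))
        \<le> ennreal (indicator {..R} (bracket n \<omega>) * running_max (\<lambda>i. (transform i \<omega>)\<^sup>2) n)"
      using \<omega> \<open>0 \<le> R\<close> by (auto simp: A ennreal_le_iff split: split_indicator)
  qed
  also have "\<dots> \<le> 4 * (\<integral>\<^sup>+\<omega>. ennreal (min R (bracket n \<omega>)) \<partial>M)"
    by (rule doob_transform_localized[OF \<open>0 \<le> R\<close>])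
  also have "(\<integral>\<^sup>+\<omega>. ennreal (min R (bracket n \<omega>)) \<partial>M) = (\<integral>\<^sup>+\<omega>. min (ennreal R) (A \<omega>) \<partial>M)"
    using \<open>0 \<le> R\<close> bracket_nonneg by (intro nn_integral_cong) (simp add: A min_ennreal)
  finally show ?thesis .
qed

end

text \<open>Young's inequality with a small weight \<open>\<delta>\<close> replaces the triangle
  inequality for norms. Only \<open>f\<close> is known to be square integrable, so the weighted term
  is always measured against its finite integral \<open>A\<close>.\<close>

lemma power2_integral_tendsto:
  fixes f :: "'b \<Rightarrow> real" and f' :: "nat \<Rightarrow> 'b \<Rightarrow> real"
  assumes [measurable]: "f \<in> borel_measurable \<mu>" "\<And>n. f' n \<in> borel_measurable \<mu>"
    and fin: "(\<integral>\<^sup>+x. ennreal ((f x)\<^sup>2) \<partial>\<mu>) < \<infinity>"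
    and lim: "(\<lambda>n. \<integral>\<^sup>+x. ennreal ((f x - f' n x)\<^sup>2) \<partial>\<mu>) \<longlonglongrightarrow> 0"
  shows "(\<lambda>n. \<integral>\<^sup>+x. ennreal ((f' n x)\<^sup>2) \<partial>\<mu>) \<longlonglongrightarrow> (\<integral>\<^sup>+x. ennreal ((f x)\<^sup>2) \<partial>\<mu>)"
proof -
  define A where "A = (\<integral>\<^sup>+x. ennreal ((f x)\<^sup>2) \<partial>\<mu>)"
  define A' where "A' n = (\<integral>\<^sup>+x. ennreal ((f' n x)\<^sup>2) \<partial>\<mu>)" for n
  define D where "D n = (\<integral>\<^sup>+x. ennreal ((f x - f' n x)\<^sup>2) \<partial>\<mu>)" for n
  \<comment> \<open>\<open>z\<close> may be either argument, so that \<open>z = f\<close> can be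
    taken when bounding the integral of \<open>f' n\<close> by that of \<open>f\<close> and also
    conversely.\<close>
  have young: "(x::real)\<^sup>2 \<le> y\<^sup>2 + \<delta> * z\<^sup>2 + (1 + 1 / \<delta>) * (x - y)\<^sup>2"
    if "0 < \<delta>" "z = x \<or> z = y" for x y z \<delta>
  proof -
    have *: "2 * \<bar>z * (x - y)\<bar> \<le> \<delta> * z\<^sup>2 + (x - y)\<^sup>2 / \<delta>"
    proof -
      have "0 \<le> (sqrt \<delta> * \<bar>z\<bar> - \<bar>x - y\<bar> / sqrt \<delta>)\<^sup>2" by simp
      also have "\<dots> = \<delta> * z\<^sup>2 + (x - y)\<^sup>2 / \<delta> - 2 * \<bar>z * (x - y)\<bar>"
        using that by (simp add: power2_diff power_mult_distrib power_divide abs_mult)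
      finally show ?thesis by simp
    qed
    have "x\<^sup>2 - y\<^sup>2 \<le> 2 * \<bar>z * (x - y)\<bar> + (x - y)\<^sup>2"
      using that(2)
    proof
      assume "z = x"
      have "x\<^sup>2 - y\<^sup>2 = 2 * (x * (x - y)) - (x - y)\<^sup>2" by (simp add: power2_eq_square algebra_simps)
      also have "\<dots> \<le> 2 * \<bar>x * (x - y)\<bar> + (x - y)\<^sup>2"
        using abs_ge_self[of "x * (x - y)"] zero_le_power2[of "x - y"] by linarith
      finally show ?thesis using \<open>z = x\<close> by simp
    next
      assume "z = y"
      have "x\<^sup>2 - y\<^sup>2 = 2 * (y * (x - y)) + (x - y)\<^sup>2" by (simp add: power2_eq_square algebra_simps)
      also have "\<dots> \<le> 2 * \<bar>y * (x - y)\<bar> + (x - y)\<^sup>2"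
        using abs_ge_self[of "y * (x - y)"] by linarith
      finally show ?thesis using \<open>z = y\<close> by simp
    qed
    then show ?thesis using * that by (simp add: distrib_right)
  qed
  have young_int: "(\<integral>\<^sup>+x. ennreal ((g x)\<^sup>2) \<partial>\<mu>) \<le> (\<integral>\<^sup>+x. ennreal ((k x)\<^sup>2) \<partial>\<mu>)
      + ennreal \<delta> * A + ennreal (1 + 1 / \<delta>) * (\<integral>\<^sup>+x. ennreal ((g x - k x)\<^sup>2) \<partial>\<mu>)"
    if [measurable]: "g \<in> borel_measurable \<mu>" "k \<in> borel_measurable \<mu>" and "0 < \<delta>" "f = g \<or> f = k" for g k \<delta>
  proof -
    have "(\<integral>\<^sup>+x. ennreal ((g x)\<^sup>2) \<partial>\<mu>) \<le> (\<integral>\<^sup>+x. ennreal ((k x)\<^sup>2)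
        + ennreal \<delta> * ennreal ((f x)\<^sup>2) + ennreal (1 + 1 / \<delta>) * ennreal ((g x - k x)\<^sup>2) \<partial>\<mu>)"
    proof (rule nn_integral_mono)
      fix x
      have "ennreal ((g x)\<^sup>2) \<le> ennreal ((k x)\<^sup>2 + \<delta> * (f x)\<^sup>2 + (1 + 1 / \<delta>) * (g x - k x)\<^sup>2)"
        using that(3,4) by (intro ennreal_leI young) auto
      also have "\<dots> = ennreal ((k x)\<^sup>2) + ennreal \<delta> * ennreal ((f x)\<^sup>2) + ennreal (1 + 1 / \<delta>) * ennreal ((g x - k x)\<^sup>2)"
        using that(3) by (subst ennreal_plus ennreal_mult; simp)+
      finally show "ennreal ((g x)\<^sup>2) \<le> \<dots>" .
    qed
    then show ?thesis by (simp add: nn_integral_add nn_integral_cmult A_def)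
  qed
  have A_fin: "A < \<infinity>" using fin by (simp add: A_def)
  define a where "a = enn2real A"
  have a: "A = ennreal a" "0 \<le> a" using A_fin by (auto simp: a_def)
  have "A' \<longlonglongrightarrow> A"
  proof -
    \<comment> \<open>Small \<open>D n\<close> first of all makes \<open>A' n\<close> finite; after
      that the estimate can be carried out in the reals.\<close>
    have ev: "eventually (\<lambda>n. D n < 1) sequentially"
      using lim order_tendstoD(2)[of D 0 sequentially 1] by (simp add: D_def[abs_def])
    have A'_real: "A' n = ennreal (enn2real (A' n))" if "D n < 1" for n
    proof -
      have D_eq: "D n = (\<integral>\<^sup>+x. ennreal ((f' n x - f x)\<^sup>2) \<partial>\<mu>)"
        by (simp add: D_def power2_commute)
      have "A' n \<le> A + ennreal 1 * A + ennreal (1 + 1 / 1) * D n"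
        using young_int[of "f' n" f 1] unfolding D_eq A'_def A_def[symmetric] by simp
      also have "\<dots> < \<infinity>"
        using a order.strict_trans[OF that ennreal_one_less_top] by (simp add: ennreal_mult_less_top)
      finally show ?thesis by simp
    qed
    have "(\<lambda>n. enn2real (A' n)) \<longlonglongrightarrow> a"
    proof (rule tendstoI)
      fix r :: real assume r: "0 < r"
      \<comment> \<open>The summand 1 covers the case \<open>a = 0\<close>. One half of
        \<open>r\<close> is spent on \<open>\<delta> * a\<close>, the other on \<open>c\<close>
        times the distance \<open>D n\<close>.\<close>
      define \<delta> where "\<delta> = r / (2 * (a + 1))"
      define c where "c = 1 + 1 / \<delta>"
      have \<delta>: "0 < \<delta>" "\<delta> * a < r / 2" using r a by (auto simp: \<delta>_def field_simps)
      have c: "0 < c" using \<delta> by (simp add: c_def add_pos_pos)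
      have "eventually (\<lambda>n. D n < ennreal (r / (2 * c))) sequentially"
        using lim order_tendstoD(2)[of D 0 sequentially "ennreal (r / (2 * c))"] r c
        by (simp add: D_def[abs_def])
      with ev show "eventually (\<lambda>n. dist (enn2real (A' n)) a < r) sequentially"
      proof eventually_elim
        case (elim n)
        define d where "d = enn2real (D n)"
        have d: "D n = ennreal d" "0 \<le> d" using order.strict_trans[OF elim(1) ennreal_one_less_top] by (simp_all add: d_def)
        have "d < r / (2 * c)" using elim(2) r c by (simp add: d ennreal_less_iff)
        then have cd: "c * d < r / 2" using c by (simp add: field_simps)
        define a' where "a' = enn2real (A' n)"
        have a': "A' n = ennreal a'" "0 \<le> a'" using A'_real[OF elim(1)] by (auto simp: a'_def)
        have D_eq: "D n = (\<integral>\<^sup>+x. ennreal ((f' n x - f x)\<^sup>2) \<partial>\<mu>)"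
          by (simp add: D_def power2_commute)
        have "A' n \<le> A + ennreal \<delta> * A + ennreal c * D n"
          using young_int[of "f' n" f \<delta>] \<delta> unfolding D_eq A'_def A_def[symmetric] c_def by simp
        also have "\<dots> = ennreal (a + \<delta> * a + c * d)"
          using a d \<delta> c by (simp add: ennreal_plus ennreal_mult)
        finally have 1: "a' \<le> a + \<delta> * a + c * d"
          using a d \<delta> c by (simp add: a' ennreal_le_iff del: ennreal_plus)
        have "A \<le> A' n + ennreal \<delta> * A + ennreal c * D n"
          using young_int[of f "f' n" \<delta>] \<delta> unfolding D_def A'_def A_def[symmetric] c_def by simp
        also have "\<dots> = ennreal (a' + \<delta> * a + c * d)"
          using a a' d \<delta> c by (simp add: ennreal_plus ennreal_mult)
        finally have 2: "a \<le> a' + \<delta> * a + c * d"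
          using a a' d \<delta> c by (simp add: ennreal_le_iff del: ennreal_plus)
        show ?case using 1 2 \<delta> cd by (simp add: dist_real_def a'_def[symmetric])
      qed
    qed
    then have "(\<lambda>n. ennreal (enn2real (A' n))) \<longlonglongrightarrow> A" by (simp add: a tendsto_ennrealI)
    then show ?thesis
      by (rule Lim_transform_eventually) (rule eventually_mono[OF ev], rule A'_real[symmetric])
  qed
  then show ?thesis by (simp add: A_def A'_def[abs_def])
qed

section \<open>Ito integrals as limits of elementary integrals\<close>

lemma set_power2_integral_tendsto:
  fixes f :: "real \<Rightarrow> real" and f' :: "nat \<Rightarrow> real \<Rightarrow> real"
  assumes [measurable]: "f \<in> borel_measurable borel" "\<And>n. f' n \<in> borel_measurable borel" "S \<in> sets borel"
    and fin: "(\<integral>\<^sup>+s\<in>S. ennreal ((f s)\<^sup>2) \<partial>lborel) < \<infinity>"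
    and lim: "(\<lambda>n. \<integral>\<^sup>+s\<in>S. ennreal ((f s - f' n s)\<^sup>2) \<partial>lborel) \<longlonglongrightarrow> 0"
  shows "(\<lambda>n. \<integral>\<^sup>+s\<in>S. ennreal ((f' n s)\<^sup>2) \<partial>lborel) \<longlonglongrightarrow> (\<integral>\<^sup>+s\<in>S. ennreal ((f s)\<^sup>2) \<partial>lborel)"
proof -
  have eq: "(\<integral>\<^sup>+s\<in>S. ennreal ((g s)\<^sup>2) \<partial>lborel) = (\<integral>\<^sup>+s. ennreal ((g s)\<^sup>2) \<partial>restrict_space lborel S)"
    for g :: "real \<Rightarrow> real"
    by (subst nn_integral_restrict_space) auto
  have m: "g \<in> borel_measurable (restrict_space lborel S)" if "g \<in> borel_measurable borel" for g :: "real \<Rightarrow> real"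
    using that by (intro measurable_restrict_space1) simp
  have "(\<lambda>n. \<integral>\<^sup>+s. ennreal ((f s - f' n s)\<^sup>2) \<partial>restrict_space lborel S) \<longlonglongrightarrow> 0"
    using lim by (simp only: eq)
  then show ?thesis
    unfolding eq using fin by (intro power2_integral_tendsto m assms(1,2)) (simp_all only: eq)
qed

text \<open>Countable suprema of measurable functions are measurable, which is why all maximal
  functions run over a sequence of times.\<close>

lemma dense_times:
  fixes T :: real
  assumes "0 \<le> T"
  shows "\<exists>d :: nat \<Rightarrow> real. range d \<subseteq> {0..T} \<and> closure (range d) = {0..T}"
proof -
  obtain S where S: "countable S" "S \<subseteq> {0..T}" "{0..T} \<subseteq> closure S"
    using separable[of "{0..T}"] by blast
  moreover have "S \<noteq> {}" using S assms by auto
  ultimately have "range (from_nat_into S) = S" by (intro range_from_nat_into)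
  moreover have "closure S \<subseteq> {0..T}" using S by (intro closure_minimal) auto
  ultimately show ?thesis using S by (intro exI[of _ "from_nat_into S"]) auto
qed

lemma dense_power2_le:
  fixes f :: "real \<Rightarrow> real"
  assumes "continuous_on {0..T} f" "closure (range d) = {0..T}" "s \<in> {0..T}"
  shows "ennreal ((f s)\<^sup>2) \<le> (SUP n. ennreal ((f (d n))\<^sup>2))"
proof (cases "(SUP n. ennreal ((f (d n))\<^sup>2))")
  case (real r)
  have "ennreal ((f (d n))\<^sup>2) \<le> ennreal r" for n
    unfolding real(2)[symmetric] by (rule SUP_upper) simp
  then have "\<And>x. x \<in> range d \<Longrightarrow> (f x)\<^sup>2 \<le> r"
    using real(1) by (auto simp: ennreal_le_iff)
  moreover have "continuous_on (closure (range d)) (\<lambda>s. (f s)\<^sup>2)"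
    unfolding assms(2) using assms(1) by (intro continuous_intros)
  ultimately have "(f s)\<^sup>2 \<le> r"
    using assms(3) unfolding assms(2)[symmetric] by (rule_tac continuous_le_on_closure)
  then show ?thesis unfolding real(2) by (rule ennreal_leI)
next
  case top
  then show ?thesis by (simp only: top_greatest)
qed

context filtered_brownian
begin

text \<open>What is retained of an Ito integral after passing to a subsequence: almost sure
  convergence instead of convergence in probability, at each time separately. Adaptedness survives
  only in the elementary approximants, where Doob's inequality is applied. Differences of two
  integrals are limits of the differences of their approximants.\<close>

definition ito_limit :: "real \<Rightarrow> (real \<Rightarrow> 'a \<Rightarrow> real) \<Rightarrow> (real \<Rightarrow> 'a \<Rightarrow> real) \<Rightarrow> bool" where
  "ito_limit T H I \<longleftrightarrow> (\<lambda>(s, \<omega>). H s \<omega>) \<in> borel_measurable (borel \<Otimes>\<^sub>M M) \<and>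
    (\<forall>s\<in>{0..T}. I s \<in> borel_measurable M) \<and>
    (\<exists>H' N. (\<forall>n. elementary (H' n) (N n)) \<and>
      (AE \<omega> in M. (\<lambda>n. \<integral>\<^sup>+s\<in>{0..T}. ennreal ((H s \<omega> - H' n s \<omega>)\<^sup>2) \<partial>lborel) \<longlonglongrightarrow> 0 \<and>
        (\<forall>s\<in>{0..T}. (\<lambda>n. N n s \<omega>) \<longlonglongrightarrow> I s \<omega>)))"

lemma ito_limit_measurable:
  "ito_limit T H I \<Longrightarrow> (\<lambda>(s, \<omega>). H s \<omega>) \<in> borel_measurable (borel \<Otimes>\<^sub>M M)"
  "ito_limit T H I \<Longrightarrow> s \<in> {0..T} \<Longrightarrow> I s \<in> borel_measurable M"
  by (simp_all add: ito_limit_def)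

lemma elementary_measurable:
  "elementary H N \<Longrightarrow> (\<lambda>(s, \<omega>). H s \<omega>) \<in> borel_measurable (borel \<Otimes>\<^sub>M M)"
  "elementary H N \<Longrightarrow> 0 \<le> s \<Longrightarrow> N s \<in> borel_measurable M"
  by (simp_all add: elementary_def)

lemma ito_limit_diff:
  assumes 1: "ito_limit T H\<^sub>1 I\<^sub>1" and 2: "ito_limit T H\<^sub>2 I\<^sub>2"
  shows "ito_limit T (\<lambda>s \<omega>. H\<^sub>1 s \<omega> - H\<^sub>2 s \<omega>) (\<lambda>s \<omega>. I\<^sub>1 s \<omega> - I\<^sub>2 s \<omega>)"
proof -
  obtain H\<^sub>1' N\<^sub>1 where l1: "\<And>n. elementary (H\<^sub>1' n) (N\<^sub>1 n)"
      "AE \<omega> in M. (\<lambda>n. \<integral>\<^sup>+s\<in>{0..T}. ennreal ((H\<^sub>1 s \<omega> - H\<^sub>1' n s \<omega>)\<^sup>2) \<partial>lborel) \<longlonglongrightarrow> 0 \<and>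
        (\<forall>s\<in>{0..T}. (\<lambda>n. N\<^sub>1 n s \<omega>) \<longlonglongrightarrow> I\<^sub>1 s \<omega>)"
    using 1 unfolding ito_limit_def by blast
  obtain H\<^sub>2' N\<^sub>2 where l2: "\<And>n. elementary (H\<^sub>2' n) (N\<^sub>2 n)"
      "AE \<omega> in M. (\<lambda>n. \<integral>\<^sup>+s\<in>{0..T}. ennreal ((H\<^sub>2 s \<omega> - H\<^sub>2' n s \<omega>)\<^sup>2) \<partial>lborel) \<longlonglongrightarrow> 0 \<and>
        (\<forall>s\<in>{0..T}. (\<lambda>n. N\<^sub>2 n s \<omega>) \<longlonglongrightarrow> I\<^sub>2 s \<omega>)"
    using 2 unfolding ito_limit_def by blast
  have [measurable]: "(\<lambda>(s, \<omega>). H\<^sub>1 s \<omega>) \<in> borel_measurable (borel \<Otimes>\<^sub>M M)"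
    "(\<lambda>(s, \<omega>). H\<^sub>2 s \<omega>) \<in> borel_measurable (borel \<Otimes>\<^sub>M M)"
    "\<And>n. (\<lambda>(s, \<omega>). H\<^sub>1' n s \<omega>) \<in> borel_measurable (borel \<Otimes>\<^sub>M M)"
    "\<And>n. (\<lambda>(s, \<omega>). H\<^sub>2' n s \<omega>) \<in> borel_measurable (borel \<Otimes>\<^sub>M M)"
    by (rule ito_limit_measurable[OF 1] ito_limit_measurable[OF 2]
        elementary_measurable[OF l1(1)] elementary_measurable[OF l2(1)])+
  define H' where "H' n s \<omega> = H\<^sub>1' n s \<omega> + (-1) * H\<^sub>2' n s \<omega>" for n s \<omega>
  define N where "N n s \<omega> = N\<^sub>1 n s \<omega> + (-1) * N\<^sub>2 n s \<omega>" for n s \<omega>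
  have "elementary (H' n) (N n)" for n
    unfolding H'_def[abs_def] N_def[abs_def] by (rule elementary_linear[OF l1(1) l2(1)])
  moreover have "AE \<omega> in M.
      (\<lambda>n. \<integral>\<^sup>+s\<in>{0..T}. ennreal ((H\<^sub>1 s \<omega> - H\<^sub>2 s \<omega> - H' n s \<omega>)\<^sup>2) \<partial>lborel) \<longlonglongrightarrow> 0 \<and>
        (\<forall>s\<in>{0..T}. (\<lambda>n. N n s \<omega>) \<longlonglongrightarrow> I\<^sub>1 s \<omega> - I\<^sub>2 s \<omega>)"
    using l1(2) l2(2) AE_space
  proof eventually_elim
    case (elim \<omega>)
    note [measurable] = elim(3)
    let ?D1 = "\<lambda>n. \<integral>\<^sup>+s\<in>{0..T}. ennreal ((H\<^sub>1 s \<omega> - H\<^sub>1' n s \<omega>)\<^sup>2) \<partial>lborel"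
    let ?D2 = "\<lambda>n. \<integral>\<^sup>+s\<in>{0..T}. ennreal ((H\<^sub>2 s \<omega> - H\<^sub>2' n s \<omega>)\<^sup>2) \<partial>lborel"
    have "(\<lambda>n. 2 * ?D1 n + 2 * ?D2 n) \<longlonglongrightarrow> 2 * 0 + 2 * 0"
      using elim by (intro tendsto_add ennreal_tendsto_cmult) auto
    then have lim: "(\<lambda>n. 2 * ?D1 n + 2 * ?D2 n) \<longlonglongrightarrow> 0" by simp
    have "(\<integral>\<^sup>+s\<in>{0..T}. ennreal ((H\<^sub>1 s \<omega> - H\<^sub>2 s \<omega> - H' n s \<omega>)\<^sup>2) \<partial>lborel) \<le> 2 * ?D1 n + 2 * ?D2 n" for n
    proof -
      have "(\<integral>\<^sup>+s\<in>{0..T}. ennreal ((H\<^sub>1 s \<omega> - H\<^sub>2 s \<omega> - H' n s \<omega>)\<^sup>2) \<partial>lborel)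
        \<le> (\<integral>\<^sup>+s. 2 * (ennreal ((H\<^sub>1 s \<omega> - H\<^sub>1' n s \<omega>)\<^sup>2) * indicator {0..T} s)
            + 2 * (ennreal ((H\<^sub>2 s \<omega> - H\<^sub>2' n s \<omega>)\<^sup>2) * indicator {0..T} s) \<partial>lborel)"
      proof (rule nn_integral_mono)
        fix s
        have *: "(x - y)\<^sup>2 \<le> 2 * x\<^sup>2 + 2 * y\<^sup>2" for x y :: real
          using zero_le_power2[of "x + y"] by (simp add: power2_sum power2_diff)
        have "H\<^sub>1 s \<omega> - H\<^sub>2 s \<omega> - H' n s \<omega> = (H\<^sub>1 s \<omega> - H\<^sub>1' n s \<omega>) - (H\<^sub>2 s \<omega> - H\<^sub>2' n s \<omega>)"
          by (simp add: H'_def)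
        then have "(H\<^sub>1 s \<omega> - H\<^sub>2 s \<omega> - H' n s \<omega>)\<^sup>2
            \<le> 2 * (H\<^sub>1 s \<omega> - H\<^sub>1' n s \<omega>)\<^sup>2 + 2 * (H\<^sub>2 s \<omega> - H\<^sub>2' n s \<omega>)\<^sup>2"
          by (simp only: *)
        then have "ennreal ((H\<^sub>1 s \<omega> - H\<^sub>2 s \<omega> - H' n s \<omega>)\<^sup>2)
            \<le> ennreal (2 * (H\<^sub>1 s \<omega> - H\<^sub>1' n s \<omega>)\<^sup>2 + 2 * (H\<^sub>2 s \<omega> - H\<^sub>2' n s \<omega>)\<^sup>2)"
          by (rule ennreal_leI)
        also have "\<dots> = 2 * ennreal ((H\<^sub>1 s \<omega> - H\<^sub>1' n s \<omega>)\<^sup>2) + 2 * ennreal ((H\<^sub>2 s \<omega> - H\<^sub>2' n s \<omega>)\<^sup>2)"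
          by (simp add: ennreal_mult)
        finally show "ennreal ((H\<^sub>1 s \<omega> - H\<^sub>2 s \<omega> - H' n s \<omega>)\<^sup>2) * indicator {0..T} s
            \<le> 2 * (ennreal ((H\<^sub>1 s \<omega> - H\<^sub>1' n s \<omega>)\<^sup>2) * indicator {0..T} s)
            + 2 * (ennreal ((H\<^sub>2 s \<omega> - H\<^sub>2' n s \<omega>)\<^sup>2) * indicator {0..T} s)"
          by (simp split: split_indicator)
      qed
      then show ?thesis by (simp add: nn_integral_add nn_integral_cmult)
    qed
    then have "(\<lambda>n. \<integral>\<^sup>+s\<in>{0..T}. ennreal ((H\<^sub>1 s \<omega> - H\<^sub>2 s \<omega> - H' n s \<omega>)\<^sup>2) \<partial>lborel) \<longlonglongrightarrow> 0"
      by (intro tendsto_sandwich[OF _ _ tendsto_const lim]) auto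
    moreover have "(\<lambda>n. N n s \<omega>) \<longlonglongrightarrow> I\<^sub>1 s \<omega> - I\<^sub>2 s \<omega>" if "s \<in> {0..T}" for s
      using elim that unfolding N_def by (auto intro!: tendsto_diff)
    ultimately show ?case by blast
  qed
  moreover have "(\<lambda>(s, \<omega>). H\<^sub>1 s \<omega> - H\<^sub>2 s \<omega>) \<in> borel_measurable (borel \<Otimes>\<^sub>M M)"
    by measurable
  moreover have "\<forall>s\<in>{0..T}. (\<lambda>\<omega>. I\<^sub>1 s \<omega> - I\<^sub>2 s \<omega>) \<in> borel_measurable M"
    using ito_limit_measurable(2)[OF 1] ito_limit_measurable(2)[OF 2] by simp
  ultimately show ?thesis unfolding ito_limit_def by blast
qed

lemma ito_limit_mono:
  assumes "ito_limit T H I" "t \<le> T"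
  shows "ito_limit t H I"
proof -
  have D: "(\<integral>\<^sup>+s\<in>{0..t}. ennreal ((H s \<omega> - H' s \<omega>)\<^sup>2) \<partial>lborel)
      \<le> (\<integral>\<^sup>+s\<in>{0..T}. ennreal ((H s \<omega> - H' s \<omega>)\<^sup>2) \<partial>lborel)" for H' \<omega>
    using assms(2) by (intro nn_integral_mono) (auto split: split_indicator)
  have conv: "(\<lambda>n. \<integral>\<^sup>+s\<in>{0..t}. ennreal ((H s \<omega> - H' n s \<omega>)\<^sup>2) \<partial>lborel) \<longlonglongrightarrow> 0"
    if "(\<lambda>n. \<integral>\<^sup>+s\<in>{0..T}. ennreal ((H s \<omega> - H' n s \<omega>)\<^sup>2) \<partial>lborel) \<longlonglongrightarrow> 0" for H' \<omega>
    by (rule tendsto_sandwich[OF _ _ tendsto_const that]) (simp_all add: D)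
  obtain H' N where HN: "\<forall>n. elementary (H' n) (N n)"
      "AE \<omega> in M. (\<lambda>n. \<integral>\<^sup>+s\<in>{0..T}. ennreal ((H s \<omega> - H' n s \<omega>)\<^sup>2) \<partial>lborel) \<longlonglongrightarrow> 0 \<and>
        (\<forall>s\<in>{0..T}. (\<lambda>n. N n s \<omega>) \<longlonglongrightarrow> I s \<omega>)"
    using assms(1) unfolding ito_limit_def by blast
  have sub: "{0..t} \<subseteq> {0..T}" using assms(2) by simp
  have "AE \<omega> in M. (\<lambda>n. \<integral>\<^sup>+s\<in>{0..t}. ennreal ((H s \<omega> - H' n s \<omega>)\<^sup>2) \<partial>lborel) \<longlonglongrightarrow> 0 \<and>
        (\<forall>s\<in>{0..t}. (\<lambda>n. N n s \<omega>) \<longlonglongrightarrow> I s \<omega>)"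
    using HN(2) by eventually_elim (use sub conv in blast)
  then show ?thesis
    using ito_limit_measurable[OF assms(1)] HN(1) sub unfolding ito_limit_def by blast
qed

text \<open>Fatou's lemma applied to \<open>doob_elementary\<close>. The cutoff is closed for the
  approximants and becomes open in the limit: brackets converging to a value strictly below
  \<open>R\<close> are eventually below \<open>R\<close>, which fails for the limit value
  \<open>R\<close> itself.\<close>

lemma maximal_inequality_finite:
  assumes lim: "ito_limit T H I" and S: "finite S" "S \<subseteq> {0..T}" and "0 \<le> T" "0 \<le> R"
  defines "A \<equiv> \<lambda>\<omega>. \<integral>\<^sup>+s\<in>{0..T}. ennreal ((H s \<omega>)\<^sup>2) \<partial>lborel"
  assumes A_fin: "AE \<omega> in M. A \<omega> < \<infinity>"
  shows "(\<integral>\<^sup>+\<omega>. indicator {..<ennreal R} (A \<omega>) * (SUP s\<in>S. ennreal ((I s \<omega>)\<^sup>2)) \<partial>M)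
    \<le> 4 * (\<integral>\<^sup>+\<omega>. min (ennreal R) (A \<omega>) \<partial>M)"
proof -
  obtain H' N where el: "\<And>n. elementary (H' n) (N n)"
    and ae: "AE \<omega> in M. (\<lambda>n. \<integral>\<^sup>+s\<in>{0..T}. ennreal ((H s \<omega> - H' n s \<omega>)\<^sup>2) \<partial>lborel) \<longlonglongrightarrow> 0 \<and>
        (\<forall>s\<in>{0..T}. (\<lambda>n. N n s \<omega>) \<longlonglongrightarrow> I s \<omega>)"
    using lim unfolding ito_limit_def by blast
  have [measurable]: "(\<lambda>(s, \<omega>). H s \<omega>) \<in> borel_measurable (borel \<Otimes>\<^sub>M M)"
    "\<And>n. (\<lambda>(s, \<omega>). H' n s \<omega>) \<in> borel_measurable (borel \<Otimes>\<^sub>M M)"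
    by (rule ito_limit_measurable[OF lim] elementary_measurable[OF el])+
  define A' where "A' n \<omega> = (\<integral>\<^sup>+s\<in>{0..T}. ennreal ((H' n s \<omega>)\<^sup>2) \<partial>lborel)" for n \<omega>
  have A_meas[measurable]: "A \<in> borel_measurable M" "\<And>n. A' n \<in> borel_measurable M"
    unfolding A_def A'_def[abs_def] by measurable
  have N_meas: "N n s \<in> borel_measurable M" if "s \<in> S" for n s
    using elementary_measurable(2)[OF el] that S by auto
  define u where "u n \<omega> = indicator {..ennreal R} (A' n \<omega>) * (SUP s\<in>S. ennreal ((N n s \<omega>)\<^sup>2))" for n \<omega>
  have u_meas[measurable]: "u n \<in> borel_measurable M" for n
    unfolding u_def[abs_def] using S N_meas
    by (intro borel_measurable_times_ennreal borel_measurable_SUP) (auto intro: countable_finite)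
  have A'_lim: "AE \<omega> in M. A \<omega> < \<infinity> \<longrightarrow> (\<lambda>n. A' n \<omega>) \<longlonglongrightarrow> A \<omega>"
    using ae AE_space
  proof eventually_elim
    case (elim \<omega>)
    note [measurable] = elim(2)
    show ?case
      unfolding A_def A'_def using elim by (intro impI set_power2_integral_tendsto) auto
  qed
  have fatou: "AE \<omega> in M. indicator {..<ennreal R} (A \<omega>) * (SUP s\<in>S. ennreal ((I s \<omega>)\<^sup>2)) \<le> liminf (\<lambda>n. u n \<omega>)"
    using ae A'_lim
  proof eventually_elim
    case (elim \<omega>)
    show ?case
    proof (cases "A \<omega> < ennreal R")
      case True
      then have "(\<lambda>n. A' n \<omega>) \<longlonglongrightarrow> A \<omega>" using elim(2) by (auto intro: less_trans)
      then have "eventually (\<lambda>n. A' n \<omega> < ennreal R) sequentially" using True by (rule order_tendstoD)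
      then have ev: "eventually (\<lambda>n. u n \<omega> = (SUP s\<in>S. ennreal ((N n s \<omega>)\<^sup>2))) sequentially"
        by eventually_elim (simp add: u_def)
      have "(SUP s\<in>S. ennreal ((I s \<omega>)\<^sup>2)) \<le> liminf (\<lambda>n. u n \<omega>)"
      proof (rule SUP_least)
        fix s assume s: "s \<in> S"
        then have "(\<lambda>n. N n s \<omega>) \<longlonglongrightarrow> I s \<omega>" using elim(1) S by blast
        then have "(\<lambda>n. ennreal ((N n s \<omega>)\<^sup>2)) \<longlonglongrightarrow> ennreal ((I s \<omega>)\<^sup>2)"
          by (intro tendsto_ennrealI tendsto_power)
        then have "ennreal ((I s \<omega>)\<^sup>2) = liminf (\<lambda>n. ennreal ((N n s \<omega>)\<^sup>2))"
          by (intro lim_imp_Liminf[symmetric]) auto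
        also have "\<dots> \<le> liminf (\<lambda>n. u n \<omega>)"
          by (intro Liminf_mono eventually_mono[OF ev]) (auto intro: SUP_upper2[OF s])
        finally show "ennreal ((I s \<omega>)\<^sup>2) \<le> liminf (\<lambda>n. u n \<omega>)" .
      qed
      then show ?thesis using True by simp
    qed simp
  qed
  have "(\<integral>\<^sup>+\<omega>. indicator {..<ennreal R} (A \<omega>) * (SUP s\<in>S. ennreal ((I s \<omega>)\<^sup>2)) \<partial>M)
      \<le> (\<integral>\<^sup>+\<omega>. liminf (\<lambda>n. u n \<omega>) \<partial>M)"
    by (rule nn_integral_mono_AE[OF fatou])
  also have "\<dots> \<le> liminf (\<lambda>n. \<integral>\<^sup>+\<omega>. u n \<omega> \<partial>M)"
    by (rule nn_integral_liminf) measurable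
  also have "\<dots> \<le> liminf (\<lambda>n. 4 * (\<integral>\<^sup>+\<omega>. min (ennreal R) (A' n \<omega>) \<partial>M))"
    unfolding u_def A'_def
    by (intro Liminf_mono always_eventually allI doob_elementary el S \<open>0 \<le> T\<close> \<open>0 \<le> R\<close>)
  \<comment> \<open>The cap at \<open>R\<close> supplies the dominating constant, so the right-hand
    side converges before any moment of \<open>A\<close> is known.\<close>
  also have "\<dots> = 4 * (\<integral>\<^sup>+\<omega>. min (ennreal R) (A \<omega>) \<partial>M)"
  proof (intro lim_imp_Liminf ennreal_tendsto_cmult)
    show "(\<lambda>n. \<integral>\<^sup>+\<omega>. min (ennreal R) (A' n \<omega>) \<partial>M) \<longlonglongrightarrow> (\<integral>\<^sup>+\<omega>. min (ennreal R) (A \<omega>) \<partial>M)"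
    proof (rule nn_integral_dominated_convergence[where w="\<lambda>_. ennreal R"])
      show "AE \<omega> in M. (\<lambda>n. min (ennreal R) (A' n \<omega>)) \<longlonglongrightarrow> min (ennreal R) (A \<omega>)"
        using A'_lim A_fin by eventually_elim (auto intro!: tendsto_min)
    qed (auto simp: emeasure_space_1)
  qed auto
  finally show ?thesis .
qed

text \<open>The supremum over a sequence of times: for continuous paths and dense times it is the supremum over
  \<open>[0,T]\<close>.\<close>

lemma maximal_inequality_localized:
  assumes lim: "ito_limit T H I" and d: "range d \<subseteq> {0..T}" and "0 \<le> T" "0 \<le> R"
  defines "A \<equiv> \<lambda>\<omega>. \<integral>\<^sup>+s\<in>{0..T}. ennreal ((H s \<omega>)\<^sup>2) \<partial>lborel"
  assumes A_fin: "AE \<omega> in M. A \<omega> < \<infinity>"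
  shows "(\<integral>\<^sup>+\<omega>. indicator {..<ennreal R} (A \<omega>) * (SUP n::nat. ennreal ((I (d n) \<omega>)\<^sup>2)) \<partial>M)
    \<le> 4 * (\<integral>\<^sup>+\<omega>. min (ennreal R) (A \<omega>) \<partial>M)"
proof -
  have [measurable]: "(\<lambda>(s, \<omega>). H s \<omega>) \<in> borel_measurable (borel \<Otimes>\<^sub>M M)"
    "\<And>n. I (d n) \<in> borel_measurable M"
    using ito_limit_measurable[OF lim] d by (auto simp: image_subset_iff)
  have [measurable]: "A \<in> borel_measurable M" unfolding A_def by measurable
  define g where "g n \<omega> = indicator {..<ennreal R} (A \<omega>) * (SUP s\<in>d ` {..n}. ennreal ((I s \<omega>)\<^sup>2))" for n \<omega>
  have g_meas: "g n \<in> borel_measurable M" for n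
    unfolding g_def[abs_def]
    by (intro borel_measurable_times_ennreal borel_measurable_SUP) (auto intro: countable_finite)
  have "incseq g"
    unfolding g_def[abs_def] by (intro incseq_SucI le_funI mult_left_mono SUP_subset_mono) auto
  have "(SUP n::nat. ennreal ((I (d n) \<omega>)\<^sup>2)) = (SUP n. SUP s\<in>d ` {..n}. ennreal ((I s \<omega>)\<^sup>2))" for \<omega>
  proof (intro antisym SUP_least)
    fix n
    show "ennreal ((I (d n) \<omega>)\<^sup>2) \<le> (SUP n. SUP s\<in>d ` {..n}. ennreal ((I s \<omega>)\<^sup>2))"
      by (rule SUP_upper2[of n], simp) (rule SUP_upper2[of "d n"], auto)
  qed (auto intro: SUP_upper)
  then have "(\<integral>\<^sup>+\<omega>. indicator {..<ennreal R} (A \<omega>) * (SUP n::nat. ennreal ((I (d n) \<omega>)\<^sup>2)) \<partial>M)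
      = (\<integral>\<^sup>+\<omega>. (SUP n. g n \<omega>) \<partial>M)"
    by (simp only: g_def SUP_mult_left_ennreal)
  also have "\<dots> = (SUP n. \<integral>\<^sup>+\<omega>. g n \<omega> \<partial>M)"
    by (rule nn_integral_monotone_convergence_SUP[OF \<open>incseq g\<close> g_meas])
  also have "\<dots> \<le> 4 * (\<integral>\<^sup>+\<omega>. min (ennreal R) (A \<omega>) \<partial>M)"
    unfolding g_def A_def using d A_fin \<open>0 \<le> T\<close> \<open>0 \<le> R\<close>
    by (intro SUP_least maximal_inequality_finite[OF lim]) (auto simp: A_def)
  finally show ?thesis .
qed

text \<open>Since \<open>A\<close> is almost surely finite, the cutoff events increase to an event
  of full measure, and monotone convergence removes the cutoff.\<close>

lemma nn_integral_le_truncated: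
  assumes [measurable]: "A \<in> borel_measurable M" "J \<in> borel_measurable M"
    and A_fin: "AE \<omega> in M. A \<omega> < \<infinity>"
    and bound: "\<And>n::nat. (\<integral>\<^sup>+\<omega>. indicator {..<ennreal (real n)} (A \<omega>) * J \<omega> \<partial>M) \<le> c"
  shows "(\<integral>\<^sup>+\<omega>. J \<omega> \<partial>M) \<le> c"
proof -
  define g where "g n \<omega> = indicator {..<ennreal (real n)} (A \<omega>) * J \<omega>" for n :: nat and \<omega>
  have g_meas: "g n \<in> borel_measurable M" for n unfolding g_def[abs_def] by measurable
  have "incseq g"
    unfolding g_def[abs_def]
    by (intro incseq_SucI le_funI mult_right_mono)
      (auto split: split_indicator elim!: less_le_trans intro!: ennreal_leI)
  have "AE \<omega> in M. J \<omega> \<le> (SUP n. g n \<omega>)"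
    using A_fin
  proof eventually_elim
    case (elim \<omega>)
    then obtain n :: nat where "A \<omega> < ennreal (real n)"
      using ennreal_Ex_less_of_nat[of "A \<omega>"] by (auto simp: ennreal_of_nat_eq_real_of_nat)
    then show ?case by (intro SUP_upper2[of n]) (auto simp: g_def)
  qed
  then have "(\<integral>\<^sup>+\<omega>. J \<omega> \<partial>M) \<le> (\<integral>\<^sup>+\<omega>. (SUP n. g n \<omega>) \<partial>M)"
    by (rule nn_integral_mono_AE)
  also have "\<dots> = (SUP n. \<integral>\<^sup>+\<omega>. g n \<omega> \<partial>M)"
    by (rule nn_integral_monotone_convergence_SUP[OF \<open>incseq g\<close> g_meas])
  also have "\<dots> \<le> c"
    unfolding g_def by (intro SUP_least bound)
  finally show ?thesis .
qed

lemma maximal_inequality: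
  assumes lim: "ito_limit T H I" and d: "range d \<subseteq> {0..T}" and "0 \<le> T"
  defines "A \<equiv> \<lambda>\<omega>. \<integral>\<^sup>+s\<in>{0..T}. ennreal ((H s \<omega>)\<^sup>2) \<partial>lborel"
  assumes A_fin: "AE \<omega> in M. A \<omega> < \<infinity>"
  shows "(\<integral>\<^sup>+\<omega>. (SUP n::nat. ennreal ((I (d n) \<omega>)\<^sup>2)) \<partial>M) \<le> 4 * (\<integral>\<^sup>+\<omega>. A \<omega> \<partial>M)"
proof -
  have [measurable]: "(\<lambda>(s, \<omega>). H s \<omega>) \<in> borel_measurable (borel \<Otimes>\<^sub>M M)"
    "\<And>n. I (d n) \<in> borel_measurable M"
    using ito_limit_measurable[OF lim] d by (auto simp: image_subset_iff)
  have [measurable]: "A \<in> borel_measurable M" unfolding A_def by measurable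
  have "(\<integral>\<^sup>+\<omega>. indicator {..<ennreal (real n)} (A \<omega>) * (SUP n::nat. ennreal ((I (d n) \<omega>)\<^sup>2)) \<partial>M)
      \<le> 4 * (\<integral>\<^sup>+\<omega>. A \<omega> \<partial>M)" for n
  proof -
    have "(\<integral>\<^sup>+\<omega>. indicator {..<ennreal (real n)} (A \<omega>) * (SUP n::nat. ennreal ((I (d n) \<omega>)\<^sup>2)) \<partial>M)
        \<le> 4 * (\<integral>\<^sup>+\<omega>. min (ennreal (real n)) (A \<omega>) \<partial>M)"
      unfolding A_def using A_fin
      by (intro maximal_inequality_localized[OF lim d \<open>0 \<le> T\<close>]) (auto simp: A_def)
    also have "\<dots> \<le> 4 * (\<integral>\<^sup>+\<omega>. A \<omega> \<partial>M)"
      by (intro mult_left_mono nn_integral_mono) auto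
    finally show ?thesis .
  qed
  then show ?thesis
    by (rule nn_integral_le_truncated[OF _ _ A_fin, rotated 2]) measurable
qed

section \<open>From convergence in probability to almost surely convergent approximations\<close>

lemma simple_integral_continuous:
  assumes "continuous_on {0..} (\<lambda>s. B s \<omega>)" "simple_integrand F n \<tau> \<eta>"
  shows "continuous_on {0..} (\<lambda>s. simple_integral B n \<tau> \<eta> s \<omega>)"
proof -
  have "0 \<le> \<tau> i" if "i \<le> n" for i
    using assms(2) that mono_onD[of "{..n}" \<tau> 0 i]
    by (auto simp: simple_integrand_def intro: order_trans[of 0 "\<tau> 0"])
  then have "continuous_on {0..} (\<lambda>s. B (min (\<tau> i) s) \<omega>)" if "i \<le> n" for i
    using that by (intro continuous_on_compose2[OF assms(1)] continuous_intros) auto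
  then show ?thesis
    unfolding simple_integral_def by (intro continuous_intros) auto
qed

text \<open>Along a subsequence with geometrically small exceptional probabilities, Borel-Cantelli
  gives almost sure convergence. The integrand is cut off outside [0,T] because progressive
  measurability up to \<open>T\<close> says something about that interval only.\<close>

lemma ito_limit_of_integral:
  assumes ito: "ito_integral M F B H I" and "0 \<le> T"
  shows "ito_limit T (\<lambda>s \<omega>. H s \<omega> * indicator {0..T} s) I"
proof -
  let ?H = "\<lambda>s \<omega>. H s \<omega> * indicator {0..T} s"
  obtain n \<tau> \<eta> where simple: "\<And>k. simple_integrand F (n k) (\<tau> k) (\<eta> k)"
    and conv: "\<And>t \<epsilon>. 0 \<le> t \<Longrightarrow> 0 < \<epsilon> \<Longrightarrow>
           (\<lambda>k. measure M {\<omega>\<in>space M.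
              (\<integral>\<^sup>+ s\<in>{0..t}. ennreal ((H s \<omega> - simple_process (n k) (\<tau> k) (\<eta> k) s \<omega>)\<^sup>2) \<partial>lborel)
                > ennreal \<epsilon>}) \<longlonglongrightarrow> 0 \<and>
           (\<lambda>k. measure M {\<omega>\<in>space M.
              \<exists>s\<in>{0..t}. \<bar>I s \<omega> - simple_integral B (n k) (\<tau> k) (\<eta> k) s \<omega>\<bar> > \<epsilon>}) \<longlonglongrightarrow> 0"
    using ito unfolding ito_integral_def by blast
  have I_cont: "continuous_on {0..} (\<lambda>t. I t \<omega>)" if "\<omega> \<in> space M" for \<omega>
    using ito that unfolding ito_integral_def by blast
  have I_meas: "I s \<in> borel_measurable M" if "0 \<le> s" for s
    using ito measurable_F_M[OF that] that unfolding ito_integral_def adapted_process_def by blast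
  have B_cont: "AE \<omega> in M. continuous_on {0..} (\<lambda>s. B s \<omega>)"
    using brownian unfolding brownian_motion_def by blast
  have H_meas[measurable]: "(\<lambda>(s, \<omega>). ?H s \<omega>) \<in> borel_measurable (borel \<Otimes>\<^sub>M M)"
  proof -
    have "(\<lambda>(s, \<omega>). H s \<omega>) \<in> borel_measurable (restrict_space borel {0..T} \<Otimes>\<^sub>M F T)"
      using ito \<open>0 \<le> T\<close> unfolding ito_integral_def progressive_process_def by blast
    moreover have "(\<lambda>\<omega>. \<omega>) \<in> M \<rightarrow>\<^sub>M F T"
      using subalgebra_F[OF \<open>0 \<le> T\<close>] by (auto simp: subalgebra_def measurable_def)
    \<comment> \<open>Clamping time into [0,T] makes a function on the whole product out of one on
      the restricted product. The values produced by clamping are removed afterwards by the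
      indicator.\<close>
    then have "(\<lambda>x. (max 0 (min T (fst x)), snd x)) \<in> borel \<Otimes>\<^sub>M M \<rightarrow>\<^sub>M restrict_space borel {0..T} \<Otimes>\<^sub>M F T"
      using \<open>0 \<le> T\<close>
      by (intro measurable_Pair measurable_restrict_space2 measurable_compose[OF measurable_snd]) auto
    ultimately have "(\<lambda>x. H (max 0 (min T (fst x))) (snd x)) \<in> borel_measurable (borel \<Otimes>\<^sub>M M)"
      using measurable_compose by fastforce
    then have "(\<lambda>x. H (max 0 (min T (fst x))) (snd x) * indicator {0..T} (fst x))
        \<in> borel_measurable (borel \<Otimes>\<^sub>M M)"
      by measurable
    moreover have "(\<lambda>x. H (max 0 (min T (fst x))) (snd x) * indicator {0..T} (fst x))
        = (\<lambda>(s, \<omega>). ?H s \<omega>)"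
      by (auto simp: fun_eq_iff split: split_indicator)
    ultimately show ?thesis by simp
  qed
  define H' where "H' k = simple_process (n k) (\<tau> k) (\<eta> k)" for k
  define N where "N k = simple_integral B (n k) (\<tau> k) (\<eta> k)" for k
  have el: "elementary (H' k) (N k)" for k
    unfolding H'_def N_def by (rule elementary_simple[OF simple])
  note [measurable] = elementary_measurable(1)[OF el]
  define D where "D k \<omega> = (\<integral>\<^sup>+s\<in>{0..T}. ennreal ((?H s \<omega> - H' k s \<omega>)\<^sup>2) \<partial>lborel)" for k \<omega>
  have [measurable]: "D k \<in> borel_measurable M" for k unfolding D_def[abs_def] by measurable
  have D_eq: "D k \<omega> = (\<integral>\<^sup>+s\<in>{0..T}. ennreal ((H s \<omega> - H' k s \<omega>)\<^sup>2) \<partial>lborel)" for k \<omega>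
    unfolding D_def by (intro nn_integral_cong) (auto split: split_indicator)
  define E where "E k \<epsilon> = {\<omega>\<in>space M. \<exists>s\<in>{0..T}. \<bar>I s \<omega> - N k s \<omega>\<bar> > \<epsilon>}" for k \<epsilon>
  obtain d :: "nat \<Rightarrow> real" where d: "range d \<subseteq> {0..T}" "closure (range d) = {0..T}"
    using dense_times[OF \<open>0 \<le> T\<close>] by blast
  \<comment> \<open>\<open>E\<close> is a union over uncountably many times. On paths where
    \<open>B\<close> is continuous it agrees with the union over dense times, and completeness of
    the measure turns this almost sure agreement into measurability.\<close>
  have E_meas[measurable]: "E k \<epsilon> \<in> sets M" for k \<epsilon>
  proof (rule in_sets_AE)
    have "\<And>i. I (d i) \<in> borel_measurable M" "\<And>i. N k (d i) \<in> borel_measurable M"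
      using d(1) I_meas elementary_measurable(2)[OF el] by (auto simp: image_subset_iff)
    then show "{\<omega>\<in>space M. \<exists>i. \<bar>I (d i) \<omega> - N k (d i) \<omega>\<bar> > \<epsilon>} \<in> sets M" by measurable
    show "AE \<omega> in M. \<omega> \<in> {\<omega>\<in>space M. \<exists>i. \<bar>I (d i) \<omega> - N k (d i) \<omega>\<bar> > \<epsilon>} \<longleftrightarrow> \<omega> \<in> E k \<epsilon>"
      using B_cont AE_space
    proof eventually_elim
      case (elim \<omega>)
      have "continuous_on {0..} (\<lambda>s. \<bar>I s \<omega> - N k s \<omega>\<bar>)"
        unfolding N_def using elim
        by (intro continuous_intros I_cont simple_integral_continuous simple)
      then have cont: "continuous_on (closure (range d)) (\<lambda>s. \<bar>I s \<omega> - N k s \<omega>\<bar>)"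
        unfolding d(2) by (rule continuous_on_subset) auto
      have "\<bar>I s \<omega> - N k s \<omega>\<bar> \<le> \<epsilon>"
        if "\<forall>i. \<bar>I (d i) \<omega> - N k (d i) \<omega>\<bar> \<le> \<epsilon>" "s \<in> {0..T}" for s
      proof -
        have "s \<in> closure (range d)" using that(2) unfolding d(2) .
        moreover have "\<And>x. x \<in> range d \<Longrightarrow> \<bar>I x \<omega> - N k x \<omega>\<bar> \<le> \<epsilon>" using that(1) by blast
        ultimately show ?thesis by (rule continuous_le_on_closure[OF cont])
      qed
      moreover have "d i \<in> {0..T}" for i using d(1) by (auto simp: image_subset_iff)
      ultimately show ?case using elim(2) unfolding E_def by (simp, meson not_less)
    qed
  qed (auto simp: E_def)
  have "\<exists>k. measure M {\<omega>\<in>space M. ennreal ((1/2)^j) < D k \<omega>} < (1/2)^j \<and> measure M (E k ((1/2)^j)) < (1/2)^j" for j :: nat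
  proof -
    have "eventually (\<lambda>k. measure M {\<omega>\<in>space M. ennreal ((1/2)^j) < D k \<omega>} < (1/2)^j) sequentially"
      using conv[OF \<open>0 \<le> T\<close>, of "(1/2)^j"] unfolding D_eq H'_def
      by (intro order_tendstoD) auto
    moreover have "eventually (\<lambda>k. measure M (E k ((1/2)^j)) < (1/2)^j) sequentially"
      using conv[OF \<open>0 \<le> T\<close>, of "(1/2)^j"] unfolding E_def N_def
      by (intro order_tendstoD) auto
    ultimately have "eventually (\<lambda>k. measure M {\<omega>\<in>space M. ennreal ((1/2)^j) < D k \<omega>} < (1/2)^j
        \<and> measure M (E k ((1/2)^j)) < (1/2)^j) sequentially"
      by eventually_elim blast
    then show ?thesis by (rule eventually_happens'[OF sequentially_bot])
  qed
  then obtain r where r: "\<And>j. measure M {\<omega>\<in>space M. ennreal ((1/2)^j) < D (r j) \<omega>} < (1/2)^j"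
      "\<And>j. measure M (E (r j) ((1/2)^j)) < (1/2)^j" by metis
  \<comment> \<open>Both kinds of failure have probability below (1/2)^j, so the probabilities are
    summable and almost every path lies in only finitely many of the bad events.\<close>
  define bad where "bad j = {\<omega>\<in>space M. ennreal ((1/2)^j) < D (r j) \<omega>} \<union> E (r j) ((1/2)^j)" for j
  have [measurable]: "bad j \<in> sets M" for j unfolding bad_def by measurable
  have bad_le: "measure M (bad j) \<le> 2 * (1/2)^j" for j
    unfolding bad_def using r[of j] by (intro order_trans[OF measure_Un_le]) auto
  have geometric: "summable (\<lambda>j. 2 * (1/2 :: real)^j)"
    by (intro summable_mult summable_geometric) simp
  have "summable (\<lambda>j. measure M (bad j))"
    by (rule summable_comparison_test'[OF geometric, of 0]) (use bad_le in simp)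
  then have "AE \<omega> in M. eventually (\<lambda>j. \<omega> \<in> space M - bad j) sequentially"
    by (intro borel_cantelli_AE1) (auto simp: less_top[symmetric])
  then have "AE \<omega> in M. (\<lambda>j. D (r j) \<omega>) \<longlonglongrightarrow> 0 \<and> (\<forall>s\<in>{0..T}. (\<lambda>j. N (r j) s \<omega>) \<longlonglongrightarrow> I s \<omega>)"
  proof eventually_elim
    case (elim \<omega>)
    have half: "(\<lambda>j. (1/2 :: real)^j) \<longlonglongrightarrow> 0" by (intro LIMSEQ_power_zero) auto
    have pow: "(\<lambda>j. ennreal ((1/2)^j)) \<longlonglongrightarrow> 0" using tendsto_ennrealI[OF half] by simp
    have "eventually (\<lambda>j. D (r j) \<omega> \<le> ennreal ((1/2)^j)) sequentially"
      using elim by (rule eventually_mono) (auto simp: bad_def not_less)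
    then have "(\<lambda>j. D (r j) \<omega>) \<longlonglongrightarrow> 0"
      by (intro tendsto_sandwich[OF _ _ tendsto_const pow]) auto
    moreover have "(\<lambda>j. N (r j) s \<omega>) \<longlonglongrightarrow> I s \<omega>" if s: "s \<in> {0..T}" for s
    proof -
      have "eventually (\<lambda>j. norm (I s \<omega> - N (r j) s \<omega>) \<le> (1/2)^j) sequentially"
        using elim by (rule eventually_mono) (use s in \<open>auto simp: bad_def E_def not_less\<close>)
      then have "(\<lambda>j. I s \<omega> - N (r j) s \<omega>) \<longlonglongrightarrow> 0" by (rule Lim_null_comparison[OF _ half])
      then show ?thesis by (rule Lim_transform2[OF tendsto_const])
    qed
    ultimately show ?case by blast
  qed
  then have "(\<forall>j. elementary (H' (r j)) (N (r j))) \<and> (AE \<omega> in M.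
      (\<lambda>j. \<integral>\<^sup>+s\<in>{0..T}. ennreal ((?H s \<omega> - H' (r j) s \<omega>)\<^sup>2) \<partial>lborel) \<longlonglongrightarrow> 0 \<and>
      (\<forall>s\<in>{0..T}. (\<lambda>j. N (r j) s \<omega>) \<longlonglongrightarrow> I s \<omega>))"
    unfolding D_def using el by blast
  then have "\<exists>H' N. (\<forall>j. elementary (H' j) (N j)) \<and> (AE \<omega> in M.
      (\<lambda>j. \<integral>\<^sup>+s\<in>{0..T}. ennreal ((?H s \<omega> - H' j s \<omega>)\<^sup>2) \<partial>lborel) \<longlonglongrightarrow> 0 \<and>
      (\<forall>s\<in>{0..T}. (\<lambda>j. N j s \<omega>) \<longlonglongrightarrow> I s \<omega>))"
    by (rule_tac exI[of _ "\<lambda>j. H' (r j)"], rule_tac exI[of _ "\<lambda>j. N (r j)"])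
  then show ?thesis
    unfolding ito_limit_def using H_meas I_meas by simp
qed

end

section \<open>Moment bounds by localisation\<close>

text \<open>At the first time \<open>p\<close> at which the continuous function \<open>A\<close>
  reaches \<open>R\<close>, its value is already accumulated by integrating over times with
  \<open>A s < R\<close>. This plays the part of stopping at \<open>p\<close>, but is stated as a
  cutoff at each time, the form that a Gronwall argument for truncated moments can use.\<close>

lemma min_le_truncated_integral:
  fixes f :: "real \<Rightarrow> ennreal" and R :: ennreal
  assumes [measurable]: "f \<in> borel_measurable borel"
    and fin: "(\<integral>\<^sup>+s\<in>{0..T}. f s \<partial>lborel) < \<infinity>" and "0 \<le> T"
  defines "A \<equiv> \<lambda>u. \<integral>\<^sup>+s\<in>{0..u}. f s \<partial>lborel"
  shows "min R (A T) \<le> (\<integral>\<^sup>+s\<in>{0..T}. indicator {..<R} (A s) * f s \<partial>lborel)"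
proof -
  have A_mono: "A s \<le> A u" if "s \<le> u" for s u
    unfolding A_def using that by (intro nn_integral_mono) (auto split: split_indicator)
  define N where "N = {s\<in>{0..T}. R \<le> A s}"
  show ?thesis
  proof (cases "N = {}")
    case True
    have "A T = (\<integral>\<^sup>+s\<in>{0..T}. f s \<partial>lborel)" by (simp add: A_def)
    also have "\<dots> = (\<integral>\<^sup>+s\<in>{0..T}. indicator {..<R} (A s) * f s \<partial>lborel)"
    proof (intro nn_integral_cong)
      fix s
      have "A s < R" if "s \<in> {0..T}" using True that by (force simp: N_def)
      then show "f s * indicator {0..T} s = indicator {..<R} (A s) * f s * indicator {0..T} s"
        by (cases "s \<in> {0..T}") auto
    qed
    finally show ?thesis by simp
  next
    case False
    define p where "p = Inf N"
    have bdd: "bdd_below N" by (auto simp: N_def)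
    have p: "0 \<le> p" "p \<le> T"
    proof -
      obtain s where "s \<in> N" using False by blast
      then show "p \<le> T" using cInf_lower[OF _ bdd, of s] by (simp add: p_def N_def)
      show "0 \<le> p" unfolding p_def using False by (rule cInf_greatest) (simp add: N_def)
    qed
    \<comment> \<open>\<open>p\<close> is only an infimum, so it is approached from the right, where
      \<open>A\<close> is already at least \<open>R\<close>; dominated convergence carries the bound
      to \<open>p\<close>.\<close>
    define t where "t n = min T (p + 1 / real (Suc n))" for n
    have "t \<longlonglongrightarrow> min T (p + 0)"
      unfolding t_def by (intro tendsto_intros LIMSEQ_inverse_real_of_nat[unfolded inverse_eq_divide])
    then have t_lim: "t \<longlonglongrightarrow> p" using p by simp
    have "R \<le> A (t n)" for n
    proof -
      have "Inf N < p + 1 / real (Suc n)" by (simp add: p_def)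
      then obtain s where "s \<in> N" "s < p + 1 / real (Suc n)" using False bdd by (auto simp: cInf_less_iff)
      then show ?thesis using A_mono[of s "t n"] by (auto simp: N_def t_def)
    qed
    moreover have "(\<lambda>n. A (t n)) \<longlonglongrightarrow> A p"
      unfolding A_def
    proof (rule nn_integral_dominated_convergence)
      show "AE s in lborel. f s * indicator {0..t n} s \<le> f s * indicator {0..T} s" for n
        by (auto simp: t_def split: split_indicator)
      show "(\<integral>\<^sup>+s\<in>{0..T}. f s \<partial>lborel) < \<infinity>" by (rule fin)
      have "(\<lambda>n. f s * indicator {0..t n} s) \<longlonglongrightarrow> f s * indicator {0..p} s" for s
      proof (cases "s \<le> p")
        case True
        then have "s \<le> t n" for n using p by (auto simp: t_def intro: add_increasing2)
        then show ?thesis using True by (simp add: indicator_def)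
      next
        case False
        then have "eventually (\<lambda>n. t n < s) sequentially" by (intro order_tendstoD[OF t_lim]) simp
        then have "eventually (\<lambda>n. f s * indicator {0..t n} s = f s * indicator {0..p} s) sequentially"
          by (rule eventually_mono) (use False in \<open>auto split: split_indicator\<close>)
        then show ?thesis by (rule tendsto_eventually)
      qed
      then show "AE s in lborel. (\<lambda>n. f s * indicator {0..t n} s) \<longlonglongrightarrow> f s * indicator {0..p} s" by simp
    qed measurable
    ultimately have "R \<le> A p" by (intro LIMSEQ_le_const) auto
    \<comment> \<open>The single point \<open>p\<close>, where the cutoff may already be active, has
      Lebesgue measure zero.\<close>
    also have "A p = (\<integral>\<^sup>+s\<in>{0..<p}. f s \<partial>lborel)"
      unfolding A_def
      by (intro nn_integral_cong_AE, use AE_lborel_singleton[of p] in eventually_elim)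
        (auto split: split_indicator)
    also have "\<dots> \<le> (\<integral>\<^sup>+s\<in>{0..T}. indicator {..<R} (A s) * f s \<partial>lborel)"
    proof (intro nn_integral_mono)
      fix s
      have "A s < R" if "0 \<le> s" "s < p"
      proof (rule ccontr)
        assume "\<not> A s < R"
        then have "s \<in> N" using that p by (simp add: N_def)
        then show False using cInf_lower[OF _ bdd, of s] that by (simp add: p_def)
      qed
      then show "f s * indicator {0..<p} s \<le> indicator {..<R} (A s) * f s * indicator {0..T} s"
        using p by (auto split: split_indicator)
    qed
    finally show ?thesis by (simp add: min.coboundedI1)
  qed
qed

context filtered_brownian
begin

text \<open>The bracket need not be integrable a priori, so Gronwall's inequality is applied to the second moment
  of the running supremum on the event that the bracket is below \<open>R\<close>, with a bound independent of \<open>R\<close>.\<close>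

lemma second_moment_bound:
  fixes q :: "real \<Rightarrow> ennreal"
  assumes ito: "ito_limit T H I" and "0 \<le> T"
    and I_cont: "\<And>\<omega>. \<omega> \<in> space M \<Longrightarrow> continuous_on {0..T} (\<lambda>s. I s \<omega>)"
    and X_cont: "\<And>\<omega>. \<omega> \<in> space M \<Longrightarrow> continuous_on {0..T} (\<lambda>s. X s \<omega>)"
    and nonneg: "0 < L" "0 \<le> c"
    and growth_X: "AE \<omega> in M. \<forall>t\<in>{0..T}.
      ennreal \<bar>X t \<omega>\<bar> \<le> ennreal (c + \<bar>I t \<omega>\<bar>) + ennreal L * (\<integral>\<^sup>+s\<in>{0..t}. ennreal \<bar>X s \<omega>\<bar> \<partial>lborel)"
    and q[measurable]: "q \<in> borel_measurable borel" and q_fin: "(\<integral>\<^sup>+s\<in>{0..T}. q s \<partial>lborel) < \<infinity>"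
    and growth_H: "\<And>s \<omega>. \<omega> \<in> space M \<Longrightarrow> s \<in> {0..T} \<Longrightarrow>
      ennreal ((H s \<omega>)\<^sup>2) \<le> q s + ennreal L * ennreal ((X s \<omega>)\<^sup>2)"
    and d: "range d \<subseteq> {0..T}"
  shows "(\<integral>\<^sup>+\<omega>. (SUP n::nat. ennreal ((X (d n) \<omega>)\<^sup>2)) \<partial>M) < \<infinity>"
proof -
  have "\<forall>u. \<exists>e :: nat \<Rightarrow> real. u \<in> {0..T} \<longrightarrow> range e \<subseteq> {0..u} \<and> closure (range e) = {0..u}"
    using dense_times by (metis atLeastAtMost_iff)
  then obtain e :: "real \<Rightarrow> nat \<Rightarrow> real"
    where e: "\<And>u. u \<in> {0..T} \<Longrightarrow> range (e u) \<subseteq> {0..u}" "\<And>u. u \<in> {0..T} \<Longrightarrow> closure (range (e u)) = {0..u}"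
    by metis
  have e_in: "e u n \<in> {0..T}" if "u \<in> {0..T}" for u n
    using e(1)[OF that] that by (auto simp: image_subset_iff intro: order_trans[of _ u])
  \<comment> \<open>The sequence \<open>e u\<close> is picked for each \<open>u\<close> separately,
    so measurability of \<open>J\<close> in \<open>u\<close> is not evident. The truncated moments
    \<open>g\<close> below inherit this, which calls for the majorant form of Gronwall's
    inequality.\<close>
  define J where "J u \<omega> = (SUP n. ennreal ((I (e u n) \<omega>)\<^sup>2))" for u \<omega>
  have J_meas[measurable]: "J u \<in> borel_measurable M" if "u \<in> {0..T}" for u
    unfolding J_def[abs_def] using ito_limit_measurable(2)[OF ito e_in[OF that]] by measurable
  have I_le_J: "ennreal ((I s \<omega>)\<^sup>2) \<le> J u \<omega>" if "\<omega> \<in> space M" "u \<in> {0..T}" "s \<in> {0..u}" for s u \<omega>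
    unfolding J_def
    using dense_power2_le[OF continuous_on_subset[OF I_cont[OF that(1)], of "{0..u}"] e(2)[OF that(2)] that(3)] that
    by simp
  have J_mono: "J u \<omega> \<le> J v \<omega>" if "\<omega> \<in> space M" "v \<in> {0..T}" "0 \<le> u" "u \<le> v" for u v \<omega>
    unfolding J_def[of u]
  proof (rule SUP_least)
    fix n
    have "range (e u) \<subseteq> {0..u}" using e(1)[of u] that by simp
    then have "e u n \<in> {0..v}" using that by (auto simp: image_subset_iff intro: order_trans[of _ u])
    then show "ennreal ((I (e u n) \<omega>)\<^sup>2) \<le> J v \<omega>" by (rule I_le_J[OF that(1,2)])
  qed
  \<comment> \<open>Pathwise Gronwall gives |X| <= 2 (c + j) exp (2 L T) when |I| <= j. Squaring
    produces \<open>4 * exp (4 * L * T)\<close>, and (c + j)^2 <= 2 (c^2 + j^2) another factor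
    2.\<close>
  define c1 where "c1 = 8 * exp (4 * L * T)"
  have c1: "0 < c1" by (simp add: c1_def)
  have X_le_J: "AE \<omega> in M. \<forall>u\<in>{0..T}. ennreal ((X u \<omega>)\<^sup>2) \<le> ennreal c1 * (ennreal (c\<^sup>2) + J u \<omega>)"
    using growth_X AE_space
  proof eventually_elim
    case (elim \<omega>)
    show ?case
    proof
      fix u assume u: "u \<in> {0..T}"
      show "ennreal ((X u \<omega>)\<^sup>2) \<le> ennreal c1 * (ennreal (c\<^sup>2) + J u \<omega>)"
      proof (cases "J u \<omega>")
        case top
        then show ?thesis using c1 by (simp add: ennreal_mult_top)
      next
        case (real r)
        define j where "j = sqrt r"
        have I_le: "\<bar>I s \<omega>\<bar> \<le> j" if "s \<in> {0..u}" for s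
        proof -
          have "(I s \<omega>)\<^sup>2 \<le> r" using I_le_J[OF elim(2) u that] real by (simp add: ennreal_le_iff)
          then show ?thesis using real_le_rsqrt[of "\<bar>I s \<omega>\<bar>" r] by (simp add: j_def)
        qed
        have j: "0 \<le> j" using real by (simp add: j_def)
        have "compact ((\<lambda>s. X s \<omega>) ` {0..T})"
          by (intro compact_continuous_image X_cont[OF elim(2)]) simp
        then obtain G where G: "0 < G" "\<And>s. s \<in> {0..T} \<Longrightarrow> \<bar>X s \<omega>\<bar> \<le> G"
          using compact_imp_bounded bounded_pos by (metis image_eqI real_norm_def)
        have "ennreal \<bar>X u \<omega>\<bar> \<le> ennreal (2 * (c + j) * exp (2 * L * u))"
        proof (rule gronwall[where T=u and G=G])
          fix t assume t: "t \<in> {0..u}"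
          then show "ennreal \<bar>X t \<omega>\<bar> \<le> ennreal G" using G u by (intro ennreal_leI) auto
          have "ennreal \<bar>X t \<omega>\<bar> \<le> ennreal (c + \<bar>I t \<omega>\<bar>) + ennreal L * (\<integral>\<^sup>+s\<in>{0..t}. ennreal \<bar>X s \<omega>\<bar> \<partial>lborel)"
            using elim(1) t u by auto
          also have "\<dots> \<le> ennreal (c + j) + ennreal L * (\<integral>\<^sup>+s\<in>{0..t}. ennreal \<bar>X s \<omega>\<bar> \<partial>lborel)"
            using I_le[OF t] by (intro add_right_mono ennreal_leI) simp
          finally show "ennreal \<bar>X t \<omega>\<bar> \<le> ennreal (c + j) + ennreal L * (\<integral>\<^sup>+s\<in>{0..t}. ennreal \<bar>X s \<omega>\<bar> \<partial>lborel)" .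
        qed (use nonneg j G u in auto)
        then have "\<bar>X u \<omega>\<bar> \<le> 2 * (c + j) * exp (2 * L * u)"
          using nonneg j by (simp add: ennreal_le_iff)
        also have "\<dots> \<le> 2 * (c + j) * exp (2 * L * T)"
          using nonneg j u by (intro mult_left_mono) auto
        finally have "\<bar>X u \<omega>\<bar>\<^sup>2 \<le> (2 * (c + j) * exp (2 * L * T))\<^sup>2"
          by (intro power_mono) auto
        also have "\<dots> = 4 * exp (4 * L * T) * (c + j)\<^sup>2"
        proof -
          have "exp (4 * L * T) = (exp (2 * L * T))\<^sup>2"
            using exp_double[of "2 * L * T"] by (simp add: mult.assoc)
          then show ?thesis by (simp only: power_mult_distrib) simp
        qed
        also have "\<dots> \<le> 4 * exp (4 * L * T) * (2 * (c\<^sup>2 + r))"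
        proof (rule mult_left_mono)
          have "j\<^sup>2 = r" using real by (simp add: j_def)
          then show "(c + j)\<^sup>2 \<le> 2 * (c\<^sup>2 + r)"
            using zero_le_power2[of "c - j"] by (simp add: power2_sum power2_diff)
        qed simp
        finally have "(X u \<omega>)\<^sup>2 \<le> c1 * (c\<^sup>2 + r)" by (simp add: c1_def algebra_simps)
        then have "ennreal ((X u \<omega>)\<^sup>2) \<le> ennreal (c1 * (c\<^sup>2 + r))" by (rule ennreal_leI)
        also have "\<dots> = ennreal c1 * (ennreal (c\<^sup>2) + J u \<omega>)"
          using real c1 by (simp add: ennreal_mult)
        finally show ?thesis .
      qed
    qed
  qed
  have H_meas[measurable]: "(\<lambda>(s, \<omega>). H s \<omega>) \<in> borel_measurable (borel \<Otimes>\<^sub>M M)"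
    by (rule ito_limit_measurable[OF ito])
  define A where "A u \<omega> = (\<integral>\<^sup>+s\<in>{0..u}. ennreal ((H s \<omega>)\<^sup>2) \<partial>lborel)" for u \<omega>
  have A_mono: "A u \<omega> \<le> A v \<omega>" if "u \<le> v" for u v \<omega>
    unfolding A_def using that by (intro nn_integral_mono) (auto split: split_indicator)
  have A_meas[measurable]: "(\<lambda>(u, \<omega>). A u \<omega>) \<in> borel_measurable (borel \<Otimes>\<^sub>M M)"
  proof -
    have "(\<lambda>x. \<integral>\<^sup>+s. ennreal ((H s (snd x))\<^sup>2) * (if 0 \<le> s \<and> s \<le> fst x then 1 else 0) \<partial>lborel)
        \<in> borel_measurable (borel \<Otimes>\<^sub>M M)"
      by measurable
    moreover have "(\<lambda>x. \<integral>\<^sup>+s. ennreal ((H s (snd x))\<^sup>2) * (if 0 \<le> s \<and> s \<le> fst x then 1 else 0) \<partial>lborel)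
        = (\<lambda>(u, \<omega>). A u \<omega>)"
      by (auto simp: A_def fun_eq_iff intro!: nn_integral_cong split: split_indicator)
    ultimately show ?thesis by simp
  qed
  \<comment> \<open>Along one path continuity bounds \<open>X\<close> on [0,T], so the growth
    condition makes the bracket finite, though with a bound that depends on the path.\<close>
  have A_fin: "A u \<omega> < \<infinity>" if "\<omega> \<in> space M" "u \<le> T" for u \<omega>
  proof -
    have "compact ((\<lambda>s. X s \<omega>) ` {0..T})"
      by (intro compact_continuous_image X_cont[OF that(1)]) simp
    then obtain G where G: "0 < G" "\<And>s. s \<in> {0..T} \<Longrightarrow> \<bar>X s \<omega>\<bar> \<le> G"
      using compact_imp_bounded bounded_pos by (metis image_eqI real_norm_def)
    have "A u \<omega> \<le> A T \<omega>" using A_mono that by simp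
    also have "\<dots> \<le> (\<integral>\<^sup>+s. q s * indicator {0..T} s + ennreal (L * G\<^sup>2) * indicator {0..T} s \<partial>lborel)"
      unfolding A_def
    proof (intro nn_integral_mono)
      fix s
      show "ennreal ((H s \<omega>)\<^sup>2) * indicator {0..T} s
          \<le> q s * indicator {0..T} s + ennreal (L * G\<^sup>2) * indicator {0..T} s"
      proof (cases "s \<in> {0..T}")
        case True
        have "(X s \<omega>)\<^sup>2 \<le> G\<^sup>2" using power_mono[OF G(2)[OF True], of 2] by simp
        then have "ennreal L * ennreal ((X s \<omega>)\<^sup>2) \<le> ennreal (L * G\<^sup>2)"
          using nonneg by (simp add: ennreal_mult[symmetric] ennreal_leI mult_left_mono)
        then show ?thesis
          using growth_H[OF that(1) True] True by (simp add: order_trans add_left_mono)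
      qed simp
    qed
    also have "\<dots> = (\<integral>\<^sup>+s\<in>{0..T}. q s \<partial>lborel) + ennreal (L * G\<^sup>2) * ennreal T"
      using \<open>0 \<le> T\<close> by (subst nn_integral_add) (auto simp: nn_integral_cmult_indicator)
    also have "\<dots> < \<infinity>" using q_fin by (simp add: ennreal_mult[symmetric] ennreal_mult_less_top)
    finally show ?thesis .
  qed
  define Q where "Q = enn2real (\<integral>\<^sup>+s\<in>{0..T}. q s \<partial>lborel)"
  have Q: "(\<integral>\<^sup>+s\<in>{0..T}. q s \<partial>lborel) = ennreal Q" "0 \<le> Q" using q_fin by (auto simp: Q_def)
  \<comment> \<open>The factor 4 is Doob's. The bracket rate is at most \<open>q s\<close> plus
    \<open>L\<close> times X^2, and X^2 is at most \<open>c1 * (c\<^sup>2 + J)\<close>;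
    \<open>a\<close> collects what does not involve \<open>J\<close>, leaving
    \<open>4 * L * c1\<close> as the Gronwall constant.\<close>
  define a where "a = 4 * (Q + L * c1 * c\<^sup>2 * T)"
  have a: "0 \<le> a" using Q nonneg c1 \<open>0 \<le> T\<close> by (simp add: a_def)
  have localized: "(\<integral>\<^sup>+\<omega>. indicator {..<ennreal (real R)} (A T \<omega>) * J T \<omega> \<partial>M)
      \<le> ennreal (2 * a * exp (2 * (4 * L * c1) * T))" for R :: nat
  proof -
    \<comment> \<open>The cutoff moves with \<open>u\<close>. Writing the capped bracket at
      \<open>u\<close> as a time integral produces the cutoff \<open>A s < R\<close> at each earlier
      \<open>s\<close>, which is the one in \<open>g s\<close>, so the inequality closes.\<close>
    define g where "g u = (\<integral>\<^sup>+\<omega>. indicator {..<ennreal (real R)} (A u \<omega>) * J u \<omega> \<partial>M)" for u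
    have g_le: "g u \<le> 4 * (\<integral>\<^sup>+\<omega>. min (ennreal (real R)) (A u \<omega>) \<partial>M)" if "u \<in> {0..T}" for u
      unfolding g_def J_def A_def using that e(1)[OF that] A_fin[of _ u]
      by (intro maximal_inequality_localized ito_limit_mono[OF ito] AE_I2) (auto simp: A_def)
    have "g T \<le> ennreal (2 * a * exp (2 * (4 * L * c1) * T))"
    \<comment> \<open>The a priori bound \<open>4 * real R\<close> grows with \<open>R\<close>, but
      Gronwall's conclusion does not contain it.\<close>
    proof (rule gronwall_majorant[where G="4 * real R" and T=T])
      fix u assume u: "u \<in> {0..T}"
      have "(\<integral>\<^sup>+\<omega>. min (ennreal (real R)) (A u \<omega>) \<partial>M) \<le> (\<integral>\<^sup>+\<omega>. ennreal (real R) \<partial>M)"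
        by (intro nn_integral_mono) simp
      then have "4 * (\<integral>\<^sup>+\<omega>. min (ennreal (real R)) (A u \<omega>) \<partial>M) \<le> 4 * ennreal (real R)"
        by (intro mult_left_mono) (simp_all add: emeasure_space_1)
      then show "g u \<le> ennreal (4 * real R)"
        using g_le[OF u] by (simp add: ennreal_mult)
      fix k :: "real \<Rightarrow> ennreal"
      assume [measurable]: "k \<in> borel_measurable borel" and k: "\<And>s. s \<in> {0..u} \<Longrightarrow> g s \<le> k s"
      have "(\<integral>\<^sup>+\<omega>. min (ennreal (real R)) (A u \<omega>) \<partial>M)
          \<le> (\<integral>\<^sup>+\<omega>. (\<integral>\<^sup>+s\<in>{0..u}. indicator {..<ennreal (real R)} (A s \<omega>) * ennreal ((H s \<omega>)\<^sup>2) \<partial>lborel) \<partial>M)"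
      proof (rule nn_integral_mono)
        fix \<omega> assume \<omega>[measurable]: "\<omega> \<in> space M"
        show "min (ennreal (real R)) (A u \<omega>)
            \<le> (\<integral>\<^sup>+s\<in>{0..u}. indicator {..<ennreal (real R)} (A s \<omega>) * ennreal ((H s \<omega>)\<^sup>2) \<partial>lborel)"
          unfolding A_def using u A_fin[OF \<omega>, of u] by (intro min_le_truncated_integral) (auto simp: A_def)
      qed
      also have "\<dots> = (\<integral>\<^sup>+s. (\<integral>\<^sup>+\<omega>. indicator {..<ennreal (real R)} (A s \<omega>) * ennreal ((H s \<omega>)\<^sup>2) * indicator {0..u} s \<partial>M) \<partial>lborel)"
      proof -
        interpret pair_sigma_finite lborel M ..
        have "(\<lambda>(s, \<omega>). indicator {..<ennreal (real R)} (A s \<omega>) * ennreal ((H s \<omega>)\<^sup>2) * indicator {0..u} s)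
            \<in> borel_measurable (lborel \<Otimes>\<^sub>M M)"
          by measurable
        then show ?thesis by (rule Fubini')
      qed
      also have "\<dots> \<le> (\<integral>\<^sup>+s. q s * indicator {0..T} s + ennreal (L * c1 * c\<^sup>2) * indicator {0..T} s
          + ennreal (L * c1) * (k s * indicator {0..u} s) \<partial>lborel)"
      proof (rule nn_integral_mono)
        fix s
        show "(\<integral>\<^sup>+\<omega>. indicator {..<ennreal (real R)} (A s \<omega>) * ennreal ((H s \<omega>)\<^sup>2) * indicator {0..u} s \<partial>M)
            \<le> q s * indicator {0..T} s + ennreal (L * c1 * c\<^sup>2) * indicator {0..T} s
              + ennreal (L * c1) * (k s * indicator {0..u} s)"
        proof (cases "s \<in> {0..u}")
          case True
          then have s: "s \<in> {0..T}" using u by auto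
          note [measurable] = J_meas[OF s]
          have "(\<integral>\<^sup>+\<omega>. indicator {..<ennreal (real R)} (A s \<omega>) * ennreal ((H s \<omega>)\<^sup>2) \<partial>M)
              \<le> (\<integral>\<^sup>+\<omega>. (q s + ennreal (L * c1 * c\<^sup>2)) + ennreal (L * c1) * (indicator {..<ennreal (real R)} (A s \<omega>) * J s \<omega>) \<partial>M)"
          proof (rule nn_integral_mono_AE)
            show "AE \<omega> in M. indicator {..<ennreal (real R)} (A s \<omega>) * ennreal ((H s \<omega>)\<^sup>2)
                \<le> (q s + ennreal (L * c1 * c\<^sup>2)) + ennreal (L * c1) * (indicator {..<ennreal (real R)} (A s \<omega>) * J s \<omega>)"
              using X_le_J AE_space
            proof eventually_elim
              case (elim \<omega>)
              have "ennreal ((H s \<omega>)\<^sup>2) \<le> q s + ennreal L * ennreal ((X s \<omega>)\<^sup>2)"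
                by (rule growth_H[OF elim(2) s])
              also have "\<dots> \<le> q s + ennreal L * (ennreal c1 * (ennreal (c\<^sup>2) + J s \<omega>))"
                using elim(1) s by (intro add_left_mono mult_left_mono) auto
              also have "\<dots> = q s + ennreal (L * c1 * c\<^sup>2) + ennreal (L * c1) * J s \<omega>"
                using nonneg c1 by (simp add: ennreal_mult distrib_left mult.assoc add.assoc)
              finally show ?case by (simp split: split_indicator)
            qed
          qed
          also have "\<dots> = (q s + ennreal (L * c1 * c\<^sup>2)) + ennreal (L * c1) * g s"
            unfolding g_def by (subst nn_integral_add) (auto simp: nn_integral_cmult emeasure_space_1)
          also have "\<dots> \<le> (q s + ennreal (L * c1 * c\<^sup>2)) + ennreal (L * c1) * k s"
            by (intro add_left_mono mult_left_mono k[OF True]) simp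
          finally show ?thesis using True s by simp
        qed simp
      qed
      also have "\<dots> = (\<integral>\<^sup>+s\<in>{0..T}. q s \<partial>lborel) + ennreal (L * c1 * c\<^sup>2) * ennreal T
          + ennreal (L * c1) * (\<integral>\<^sup>+s\<in>{0..u}. k s \<partial>lborel)"
        using \<open>0 \<le> T\<close> by (simp add: nn_integral_add nn_integral_cmult nn_integral_cmult_indicator)
      also have "(\<integral>\<^sup>+s\<in>{0..T}. q s \<partial>lborel) + ennreal (L * c1 * c\<^sup>2) * ennreal T
          = ennreal (Q + L * c1 * c\<^sup>2 * T)"
        using Q nonneg c1 \<open>0 \<le> T\<close> by (simp add: ennreal_mult)
      finally have "4 * (\<integral>\<^sup>+\<omega>. min (ennreal (real R)) (A u \<omega>) \<partial>M)
          \<le> 4 * (ennreal (Q + L * c1 * c\<^sup>2 * T) + ennreal (L * c1) * (\<integral>\<^sup>+s\<in>{0..u}. k s \<partial>lborel))"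
        by (rule mult_left_mono) simp
      also have "\<dots> = ennreal a + ennreal (4 * L * c1) * (\<integral>\<^sup>+s\<in>{0..u}. k s \<partial>lborel)"
        using Q nonneg c1 \<open>0 \<le> T\<close> by (simp add: a_def distrib_left ennreal_mult mult.assoc)
      finally show "g u \<le> ennreal a + ennreal (4 * L * c1) * (\<integral>\<^sup>+s\<in>{0..u}. k s \<partial>lborel)"
        using g_le[OF u] by (rule order_trans[rotated])
    qed (use a nonneg c1 \<open>0 \<le> T\<close> in auto)
    then show ?thesis by (simp add: g_def)
  qed
  have [measurable]: "J T \<in> borel_measurable M" "A T \<in> borel_measurable M"
    using J_meas[of T] \<open>0 \<le> T\<close> by auto
  have J_fin: "(\<integral>\<^sup>+\<omega>. J T \<omega> \<partial>M) < \<infinity>"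
    by (rule le_less_trans[OF nn_integral_le_truncated[OF _ _ _ localized]]) (auto intro!: AE_I2 A_fin[simplified])
  have "(\<integral>\<^sup>+\<omega>. (SUP n::nat. ennreal ((X (d n) \<omega>)\<^sup>2)) \<partial>M) \<le> (\<integral>\<^sup>+\<omega>. ennreal c1 * (ennreal (c\<^sup>2) + J T \<omega>) \<partial>M)"
  proof (rule nn_integral_mono_AE)
    show "AE \<omega> in M. (SUP n::nat. ennreal ((X (d n) \<omega>)\<^sup>2)) \<le> ennreal c1 * (ennreal (c\<^sup>2) + J T \<omega>)"
      using X_le_J AE_space
    proof eventually_elim
      case (elim \<omega>)
      show ?case
      proof (rule SUP_least)
        fix n
        have dn: "d n \<in> {0..T}" using d by (auto simp: image_subset_iff)
        have "ennreal ((X (d n) \<omega>)\<^sup>2) \<le> ennreal c1 * (ennreal (c\<^sup>2) + J (d n) \<omega>)" using elim(1) dn by blast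
        also have "\<dots> \<le> ennreal c1 * (ennreal (c\<^sup>2) + J T \<omega>)"
          using dn J_mono[OF elim(2), of T "d n"] by (intro mult_left_mono add_left_mono) auto
        finally show "ennreal ((X (d n) \<omega>)\<^sup>2) \<le> ennreal c1 * (ennreal (c\<^sup>2) + J T \<omega>)" .
      qed
    qed
  qed
  also have "\<dots> = ennreal c1 * (ennreal (c\<^sup>2) + (\<integral>\<^sup>+\<omega>. J T \<omega> \<partial>M))"
    by (simp add: nn_integral_cmult nn_integral_add emeasure_space_1)
  also have "\<dots> < \<infinity>" using J_fin by (simp add: ennreal_mult_less_top)
  finally show ?thesis .
qed

end

section \<open>Mean reflected equations\<close>

text \<open>Rounding time down to multiples of 1/(n+1) leaves countably many random variables, so
  the rounded process is jointly measurable; path continuity lets the mesh tend to zero. Clamping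
  keeps the rounded times inside [0,T].\<close>

lemma continuous_paths_jointly_measurable:
  fixes X :: "real \<Rightarrow> 'b \<Rightarrow> real"
  assumes "0 \<le> T" and meas: "\<And>s. s \<in> {0..T} \<Longrightarrow> X s \<in> borel_measurable M"
    and cont: "\<And>\<omega>. \<omega> \<in> space M \<Longrightarrow> continuous_on {0..T} (\<lambda>s. X s \<omega>)"
  shows "(\<lambda>(s, \<omega>). X s \<omega> * indicator {0..T} s) \<in> borel_measurable (borel \<Otimes>\<^sub>M M)"
proof -
  define c where "c s = max 0 (min T s)" for s :: real
  have c: "c s \<in> {0..T}" for s using assms(1) by (auto simp: c_def)
  have c_cont: "continuous_on UNIV c" unfolding c_def by (intro continuous_intros)
  define Y where "Y n x = X (c (real_of_int \<lfloor>real (Suc n) * fst x\<rfloor> / real (Suc n))) (snd x)" for n and x :: "real \<times> 'b"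
  have "Y n \<in> borel_measurable (borel \<Otimes>\<^sub>M M)" for n
    unfolding Y_def
  proof (rule measurable_compose_countable[where g="\<lambda>x. \<lfloor>real (Suc n) * fst x\<rfloor>"])
    show "(\<lambda>x. X (c (real_of_int i / real (Suc n))) (snd x)) \<in> borel_measurable (borel \<Otimes>\<^sub>M M)" for i
      using meas[OF c] by measurable
  qed measurable
  moreover have "(\<lambda>n. Y n x) \<longlonglongrightarrow> X (c (fst x)) (snd x)" if x: "x \<in> space (borel \<Otimes>\<^sub>M M)" for x
  proof -
    let ?r = "\<lambda>n. real_of_int \<lfloor>real (Suc n) * fst x\<rfloor> / real (Suc n)"
    have "?r \<longlonglongrightarrow> fst x"
    proof (rule tendsto_sandwich)
      show "eventually (\<lambda>n. fst x - 1 / real (Suc n) \<le> ?r n) sequentially"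
      proof (rule always_eventually, rule allI)
        fix n
        have "real (Suc n) * fst x - 1 \<le> real_of_int \<lfloor>real (Suc n) * fst x\<rfloor>" by linarith
        then have "(real (Suc n) * fst x - 1) / real (Suc n) \<le> ?r n" by (intro divide_right_mono) auto
        then show "fst x - 1 / real (Suc n) \<le> ?r n" by (simp add: diff_divide_distrib)
      qed
      show "eventually (\<lambda>n. ?r n \<le> fst x) sequentially"
      proof (rule always_eventually, rule allI)
        fix n
        have "?r n \<le> (real (Suc n) * fst x) / real (Suc n)" by (intro divide_right_mono) auto
        then show "?r n \<le> fst x" by simp
      qed
      have "(\<lambda>n. fst x - 1 / real (Suc n)) \<longlonglongrightarrow> fst x - 0"
        by (intro tendsto_intros LIMSEQ_inverse_real_of_nat[unfolded inverse_eq_divide])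
      then show "(\<lambda>n. fst x - 1 / real (Suc n)) \<longlonglongrightarrow> fst x" by simp
    qed (rule tendsto_const)
    then have "(\<lambda>n. c (?r n)) \<longlonglongrightarrow> c (fst x)"
      using c_cont by (auto intro: continuous_on_tendsto_compose)
    then show ?thesis
      unfolding Y_def using x c
      by (intro continuous_on_tendsto_compose[OF cont]) (auto simp: space_pair_measure)
  qed
  ultimately have "(\<lambda>x. X (c (fst x)) (snd x)) \<in> borel_measurable (borel \<Otimes>\<^sub>M M)"
    by (rule borel_measurable_LIMSEQ_real[rotated])
  then have "(\<lambda>x. X (c (fst x)) (snd x) * indicator {0..T} (fst x)) \<in> borel_measurable (borel \<Otimes>\<^sub>M M)"
    by measurable
  moreover have "(\<lambda>x. X (c (fst x)) (snd x) * indicator {0..T} (fst x)) = (\<lambda>(s, \<omega>). X s \<omega> * indicator {0..T} s)"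
    by (auto simp: fun_eq_iff c_def split: split_indicator)
  ultimately show ?thesis by simp
qed

lemma set_integral_norm_bound_nn:
  fixes f :: "real \<Rightarrow> real"
  assumes "set_integrable lborel S f"
  shows "ennreal \<bar>LINT s:S|lborel. f s\<bar> \<le> (\<integral>\<^sup>+s\<in>S. ennreal \<bar>f s\<bar> \<partial>lborel)"
proof -
  have "ennreal \<bar>LINT s:S|lborel. f s\<bar> \<le> (\<integral>\<^sup>+s. ennreal (norm (indicator S s *\<^sub>R f s)) \<partial>lborel)"
    using integral_norm_bound_ennreal assms
    unfolding set_integrable_def set_lebesgue_integral_def by fastforce
  also have "\<dots> = (\<integral>\<^sup>+s\<in>S. ennreal \<bar>f s\<bar> \<partial>lborel)"
    by (intro nn_integral_cong) (auto split: split_indicator)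
  finally show ?thesis .
qed

lemma set_integral_power2_le:
  fixes f :: "real \<Rightarrow> real"
  assumes "set_integrable lborel {0..t} f" "0 \<le> t"
  shows "ennreal ((LINT s:{0..t}|lborel. f s)\<^sup>2) \<le> ennreal t * (\<integral>\<^sup>+s\<in>{0..t}. ennreal ((f s)\<^sup>2) \<partial>lborel)"
proof -
  have [measurable]: "(\<lambda>s. f s * indicator {0..t} s) \<in> borel_measurable borel"
    using assms(1) borel_measurable_integrable[of lborel "\<lambda>s. indicator {0..t} s *\<^sub>R f s"]
    by (simp add: set_integrable_def mult.commute)
  have "ennreal ((LINT s:{0..t}|lborel. f s)\<^sup>2) = (ennreal \<bar>LINT s:{0..t}|lborel. f s\<bar>)\<^sup>2"
    by (simp add: ennreal_power)
  also have "\<dots> \<le> (\<integral>\<^sup>+s\<in>{0..t}. ennreal \<bar>f s\<bar> \<partial>lborel)\<^sup>2"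
    using set_integral_norm_bound_nn[OF assms(1)] by (intro power_mono) auto
  \<comment> \<open>Integrability on a set makes only the product with its indicator measurable, so
    the indicator is moved inside before Cauchy-Schwarz is applied.\<close>
  also have "(\<integral>\<^sup>+s\<in>{0..t}. ennreal \<bar>f s\<bar> \<partial>lborel)
      = (\<integral>\<^sup>+s. ennreal \<bar>f s * indicator {0..t} s\<bar> * indicator {0..t} s \<partial>lborel)"
    by (intro nn_integral_cong) (auto split: split_indicator)
  also have "\<dots>\<^sup>2 \<le> (\<integral>\<^sup>+s. (ennreal \<bar>f s * indicator {0..t} s\<bar>)\<^sup>2 \<partial>lborel)
      * (\<integral>\<^sup>+s. (indicator {0..t} s)\<^sup>2 \<partial>lborel)"
    by (intro Cauchy_Schwarz_nn_integral) auto
  also have "(\<integral>\<^sup>+s. (indicator {0..t} s)\<^sup>2 \<partial>lborel) = ennreal t"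
    using assms(2) by (subst nn_integral_cong[of _ _ "indicator {0..t}"]) (auto split: split_indicator)
  also have "(\<integral>\<^sup>+s. (ennreal \<bar>f s * indicator {0..t} s\<bar>)\<^sup>2 \<partial>lborel) = (\<integral>\<^sup>+s\<in>{0..t}. ennreal ((f s)\<^sup>2) \<partial>lborel)"
    by (intro nn_integral_cong) (auto simp: ennreal_power split: split_indicator)
  finally show ?thesis by (simp add: mult.commute)
qed

text \<open>\<open>L\<close> is the Lipschitz constant of the coefficients and \<open>M'\<close> the
  upper constant of \<open>h\<close>; the letters K and M denote the reflection and the probability
  measure.\<close>

locale mean_reflected = filtered_brownian M F B
  for M :: "'a measure" and F B +
  fixes b \<sigma> :: "real \<Rightarrow> real measure \<Rightarrow> real" and h :: "real \<Rightarrow> real" and L m M' :: real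
  assumes L_pos: "0 < L"
    and lipschitz: "\<And>x y \<mu> \<nu>. \<mu> \<in> P2 \<Longrightarrow> \<nu> \<in> P2 \<Longrightarrow>
           \<bar>b x \<mu> - b y \<nu>\<bar> + \<bar>\<sigma> x \<mu> - \<sigma> y \<nu>\<bar> \<le> L * (\<bar>x - y\<bar> + W2 \<mu> \<nu>)"
    and mono_h: "mono h"
    and m_pos: "0 < m" and m_le: "m \<le> M'"
    and bi_lipschitz: "\<And>x y. m * \<bar>x - y\<bar> \<le> \<bar>h x - h y\<bar> \<and> \<bar>h x - h y\<bar> \<le> M' * \<bar>x - y\<bar>"
begin

abbreviation flat_solution :: "real \<Rightarrow> (real \<Rightarrow> 'a \<Rightarrow> real) \<Rightarrow> (real \<Rightarrow> real) \<Rightarrow> bool" where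
  "flat_solution \<equiv> deterministic_flat_solution M F B b \<sigma> h"

lemma flat_solution_paths:
  assumes "flat_solution \<xi> X K"
  shows "0 \<le> s \<Longrightarrow> X s \<in> borel_measurable M"
    and "\<omega> \<in> space M \<Longrightarrow> continuous_on {0..T} (\<lambda>t. X t \<omega>)"
    and "0 \<le> s \<Longrightarrow> law M (X s) \<in> P2"
    and "0 \<le> s \<Longrightarrow> integrable M (\<lambda>\<omega>. (X s \<omega>)\<^sup>2)"
    and "K 0 = 0" "mono_on {0..} K" "continuous_on {0..} K"
proof -
  show X: "X s \<in> borel_measurable M" if "0 \<le> s" for s
    using assms that measurable_F_M[OF that] unfolding deterministic_flat_solution_def adapted_process_def by blast
  show "continuous_on {0..T} (\<lambda>t. X t \<omega>)" if "\<omega> \<in> space M"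
  proof (rule continuous_on_subset)
    show "continuous_on {0..} (\<lambda>t. X t \<omega>)" using assms that unfolding deterministic_flat_solution_def by blast
  qed auto
  show P2: "law M (X s) \<in> P2" if "0 \<le> s" for s
    using assms that unfolding deterministic_flat_solution_def by blast
  show "integrable M (\<lambda>\<omega>. (X s \<omega>)\<^sup>2)" if "0 \<le> s"
    using P2[OF that] X[OF that] unfolding P2_def law_def by (simp add: integrable_distr_eq)
  show "K 0 = 0" "mono_on {0..} K" "continuous_on {0..} K"
    using assms unfolding deterministic_flat_solution_def by blast+
qed

lemma flat_solution_equation:
  assumes "flat_solution \<xi> X K" "0 \<le> T"
  obtains I where
    "ito_limit T (\<lambda>s \<omega>. \<sigma> (X s \<omega>) (law M (X s)) * indicator {0..T} s) I"
    "\<And>\<omega>. \<omega> \<in> space M \<Longrightarrow> continuous_on {0..T} (\<lambda>s. I s \<omega>)"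
    "AE \<omega> in M. set_integrable lborel {0..T} (\<lambda>s. (\<sigma> (X s \<omega>) (law M (X s)))\<^sup>2)"
    "AE \<omega> in M. \<forall>t\<ge>0. set_integrable lborel {0..t} (\<lambda>s. b (X s \<omega>) (law M (X s))) \<and>
      X t \<omega> = \<xi> + (LINT s:{0..t}|lborel. b (X s \<omega>) (law M (X s))) + I t \<omega> + K t"
proof -
  obtain I where ito: "ito_integral M F B (\<lambda>s \<omega>. \<sigma> (X s \<omega>) (law M (X s))) I"
    and eq: "AE \<omega> in M. \<forall>t\<ge>0. set_integrable lborel {0..t} (\<lambda>s. b (X s \<omega>) (law M (X s))) \<and>
      X t \<omega> = \<xi> + (LINT s:{0..t}|lborel. b (X s \<omega>) (law M (X s))) + I t \<omega> + K t"
    using assms(1) unfolding deterministic_flat_solution_def by blast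
  have "AE \<omega> in M. \<forall>t\<ge>0. set_integrable lborel {0..t} (\<lambda>s. (\<sigma> (X s \<omega>) (law M (X s)))\<^sup>2)"
    using ito unfolding ito_integral_def by blast
  then have sq: "AE \<omega> in M. set_integrable lborel {0..T} (\<lambda>s. (\<sigma> (X s \<omega>) (law M (X s)))\<^sup>2)"
    by eventually_elim (use assms(2) in blast)
  have cont: "continuous_on {0..T} (\<lambda>s. I s \<omega>)" if "\<omega> \<in> space M" for \<omega>
  proof (rule continuous_on_subset)
    show "continuous_on {0..} (\<lambda>t. I t \<omega>)" using ito that unfolding ito_integral_def by blast
  qed auto
  show thesis by (rule that[OF ito_limit_of_integral[OF ito assms(2)] cont sq eq])
qed

text \<open>\<open>x\<close> and \<open>y\<close> are free rather than values of the two solutions.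
  With both solutions equal, \<open>w\<close> is 0 and a Lipschitz estimate at a common law
  results.\<close>

lemma lipschitz_law:
  assumes "flat_solution \<xi> X K" "flat_solution \<zeta> Y K'" "0 \<le> s"
  defines "w \<equiv> sqrt (\<integral>\<omega>. (X s \<omega> - Y s \<omega>)\<^sup>2 \<partial>M)"
  shows "\<bar>b x (law M (X s)) - b y (law M (Y s))\<bar> \<le> L * (\<bar>x - y\<bar> + w)"
    and "\<bar>\<sigma> x (law M (X s)) - \<sigma> y (law M (Y s))\<bar> \<le> L * (\<bar>x - y\<bar> + w)"
proof -
  have "W2 (law M (X s)) (law M (Y s)) \<le> w"
    unfolding w_def using flat_solution_paths(1)[OF assms(1,3)] flat_solution_paths(1)[OF assms(2,3)]
    by (intro W2_law_le prob_space_axioms)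
  then have "L * (\<bar>x - y\<bar> + W2 (law M (X s)) (law M (Y s))) \<le> L * (\<bar>x - y\<bar> + w)"
    using L_pos by (intro mult_left_mono) auto
  moreover note lipschitz[OF flat_solution_paths(3)[OF assms(1,3)] flat_solution_paths(3)[OF assms(2,3)], of x y]
  ultimately show "\<bar>b x (law M (X s)) - b y (law M (Y s))\<bar> \<le> L * (\<bar>x - y\<bar> + w)"
    "\<bar>\<sigma> x (law M (X s)) - \<sigma> y (law M (Y s))\<bar> \<le> L * (\<bar>x - y\<bar> + w)"
    by linarith+
qed

text \<open>For a fixed path \<open>X s \<omega>\<^sub>0\<close>, the Lipschitz condition with equal laws bounds \<open>b (X s \<omega>) \<mu>\<^sub>s\<close> by the
  deterministic integrable function \<open>b (X s \<omega>\<^sub>0) \<mu>\<^sub>s\<close> plus a linear term. No regularity of the laws in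
  time is needed.\<close>

lemma flat_solution_second_moment:
  assumes sol: "flat_solution \<xi> X K" and "0 \<le> T" and d: "range d \<subseteq> {0..T}"
  shows "(\<integral>\<^sup>+\<omega>. (SUP n::nat. ennreal ((X (d n) \<omega>)\<^sup>2)) \<partial>M) < \<infinity>"
proof -
  define \<mu> where "\<mu> s = law M (X s)" for s
  obtain I where I: "ito_limit T (\<lambda>s \<omega>. \<sigma> (X s \<omega>) (\<mu> s) * indicator {0..T} s) I"
    "\<And>\<omega>. \<omega> \<in> space M \<Longrightarrow> continuous_on {0..T} (\<lambda>s. I s \<omega>)"
    "AE \<omega> in M. set_integrable lborel {0..T} (\<lambda>s. (\<sigma> (X s \<omega>) (\<mu> s))\<^sup>2)"
    "AE \<omega> in M. \<forall>t\<ge>0. set_integrable lborel {0..t} (\<lambda>s. b (X s \<omega>) (\<mu> s)) \<and>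
      X t \<omega> = \<xi> + (LINT s:{0..t}|lborel. b (X s \<omega>) (\<mu> s)) + I t \<omega> + K t"
    using flat_solution_equation[OF sol \<open>0 \<le> T\<close>] unfolding \<mu>_def by blast
  note X_cont = flat_solution_paths(2)[OF sol]
  have lip: "\<bar>b x (\<mu> s) - b y (\<mu> s)\<bar> \<le> L * \<bar>x - y\<bar>" "\<bar>\<sigma> x (\<mu> s) - \<sigma> y (\<mu> s)\<bar> \<le> L * \<bar>x - y\<bar>"
    if "0 \<le> s" for s x y
    using lipschitz_law[OF sol sol that, of x y] by (simp_all add: \<mu>_def)
  \<comment> \<open>On a probability space an almost sure property holds at some point; this yields
    the reference path.\<close>
  have "AE \<omega> in M. \<omega> \<in> space M \<and> set_integrable lborel {0..T} (\<lambda>s. b (X s \<omega>) (\<mu> s)) \<and>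
      set_integrable lborel {0..T} (\<lambda>s. (\<sigma> (X s \<omega>) (\<mu> s))\<^sup>2)"
    using I(3,4) AE_space by eventually_elim (use \<open>0 \<le> T\<close> in blast)
  then obtain \<omega>\<^sub>0 where \<omega>\<^sub>0: "\<omega>\<^sub>0 \<in> space M" "set_integrable lborel {0..T} (\<lambda>s. b (X s \<omega>\<^sub>0) (\<mu> s))"
      "set_integrable lborel {0..T} (\<lambda>s. (\<sigma> (X s \<omega>\<^sub>0) (\<mu> s))\<^sup>2)"
    using eventually_happens'[OF ae_filter_bot] by blast
  have "compact ((\<lambda>s. X s \<omega>\<^sub>0) ` {0..T})"
    by (intro compact_continuous_image X_cont[OF \<omega>\<^sub>0(1)]) simp
  then obtain G where G: "0 < G" "\<And>s. s \<in> {0..T} \<Longrightarrow> \<bar>X s \<omega>\<^sub>0\<bar> \<le> G"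
    using compact_imp_bounded bounded_pos by (metis image_eqI real_norm_def)
  define \<beta> where "\<beta> s = indicator {0..T} s *\<^sub>R b (X s \<omega>\<^sub>0) (\<mu> s)" for s
  have \<beta>_int: "integrable lborel \<beta>" using \<omega>\<^sub>0(2) by (simp add: set_integrable_def \<beta>_def[abs_def])
  then have [measurable]: "\<beta> \<in> borel_measurable borel" by (simp add: borel_measurable_integrable[of lborel, simplified])
  define \<gamma> where "\<gamma> s = indicator {0..T} s *\<^sub>R (\<sigma> (X s \<omega>\<^sub>0) (\<mu> s))\<^sup>2" for s
  have \<gamma>_int: "integrable lborel \<gamma>" using \<omega>\<^sub>0(3) by (simp add: set_integrable_def \<gamma>_def[abs_def])
  then have [measurable]: "\<gamma> \<in> borel_measurable borel" by (simp add: borel_measurable_integrable[of lborel, simplified])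
  define Cb where "Cb = (\<integral>s. \<bar>\<beta> s\<bar> \<partial>lborel)"
  have Cb: "(\<integral>\<^sup>+s. ennreal \<bar>\<beta> s\<bar> \<partial>lborel) = ennreal Cb" "0 \<le> Cb"
    unfolding Cb_def using \<beta>_int by (auto intro!: nn_integral_eq_integral)
  have K_bound: "0 \<le> K t" "K t \<le> K T" if "t \<in> {0..T}" for t
    using flat_solution_paths(5,6)[OF sol] that mono_onD[of "{0..}" K 0 t] mono_onD[of "{0..}" K t T] by auto
  \<comment> \<open>\<open>Cb\<close> is the absolute drift integral along the reference path,
    \<open>L * G * T\<close> the Lipschitz cost of the size of that path, and \<open>K T\<close>
    bounds the increasing reflection on [0,T].\<close>
  define c where "c = \<bar>\<xi>\<bar> + (Cb + L * G * T) + K T"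
  have c: "0 \<le> c" using Cb K_bound[of T] L_pos G \<open>0 \<le> T\<close> by (simp add: c_def)
  \<comment> \<open>One constant has to serve two growth conditions: \<open>L\<close> for the drift
    and \<open>4 * L\<^sup>2\<close> for the squared diffusion coefficient.\<close>
  define L' where "L' = L + 4 * L\<^sup>2"
  have L': "0 < L'" "L \<le> L'" "4 * L\<^sup>2 \<le> L'" using L_pos by (auto simp: L'_def add_pos_nonneg)
  show ?thesis
  proof (rule second_moment_bound[OF I(1) \<open>0 \<le> T\<close> I(2) X_cont L'(1) c _ _ _ _ d])
    show "AE \<omega> in M. \<forall>t\<in>{0..T}. ennreal \<bar>X t \<omega>\<bar>
        \<le> ennreal (c + \<bar>I t \<omega>\<bar>) + ennreal L' * (\<integral>\<^sup>+s\<in>{0..t}. ennreal \<bar>X s \<omega>\<bar> \<partial>lborel)"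
      using I(4) AE_space
    proof eventually_elim
      case (elim \<omega>)
      show ?case
      proof
        fix t assume t: "t \<in> {0..T}"
        have int: "set_integrable lborel {0..t} (\<lambda>s. b (X s \<omega>) (\<mu> s))"
          and eq: "X t \<omega> = \<xi> + (LINT s:{0..t}|lborel. b (X s \<omega>) (\<mu> s)) + I t \<omega> + K t"
          using elim(1) t by auto
        have [measurable]: "(\<lambda>s. X s \<omega> * indicator {0..t} s) \<in> borel_measurable borel"
          using borel_measurable_continuous_on_indicator[OF _ X_cont[OF elim(2), of t]]
          by (simp add: mult.commute)
        have "ennreal \<bar>LINT s:{0..t}|lborel. b (X s \<omega>) (\<mu> s)\<bar> \<le> (\<integral>\<^sup>+s\<in>{0..t}. ennreal \<bar>b (X s \<omega>) (\<mu> s)\<bar> \<partial>lborel)"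
          by (rule set_integral_norm_bound_nn[OF int])
        also have "\<dots> \<le> (\<integral>\<^sup>+s. ennreal \<bar>\<beta> s\<bar> + ennreal (L * G) * indicator {0..T} s
            + ennreal L * ennreal \<bar>X s \<omega> * indicator {0..t} s\<bar> \<partial>lborel)"
        proof (intro nn_integral_mono)
          fix s
          show "ennreal \<bar>b (X s \<omega>) (\<mu> s)\<bar> * indicator {0..t} s \<le> ennreal \<bar>\<beta> s\<bar> + ennreal (L * G) * indicator {0..T} s
            + ennreal L * ennreal \<bar>X s \<omega> * indicator {0..t} s\<bar>"
          proof (cases "s \<in> {0..t}")
            case True
            then have s: "s \<in> {0..T}" using t by auto
            have "L * \<bar>X s \<omega> - X s \<omega>\<^sub>0\<bar> \<le> L * (G + \<bar>X s \<omega>\<bar>)"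
              using G(2)[OF s] L_pos by (intro mult_left_mono) auto
            then have "\<bar>b (X s \<omega>) (\<mu> s)\<bar> \<le> \<bar>\<beta> s\<bar> + L * G + L * \<bar>X s \<omega>\<bar>"
              using lip(1)[of s "X s \<omega>" "X s \<omega>\<^sub>0"] s by (simp add: \<beta>_def distrib_left)
            then have "ennreal \<bar>b (X s \<omega>) (\<mu> s)\<bar> \<le> ennreal (\<bar>\<beta> s\<bar> + L * G + L * \<bar>X s \<omega>\<bar>)"
              by (rule ennreal_leI)
            also have "\<dots> = ennreal \<bar>\<beta> s\<bar> + ennreal (L * G) + ennreal L * ennreal \<bar>X s \<omega>\<bar>"
              using L_pos G by (simp add: ennreal_mult)
            finally show ?thesis using True s by simp
          qed simp
        qed
        also have "\<dots> = ennreal Cb + ennreal (L * G) * ennreal T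
            + ennreal L * (\<integral>\<^sup>+s. ennreal \<bar>X s \<omega> * indicator {0..t} s\<bar> \<partial>lborel)"
          using \<open>0 \<le> T\<close> by (simp add: nn_integral_add nn_integral_cmult nn_integral_cmult_indicator Cb)
        also have "(\<integral>\<^sup>+s. ennreal \<bar>X s \<omega> * indicator {0..t} s\<bar> \<partial>lborel) = (\<integral>\<^sup>+s\<in>{0..t}. ennreal \<bar>X s \<omega>\<bar> \<partial>lborel)"
          by (intro nn_integral_cong) (auto split: split_indicator)
        also have "ennreal Cb + ennreal (L * G) * ennreal T = ennreal (Cb + L * G * T)"
          using Cb L_pos G \<open>0 \<le> T\<close> by (simp add: ennreal_mult)
        finally have drift: "ennreal \<bar>LINT s:{0..t}|lborel. b (X s \<omega>) (\<mu> s)\<bar>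
            \<le> ennreal (Cb + L * G * T) + ennreal L * (\<integral>\<^sup>+s\<in>{0..t}. ennreal \<bar>X s \<omega>\<bar> \<partial>lborel)" .
        have "\<bar>X t \<omega>\<bar> \<le> (\<bar>\<xi>\<bar> + K T + \<bar>I t \<omega>\<bar>) + \<bar>LINT s:{0..t}|lborel. b (X s \<omega>) (\<mu> s)\<bar>"
          unfolding eq using K_bound[OF t] by linarith
        then have "ennreal \<bar>X t \<omega>\<bar> \<le> ennreal ((\<bar>\<xi>\<bar> + K T + \<bar>I t \<omega>\<bar>) + \<bar>LINT s:{0..t}|lborel. b (X s \<omega>) (\<mu> s)\<bar>)"
          by (rule ennreal_leI)
        also have "\<dots> = ennreal (\<bar>\<xi>\<bar> + K T + \<bar>I t \<omega>\<bar>) + ennreal \<bar>LINT s:{0..t}|lborel. b (X s \<omega>) (\<mu> s)\<bar>"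
          using K_bound[of T] \<open>0 \<le> T\<close> by (intro ennreal_plus) auto
        also have "\<dots> \<le> ennreal (\<bar>\<xi>\<bar> + K T + \<bar>I t \<omega>\<bar>)
            + (ennreal (Cb + L * G * T) + ennreal L * (\<integral>\<^sup>+s\<in>{0..t}. ennreal \<bar>X s \<omega>\<bar> \<partial>lborel))"
          by (intro add_left_mono drift)
        also have "\<dots> = ennreal (c + \<bar>I t \<omega>\<bar>) + ennreal L * (\<integral>\<^sup>+s\<in>{0..t}. ennreal \<bar>X s \<omega>\<bar> \<partial>lborel)"
        proof -
          have "c + \<bar>I t \<omega>\<bar> = (\<bar>\<xi>\<bar> + K T + \<bar>I t \<omega>\<bar>) + (Cb + L * G * T)" by (simp add: c_def)
          then have "ennreal (c + \<bar>I t \<omega>\<bar>) = ennreal (\<bar>\<xi>\<bar> + K T + \<bar>I t \<omega>\<bar>) + ennreal (Cb + L * G * T)"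
            using K_bound[of T] Cb L_pos G \<open>0 \<le> T\<close> by (simp only:) (intro ennreal_plus, auto)
          then show ?thesis by (simp add: add.assoc)
        qed
        also have "\<dots> \<le> ennreal (c + \<bar>I t \<omega>\<bar>) + ennreal L' * (\<integral>\<^sup>+s\<in>{0..t}. ennreal \<bar>X s \<omega>\<bar> \<partial>lborel)"
          using L' by (intro add_left_mono mult_right_mono ennreal_leI) auto
        finally show "ennreal \<bar>X t \<omega>\<bar> \<le> ennreal (c + \<bar>I t \<omega>\<bar>) + ennreal L' * (\<integral>\<^sup>+s\<in>{0..t}. ennreal \<bar>X s \<omega>\<bar> \<partial>lborel)" .
      qed
    qed
    \<comment> \<open>The diffusion coefficient is split into its value on the reference path and a
      difference of size at most L (|X| + G). Two applications of (x + y)^2 <= 2 x^2 + 2 y^2 give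
      the coefficients 2 and 4.\<close>
    let ?q = "\<lambda>s. ennreal (2 * \<gamma> s) + ennreal (4 * L\<^sup>2 * G\<^sup>2) * indicator {0..T} s"
    show "?q \<in> borel_measurable borel" by measurable
    have \<gamma>_nonneg: "0 \<le> \<gamma> s" for s by (simp add: \<gamma>_def)
    have "(\<integral>\<^sup>+s\<in>{0..T}. ?q s \<partial>lborel) \<le> (\<integral>\<^sup>+s. ?q s \<partial>lborel)"
      by (intro nn_integral_mono) (auto split: split_indicator)
    also have "\<dots> = (\<integral>\<^sup>+s. ennreal (2 * \<gamma> s) \<partial>lborel) + ennreal (4 * L\<^sup>2 * G\<^sup>2) * ennreal T"
      using \<open>0 \<le> T\<close> by (simp add: nn_integral_add nn_integral_cmult_indicator)
    also have "(\<integral>\<^sup>+s. ennreal (2 * \<gamma> s) \<partial>lborel) = ennreal (\<integral>s. 2 * \<gamma> s \<partial>lborel)"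
      using \<gamma>_int \<gamma>_nonneg by (intro nn_integral_eq_integral) auto
    finally show "(\<integral>\<^sup>+s\<in>{0..T}. ?q s \<partial>lborel) < \<infinity>"
      by (rule le_less_trans) (simp add: ennreal_mult_less_top)
    show "ennreal ((\<sigma> (X s \<omega>) (\<mu> s) * indicator {0..T} s)\<^sup>2) \<le> ?q s + ennreal L' * ennreal ((X s \<omega>)\<^sup>2)"
      if "\<omega> \<in> space M" "s \<in> {0..T}" for s \<omega>
    proof -
      have sq: "(x + y)\<^sup>2 \<le> 2 * x\<^sup>2 + 2 * y\<^sup>2" for x y :: real
        using zero_le_power2[of "x - y"] by (simp add: power2_sum power2_diff)
      let ?d = "\<sigma> (X s \<omega>) (\<mu> s) - \<sigma> (X s \<omega>\<^sub>0) (\<mu> s)"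
      have "\<bar>?d\<bar>\<^sup>2 \<le> (L * \<bar>X s \<omega> - X s \<omega>\<^sub>0\<bar>)\<^sup>2"
        using lip(2)[of s "X s \<omega>" "X s \<omega>\<^sub>0"] that by (intro power_mono) auto
      also have "\<dots> = L\<^sup>2 * (X s \<omega> + - X s \<omega>\<^sub>0)\<^sup>2" by (simp add: power_mult_distrib)
      also have "\<dots> \<le> L\<^sup>2 * (2 * (X s \<omega>)\<^sup>2 + 2 * (- X s \<omega>\<^sub>0)\<^sup>2)" by (intro mult_left_mono sq) simp
      also have "\<dots> \<le> L\<^sup>2 * (2 * (X s \<omega>)\<^sup>2 + 2 * G\<^sup>2)"
        using power_mono[OF G(2)[OF that(2)], of 2] by (intro mult_left_mono) auto
      finally have d: "?d\<^sup>2 \<le> L\<^sup>2 * (2 * (X s \<omega>)\<^sup>2 + 2 * G\<^sup>2)" by simp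
      have "(\<sigma> (X s \<omega>) (\<mu> s))\<^sup>2 = (\<sigma> (X s \<omega>\<^sub>0) (\<mu> s) + ?d)\<^sup>2" by simp
      also have "\<dots> \<le> 2 * (\<sigma> (X s \<omega>\<^sub>0) (\<mu> s))\<^sup>2 + 2 * ?d\<^sup>2" by (rule sq)
      also have "\<dots> \<le> 2 * \<gamma> s + 4 * L\<^sup>2 * G\<^sup>2 + 4 * L\<^sup>2 * (X s \<omega>)\<^sup>2"
        using d that by (simp add: \<gamma>_def algebra_simps)
      also have "\<dots> \<le> 2 * \<gamma> s + 4 * L\<^sup>2 * G\<^sup>2 + L' * (X s \<omega>)\<^sup>2"
        using L'(3) by (intro add_left_mono mult_right_mono) auto
      finally have "ennreal ((\<sigma> (X s \<omega>) (\<mu> s))\<^sup>2) \<le> ennreal (2 * \<gamma> s + 4 * L\<^sup>2 * G\<^sup>2 + L' * (X s \<omega>)\<^sup>2)"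
        by (rule ennreal_leI)
      also have "\<dots> = ennreal (2 * \<gamma> s) + ennreal (4 * L\<^sup>2 * G\<^sup>2) + ennreal L' * ennreal ((X s \<omega>)\<^sup>2)"
        using \<gamma>_nonneg[of s] L' by (simp add: ennreal_mult)
      finally show ?thesis using that by simp
    qed
  qed
qed

end

section \<open>Stability in the initial condition\<close>

text \<open>On a compact interval the supremum of a continuous function is an attained maximum, so
  the real \<open>SUP\<close> is a true supremum and agrees with the extended one over dense
  times.\<close>

lemma ennreal_dense_SUP:
  fixes f :: "real \<Rightarrow> real"
  assumes cont: "continuous_on {0..T} f" and "0 \<le> T" and d: "range d \<subseteq> {0..T}" "closure (range d) = {0..T}"
  shows "ennreal (SUP t\<in>{0..T}. \<bar>f t\<bar>\<^sup>2) = (SUP n::nat. ennreal ((f (d n))\<^sup>2))"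
    and "0 \<le> (SUP t\<in>{0..T}. \<bar>f t\<bar>\<^sup>2)"
proof -
  have "continuous_on {0..T} (\<lambda>t. \<bar>f t\<bar>\<^sup>2)" using cont by (intro continuous_intros)
  then obtain u where u: "u \<in> {0..T}" "\<And>t. t \<in> {0..T} \<Longrightarrow> \<bar>f t\<bar>\<^sup>2 \<le> \<bar>f u\<bar>\<^sup>2"
    using continuous_attains_sup[of "{0..T}" "\<lambda>t. \<bar>f t\<bar>\<^sup>2"] \<open>0 \<le> T\<close> by auto
  have eq: "(SUP t\<in>{0..T}. \<bar>f t\<bar>\<^sup>2) = \<bar>f u\<bar>\<^sup>2"
  proof (rule antisym)
    show "(SUP t\<in>{0..T}. \<bar>f t\<bar>\<^sup>2) \<le> \<bar>f u\<bar>\<^sup>2" using u by (intro cSUP_least) auto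
    show "\<bar>f u\<bar>\<^sup>2 \<le> (SUP t\<in>{0..T}. \<bar>f t\<bar>\<^sup>2)"
      using u by (intro cSUP_upper bdd_aboveI2[where M="\<bar>f u\<bar>\<^sup>2"]) auto
  qed
  show "0 \<le> (SUP t\<in>{0..T}. \<bar>f t\<bar>\<^sup>2)" unfolding eq by simp
  show "ennreal (SUP t\<in>{0..T}. \<bar>f t\<bar>\<^sup>2) = (SUP n::nat. ennreal ((f (d n))\<^sup>2))"
    unfolding eq
  proof (rule antisym)
    show "ennreal (\<bar>f u\<bar>\<^sup>2) \<le> (SUP n. ennreal ((f (d n))\<^sup>2))"
      using dense_power2_le[OF cont d(2) u(1)] by simp
    have "(f (d n))\<^sup>2 \<le> \<bar>f u\<bar>\<^sup>2" for n using u(2)[of "d n"] d(1) by (auto simp: image_subset_iff)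
    then show "(SUP n. ennreal ((f (d n))\<^sup>2)) \<le> ennreal (\<bar>f u\<bar>\<^sup>2)"
      by (intro SUP_least ennreal_leI)
  qed
qed

text \<open>The supremum over the whole interval inherits measurability from the countable supremum,
  with which it agrees on every path.\<close>

lemma (in prob_space) L2C_of_dense:
  assumes meas: "\<And>t. t \<in> {0..T} \<Longrightarrow> X t \<in> borel_measurable M"
    and cont: "\<And>\<omega>. \<omega> \<in> space M \<Longrightarrow> continuous_on {0..T} (\<lambda>t. X t \<omega>)"
    and "0 \<le> T" and d: "range d \<subseteq> {0..T}" "closure (range d) = {0..T}"
    and bound: "(\<integral>\<^sup>+\<omega>. (SUP n::nat. ennreal ((X (d n) \<omega>)\<^sup>2)) \<partial>M) \<le> ennreal c" and "0 \<le> c"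
  shows "X \<in> L2C M T" and "L2C_norm M T X \<le> sqrt c"
proof -
  let ?S = "\<lambda>\<omega>. SUP t\<in>{0..T}. \<bar>X t \<omega>\<bar>\<^sup>2"
  have S: "ennreal (?S \<omega>) = (SUP n::nat. ennreal ((X (d n) \<omega>)\<^sup>2))" "0 \<le> ?S \<omega>" if "\<omega> \<in> space M" for \<omega>
    using ennreal_dense_SUP[OF cont[OF that] \<open>0 \<le> T\<close> d] by auto
  have [measurable]: "X (d n) \<in> borel_measurable M" for n
    using d(1) by (intro meas) (auto simp: image_subset_iff)
  have "(\<lambda>\<omega>. enn2real (SUP n::nat. ennreal ((X (d n) \<omega>)\<^sup>2))) \<in> borel_measurable M" by measurable
  also have "?this \<longleftrightarrow> ?S \<in> borel_measurable M"
  proof (rule measurable_cong)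
    fix \<omega> assume "\<omega> \<in> space M"
    then show "enn2real (SUP n::nat. ennreal ((X (d n) \<omega>)\<^sup>2)) = ?S \<omega>"
      using S[of \<omega>] by (metis enn2real_ennreal)
  qed
  finally have S_meas: "?S \<in> borel_measurable M" .
  have nn: "(\<integral>\<^sup>+\<omega>. ennreal (?S \<omega>) \<partial>M) \<le> ennreal c"
    using bound by (subst nn_integral_cong[OF S(1)])
  have S_int: "integrable M ?S"
  proof (rule integrableI_nonneg[OF S_meas])
    show "(\<integral>\<^sup>+\<omega>. ennreal (?S \<omega>) \<partial>M) < \<infinity>" using nn by (rule le_less_trans) simp
  qed (use S(2) in auto)
  then show "X \<in> L2C M T" using meas cont by (auto simp: L2C_def)
  have "ennreal (\<integral>\<omega>. ?S \<omega> \<partial>M) = (\<integral>\<^sup>+\<omega>. ennreal (?S \<omega>) \<partial>M)"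
    using S_int S(2) by (intro nn_integral_eq_integral[symmetric]) auto
  then have "ennreal (\<integral>\<omega>. ?S \<omega> \<partial>M) \<le> ennreal c" using nn by (simp only:)
  then have "(\<integral>\<omega>. ?S \<omega> \<partial>M) \<le> c" using \<open>0 \<le> c\<close> by (simp only: ennreal_le_iff)
  then show "L2C_norm M T X \<le> sqrt c" by (simp add: L2C_norm_def)
qed

context mean_reflected
begin

section \<open>Comparison of two solutions\<close>

lemma integrable_power2_diff:
  assumes "flat_solution \<xi> X K" "flat_solution \<zeta> Y K'" "0 \<le> s"
  shows "integrable M (\<lambda>\<omega>. (X s \<omega> - Y s \<omega>)\<^sup>2)"
proof (rule Bochner_Integration.integrable_bound)
  show "integrable M (\<lambda>\<omega>. 2 * (X s \<omega>)\<^sup>2 + 2 * (Y s \<omega>)\<^sup>2)"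
    using flat_solution_paths(4)[OF assms(1,3)] flat_solution_paths(4)[OF assms(2,3)] by simp
  have "(x - y)\<^sup>2 \<le> 2 * x\<^sup>2 + 2 * y\<^sup>2" for x y :: real
    using zero_le_power2[of "x + y"] by (simp add: power2_sum power2_diff)
  then show "AE \<omega> in M. norm ((X s \<omega> - Y s \<omega>)\<^sup>2) \<le> norm (2 * (X s \<omega>)\<^sup>2 + 2 * (Y s \<omega>)\<^sup>2)"
    by simp
  show "(\<lambda>\<omega>. (X s \<omega> - Y s \<omega>)\<^sup>2) \<in> borel_measurable M"
    using flat_solution_paths(1)[OF assms(1,3)] flat_solution_paths(1)[OF assms(2,3)] by simp
qed

text \<open>Without the reflections there remain the initial gap, a drift and an Ito term, and
  squaring their sum costs a factor 3. The squared coefficient differences have mean at most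
  \<open>4 * L\<^sup>2\<close> times \<open>g\<close>, half of it through the Wasserstein distance.
  Cauchy-Schwarz in time adds \<open>t\<close> to the drift and Doob adds 4 to the Ito term: 3 * 4 *
  t = 12 t and 3 * 4 * 4 = 48.\<close>

lemma unreflected_difference_bound:
  assumes X: "flat_solution \<xi> X K" and Y: "flat_solution \<zeta> Y K'"
    and "0 \<le> t" and d: "range d \<subseteq> {0..t}"
  defines "g \<equiv> \<lambda>s. \<integral>\<^sup>+\<omega>. ennreal ((X s \<omega> - Y s \<omega>)\<^sup>2) \<partial>M"
  shows "(\<integral>\<^sup>+\<omega>. (SUP n::nat. ennreal ((X (d n) \<omega> - K (d n) - (Y (d n) \<omega> - K' (d n)))\<^sup>2)) \<partial>M)
    \<le> ennreal (3 * (\<xi> - \<zeta>)\<^sup>2) + ennreal (L\<^sup>2 * (12 * t + 48)) * (\<integral>\<^sup>+s\<in>{0..t}. g s \<partial>lborel)"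
proof (cases "(\<integral>\<^sup>+s\<in>{0..t}. g s \<partial>lborel) = \<infinity>")
  \<comment> \<open>The coefficient of the time integral is positive, so the right-hand side is
    infinite.\<close>
  case True
  define k where "k = L\<^sup>2 * (12 * t + 48)"
  have "0 < k" unfolding k_def using L_pos \<open>0 \<le> t\<close> by (intro mult_pos_pos) auto
  then show ?thesis unfolding k_def[symmetric] using True by (simp add: ennreal_mult_top)
next
  case False
  define Z where "Z s \<omega> = X s \<omega> - Y s \<omega>" for s \<omega>
  define w where "w s = sqrt (\<integral>\<omega>. (X s \<omega> - Y s \<omega>)\<^sup>2 \<partial>M)" for s
  have g_w: "g s = ennreal ((w s)\<^sup>2)" if "0 \<le> s" for s
    unfolding g_def w_def using integrable_power2_diff[OF X Y that]
    by (subst nn_integral_eq_integral) auto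
  have Z_joint[measurable]: "(\<lambda>(s, \<omega>). Z s \<omega> * indicator {0..t} s) \<in> borel_measurable (borel \<Otimes>\<^sub>M M)"
    unfolding Z_def
    using flat_solution_paths(1)[OF X] flat_solution_paths(1)[OF Y] flat_solution_paths(2)[OF X] flat_solution_paths(2)[OF Y]
    by (intro continuous_paths_jointly_measurable \<open>0 \<le> t\<close>) (auto intro!: continuous_intros)
  have g_meas[measurable]: "(\<lambda>s. g s * indicator {0..t} s) \<in> borel_measurable borel"
  proof -
    have "(\<lambda>s. (\<integral>\<^sup>+\<omega>. ennreal ((Z s \<omega> * indicator {0..t} s)\<^sup>2) \<partial>M)) \<in> borel_measurable borel" by measurable
    moreover have "(\<integral>\<^sup>+\<omega>. ennreal ((Z s \<omega> * indicator {0..t} s)\<^sup>2) \<partial>M) = g s * indicator {0..t} s" for s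
      by (cases "s \<in> {0..t}") (auto simp: g_def Z_def)
    ultimately show ?thesis by simp
  qed
  \<comment> \<open>\<open>g s\<close> is the square of \<open>w s\<close>, the part of the
    Lipschitz bound that comes from the laws. \<open>N\<close> dominates the time integrals of both
    squared coefficient differences up to the factor \<open>2 * L\<^sup>2\<close>, and its mean is
    twice the time integral of \<open>g\<close>.\<close>
  define N where "N \<omega> = (\<integral>\<^sup>+s. ennreal ((Z s \<omega> * indicator {0..t} s)\<^sup>2) + g s * indicator {0..t} s \<partial>lborel)" for \<omega>
  have N_meas[measurable]: "N \<in> borel_measurable M" unfolding N_def[abs_def] by measurable
  have N_integral: "(\<integral>\<^sup>+\<omega>. N \<omega> \<partial>M) = 2 * (\<integral>\<^sup>+s\<in>{0..t}. g s \<partial>lborel)"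
  proof -
    interpret pair_sigma_finite lborel M ..
    have "(\<lambda>(s, \<omega>). ennreal ((Z s \<omega> * indicator {0..t} s)\<^sup>2) + g s * indicator {0..t} s) \<in> borel_measurable (lborel \<Otimes>\<^sub>M M)"
      by measurable
    then have "(\<integral>\<^sup>+\<omega>. N \<omega> \<partial>M) = (\<integral>\<^sup>+s. (\<integral>\<^sup>+\<omega>. ennreal ((Z s \<omega> * indicator {0..t} s)\<^sup>2) + g s * indicator {0..t} s \<partial>M) \<partial>lborel)"
      unfolding N_def by (rule Fubini')
    also have "\<dots> = (\<integral>\<^sup>+s. 2 * (g s * indicator {0..t} s) \<partial>lborel)"
    proof (rule nn_integral_cong)
      fix s
      have Zs: "(\<lambda>\<omega>. Z s \<omega> * indicator {0..t} s) \<in> borel_measurable M" by measurable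
      have "(\<integral>\<^sup>+\<omega>. ennreal ((Z s \<omega> * indicator {0..t} s)\<^sup>2) \<partial>M) = g s * indicator {0..t} s"
        by (cases "s \<in> {0..t}") (auto simp: g_def Z_def)
      then show "(\<integral>\<^sup>+\<omega>. ennreal ((Z s \<omega> * indicator {0..t} s)\<^sup>2) + g s * indicator {0..t} s \<partial>M) = 2 * (g s * indicator {0..t} s)"
        using Zs by (subst nn_integral_add) (auto simp: emeasure_space_1 mult_2)
    qed
    finally show ?thesis by (simp add: nn_integral_cmult)
  qed
  have sq: "(L * (\<bar>Z s \<omega>\<bar> + w s))\<^sup>2 \<le> 2 * L\<^sup>2 * ((Z s \<omega>)\<^sup>2 + (w s)\<^sup>2)" for s \<omega>
  proof -
    have "(\<bar>Z s \<omega>\<bar> + w s)\<^sup>2 \<le> 2 * ((Z s \<omega>)\<^sup>2 + (w s)\<^sup>2)"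
      using zero_le_power2[of "\<bar>Z s \<omega>\<bar> - w s"] by (simp add: power2_sum power2_diff)
    then have "L\<^sup>2 * (\<bar>Z s \<omega>\<bar> + w s)\<^sup>2 \<le> L\<^sup>2 * (2 * ((Z s \<omega>)\<^sup>2 + (w s)\<^sup>2))"
      by (rule mult_left_mono) simp
    then show ?thesis
      unfolding power_mult_distrib by (simp only: mult.assoc mult.left_commute[of "L\<^sup>2" 2])
  qed
  have le_N: "(\<integral>\<^sup>+s\<in>{0..t}. ennreal ((f s)\<^sup>2) \<partial>lborel) \<le> ennreal (2 * L\<^sup>2) * N \<omega>"
    if "\<omega> \<in> space M" and f: "\<And>s. s \<in> {0..t} \<Longrightarrow> \<bar>f s\<bar> \<le> L * (\<bar>Z s \<omega>\<bar> + w s)" for f \<omega>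
  proof -
    note [measurable] = that(1)
    have "(\<integral>\<^sup>+s\<in>{0..t}. ennreal ((f s)\<^sup>2) \<partial>lborel)
        \<le> (\<integral>\<^sup>+s. ennreal (2 * L\<^sup>2) * (ennreal ((Z s \<omega> * indicator {0..t} s)\<^sup>2) + g s * indicator {0..t} s) \<partial>lborel)"
    proof (rule nn_integral_mono)
      fix s
      show "ennreal ((f s)\<^sup>2) * indicator {0..t} s
          \<le> ennreal (2 * L\<^sup>2) * (ennreal ((Z s \<omega> * indicator {0..t} s)\<^sup>2) + g s * indicator {0..t} s)"
      proof (cases "s \<in> {0..t}")
        case True
        have "(f s)\<^sup>2 \<le> (L * (\<bar>Z s \<omega>\<bar> + w s))\<^sup>2"
          using power_mono[OF f[OF True], of 2] by simp
        also note sq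
        finally have "ennreal ((f s)\<^sup>2) \<le> ennreal (2 * L\<^sup>2 * ((Z s \<omega>)\<^sup>2 + (w s)\<^sup>2))" by (rule ennreal_leI)
        also have "\<dots> = ennreal (2 * L\<^sup>2) * (ennreal ((Z s \<omega>)\<^sup>2) + g s)"
          using g_w[of s] True by (simp add: ennreal_mult)
        finally show ?thesis using True by simp
      qed simp
    qed
    also have "\<dots> = ennreal (2 * L\<^sup>2) * N \<omega>"
      unfolding N_def by (intro nn_integral_cmult) measurable
    finally show ?thesis .
  qed
  obtain I where I: "ito_limit t (\<lambda>s \<omega>. \<sigma> (X s \<omega>) (law M (X s)) * indicator {0..t} s) I"
    "AE \<omega> in M. \<forall>t\<ge>0. set_integrable lborel {0..t} (\<lambda>s. b (X s \<omega>) (law M (X s))) \<and>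
      X t \<omega> = \<xi> + (LINT s:{0..t}|lborel. b (X s \<omega>) (law M (X s))) + I t \<omega> + K t"
    using flat_solution_equation[OF X \<open>0 \<le> t\<close>] by blast
  obtain I' where I': "ito_limit t (\<lambda>s \<omega>. \<sigma> (Y s \<omega>) (law M (Y s)) * indicator {0..t} s) I'"
    "AE \<omega> in M. \<forall>t\<ge>0. set_integrable lborel {0..t} (\<lambda>s. b (Y s \<omega>) (law M (Y s))) \<and>
      Y t \<omega> = \<zeta> + (LINT s:{0..t}|lborel. b (Y s \<omega>) (law M (Y s))) + I' t \<omega> + K' t"
    using flat_solution_equation[OF Y \<open>0 \<le> t\<close>] by blast
  define H where "H s \<omega> = \<sigma> (X s \<omega>) (law M (X s)) * indicator {0..t} s - \<sigma> (Y s \<omega>) (law M (Y s)) * indicator {0..t} s" for s \<omega>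
  define J where "J s \<omega> = I s \<omega> - I' s \<omega>" for s \<omega>
  have HJ: "ito_limit t H J"
    unfolding H_def[abs_def] J_def[abs_def] by (rule ito_limit_diff[OF I(1) I'(1)])
  have [measurable]: "J (d n) \<in> borel_measurable M" for n
    using ito_limit_measurable(2)[OF HJ] d by (auto simp: image_subset_iff)
  have [measurable]: "(\<lambda>(s, \<omega>). H s \<omega>) \<in> borel_measurable (borel \<Otimes>\<^sub>M M)"
    by (rule ito_limit_measurable(1)[OF HJ])
  have lip: "\<bar>b (X s \<omega>) (law M (X s)) - b (Y s \<omega>) (law M (Y s))\<bar> \<le> L * (\<bar>Z s \<omega>\<bar> + w s)"
    "\<bar>H s \<omega>\<bar> \<le> L * (\<bar>Z s \<omega>\<bar> + w s)" if "s \<in> {0..t}" for s \<omega>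
    using lipschitz_law[OF X Y, of s "X s \<omega>" "Y s \<omega>"] that by (auto simp: Z_def w_def H_def)
  have A_le: "(\<integral>\<^sup>+s\<in>{0..t}. ennreal ((H s \<omega>)\<^sup>2) \<partial>lborel) \<le> ennreal (2 * L\<^sup>2) * N \<omega>" if "\<omega> \<in> space M" for \<omega>
    using lip(2) by (intro le_N that)
  \<comment> \<open>A finite mean makes \<open>N\<close> finite almost surely, which bounds the
    bracket as the maximal inequality requires.\<close>
  have N_fin: "AE \<omega> in M. N \<omega> \<noteq> \<infinity>"
    using False N_integral by (intro nn_integral_noteq_infinite) (auto simp: ennreal_mult_eq_top_iff)
  have "(\<integral>\<^sup>+\<omega>. (SUP n::nat. ennreal ((J (d n) \<omega>)\<^sup>2)) \<partial>M)
      \<le> 4 * (\<integral>\<^sup>+\<omega>. (\<integral>\<^sup>+s\<in>{0..t}. ennreal ((H s \<omega>)\<^sup>2) \<partial>lborel) \<partial>M)"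
  proof (rule maximal_inequality[OF HJ d \<open>0 \<le> t\<close>])
    show "AE \<omega> in M. (\<integral>\<^sup>+s\<in>{0..t}. ennreal ((H s \<omega>)\<^sup>2) \<partial>lborel) < \<infinity>"
      using N_fin AE_space
    proof eventually_elim
      case (elim \<omega>)
      have "ennreal (2 * L\<^sup>2) * N \<omega> < \<infinity>" using elim(1) by (simp add: ennreal_mult_less_top less_top)
      then show ?case by (rule le_less_trans[OF A_le[OF elim(2)]])
    qed
  qed
  also have "\<dots> \<le> 4 * (\<integral>\<^sup>+\<omega>. ennreal (2 * L\<^sup>2) * N \<omega> \<partial>M)"
    by (intro mult_left_mono nn_integral_mono A_le) auto
  also have "\<dots> = 4 * (ennreal (2 * L\<^sup>2) * (2 * (\<integral>\<^sup>+s\<in>{0..t}. g s \<partial>lborel)))"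
    by (simp add: nn_integral_cmult N_integral)
  finally have J_le: "(\<integral>\<^sup>+\<omega>. (SUP n::nat. ennreal ((J (d n) \<omega>)\<^sup>2)) \<partial>M)
      \<le> 4 * (ennreal (2 * L\<^sup>2) * (2 * (\<integral>\<^sup>+s\<in>{0..t}. g s \<partial>lborel)))" .
  let ?U = "\<lambda>s \<omega>. X s \<omega> - K s - (Y s \<omega> - K' s)"
  have "(\<integral>\<^sup>+\<omega>. (SUP n::nat. ennreal ((?U (d n) \<omega>)\<^sup>2)) \<partial>M)
      \<le> (\<integral>\<^sup>+\<omega>. ennreal (3 * (\<xi> - \<zeta>)\<^sup>2) + ennreal (6 * t * L\<^sup>2) * N \<omega>
        + 3 * (SUP n::nat. ennreal ((J (d n) \<omega>)\<^sup>2)) \<partial>M)"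
  proof (rule nn_integral_mono_AE)
    show "AE \<omega> in M. (SUP n::nat. ennreal ((?U (d n) \<omega>)\<^sup>2))
        \<le> ennreal (3 * (\<xi> - \<zeta>)\<^sup>2) + ennreal (6 * t * L\<^sup>2) * N \<omega> + 3 * (SUP n::nat. ennreal ((J (d n) \<omega>)\<^sup>2))"
      using I(2) I'(2) AE_space
    proof eventually_elim
      case (elim \<omega>)
      show ?case
      proof (rule SUP_least)
        fix n
        define s where "s = d n"
        have s: "s \<in> {0..t}" using d by (auto simp: s_def image_subset_iff)
        let ?b = "\<lambda>s. b (X s \<omega>) (law M (X s)) - b (Y s \<omega>) (law M (Y s))"
        \<comment> \<open>The end point of the interval is the fixed time \<open>d n\<close>; the
          integration variable of the same name is bound in the integrand only.\<close>
        define D where "D = (LINT s:{0..s}|lborel. ?b s)"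
        have int: "set_integrable lborel {0..s} (\<lambda>s. b (X s \<omega>) (law M (X s)))"
          "set_integrable lborel {0..s} (\<lambda>s. b (Y s \<omega>) (law M (Y s)))"
          using elim(1,2) s by auto
        have D_eq: "D = (LINT s:{0..s}|lborel. b (X s \<omega>) (law M (X s))) - (LINT s:{0..s}|lborel. b (Y s \<omega>) (law M (Y s)))"
          unfolding D_def using int by (rule set_integral_diff(2))
        have "X s \<omega> = \<xi> + (LINT s:{0..s}|lborel. b (X s \<omega>) (law M (X s))) + I s \<omega> + K s"
          "Y s \<omega> = \<zeta> + (LINT s:{0..s}|lborel. b (Y s \<omega>) (law M (Y s))) + I' s \<omega> + K' s"
          using elim(1,2) s by auto
        then have U: "?U s \<omega> = (\<xi> - \<zeta>) + D + J s \<omega>" unfolding D_eq J_def by linarith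
        have three: "(x + y + z)\<^sup>2 \<le> 3 * x\<^sup>2 + 3 * y\<^sup>2 + 3 * z\<^sup>2" for x y z :: real
        proof -
          have "0 \<le> (x - y)\<^sup>2 + (y - z)\<^sup>2 + (x - z)\<^sup>2" by simp
          then show ?thesis by (simp add: power2_eq_square algebra_simps)
        qed
        have "ennreal ((?U s \<omega>)\<^sup>2) \<le> ennreal (3 * (\<xi> - \<zeta>)\<^sup>2 + 3 * D\<^sup>2 + 3 * (J s \<omega>)\<^sup>2)"
          unfolding U by (intro ennreal_leI three)
        also have "\<dots> = ennreal (3 * (\<xi> - \<zeta>)\<^sup>2) + 3 * ennreal (D\<^sup>2) + 3 * ennreal ((J s \<omega>)\<^sup>2)"
          by (simp add: ennreal_mult)
        also have "\<dots> \<le> ennreal (3 * (\<xi> - \<zeta>)\<^sup>2) + 3 * (ennreal (2 * t * L\<^sup>2) * N \<omega>)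
            + 3 * (SUP n::nat. ennreal ((J (d n) \<omega>)\<^sup>2))"
        proof (intro add_mono mult_left_mono order_refl)
          have "ennreal (D\<^sup>2) \<le> ennreal s * (\<integral>\<^sup>+s\<in>{0..s}. ennreal ((?b s)\<^sup>2) \<partial>lborel)"
            unfolding D_def using s by (intro set_integral_power2_le set_integral_diff(1) int) auto
          also have "\<dots> \<le> ennreal t * (\<integral>\<^sup>+s\<in>{0..t}. ennreal ((?b s)\<^sup>2) \<partial>lborel)"
            using s by (intro mult_mono ennreal_leI nn_integral_mono) (auto split: split_indicator)
          also have "\<dots> \<le> ennreal t * (ennreal (2 * L\<^sup>2) * N \<omega>)"
            by (intro mult_left_mono le_N elim(3) lip(1)) auto
          also have "\<dots> = ennreal (2 * t * L\<^sup>2) * N \<omega>"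
            using \<open>0 \<le> t\<close> by (simp add: ennreal_mult ac_simps)
          finally show "ennreal (D\<^sup>2) \<le> ennreal (2 * t * L\<^sup>2) * N \<omega>" .
          show "ennreal ((J s \<omega>)\<^sup>2) \<le> (SUP n::nat. ennreal ((J (d n) \<omega>)\<^sup>2))"
            unfolding s_def by (rule SUP_upper) simp
        qed auto
        also have "3 * (ennreal (2 * t * L\<^sup>2) * N \<omega>) = ennreal (6 * t * L\<^sup>2) * N \<omega>"
        proof -
          have "ennreal (6 * t * L\<^sup>2) = ennreal 3 * ennreal (2 * t * L\<^sup>2)"
            using \<open>0 \<le> t\<close> by (subst ennreal_mult[symmetric]) auto
          then show ?thesis by (simp add: mult.assoc)
        qed
        finally show "ennreal ((?U (d n) \<omega>)\<^sup>2)
          \<le> ennreal (3 * (\<xi> - \<zeta>)\<^sup>2) + ennreal (6 * t * L\<^sup>2) * N \<omega> + 3 * (SUP n::nat. ennreal ((J (d n) \<omega>)\<^sup>2))"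
          by (simp only: s_def)
      qed
    qed
  qed
  also have "\<dots> = ennreal (3 * (\<xi> - \<zeta>)\<^sup>2) + ennreal (6 * t * L\<^sup>2) * (\<integral>\<^sup>+\<omega>. N \<omega> \<partial>M)
      + 3 * (\<integral>\<^sup>+\<omega>. (SUP n::nat. ennreal ((J (d n) \<omega>)\<^sup>2)) \<partial>M)"
    by (simp add: nn_integral_add nn_integral_cmult emeasure_space_1)
  also have "\<dots> \<le> ennreal (3 * (\<xi> - \<zeta>)\<^sup>2) + ennreal (6 * t * L\<^sup>2) * (2 * (\<integral>\<^sup>+s\<in>{0..t}. g s \<partial>lborel))
      + 3 * (4 * (ennreal (2 * L\<^sup>2) * (2 * (\<integral>\<^sup>+s\<in>{0..t}. g s \<partial>lborel))))"
    unfolding N_integral by (intro add_mono mult_left_mono J_le order_refl) auto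
  also have "\<dots> = ennreal (3 * (\<xi> - \<zeta>)\<^sup>2) + ennreal (L\<^sup>2 * (12 * t + 48)) * (\<integral>\<^sup>+s\<in>{0..t}. g s \<partial>lborel)"
  proof -
    define q where "q = enn2real (\<integral>\<^sup>+s\<in>{0..t}. g s \<partial>lborel)"
    have q: "(\<integral>\<^sup>+s\<in>{0..t}. g s \<partial>lborel) = ennreal q" "0 \<le> q"
      using False by (auto simp: q_def less_top)
    have "ennreal (6 * t * L\<^sup>2) * (2 * ennreal q) = ennreal (12 * t * L\<^sup>2 * q)"
      using q(2) \<open>0 \<le> t\<close> by (simp add: ennreal_mult[symmetric] ennreal_numeral[symmetric] del: ennreal_numeral)
    moreover have "3 * (4 * (ennreal (2 * L\<^sup>2) * (2 * ennreal q))) = ennreal (48 * L\<^sup>2 * q)"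
      using q(2) by (simp add: ennreal_mult[symmetric] ennreal_numeral[symmetric] del: ennreal_numeral)
    moreover have "ennreal (L\<^sup>2 * (12 * t + 48)) * ennreal q = ennreal (12 * t * L\<^sup>2 * q) + ennreal (48 * L\<^sup>2 * q)"
      using q(2) \<open>0 \<le> t\<close> by (subst ennreal_plus[symmetric], simp, simp, subst ennreal_mult[symmetric])
        (auto simp: algebra_simps simp del: ennreal_plus)
    ultimately show ?thesis unfolding q by (simp add: add.assoc)
  qed
  finally show ?thesis .
qed

text \<open>\<open>X\<close> is compared with \<open>Y\<close> shifted by the gap K - K'. Where the
  gap is nonnegative, the shift raises \<open>h\<close> by at least \<open>m\<close> times the gap,
  and the shifted variable differs from \<open>X\<close> by exactly the unreflected difference,
  which costs at most \<open>M'\<close> times its absolute value. Taking means and using the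
  constraint on \<open>Y\<close> gives the lower bound that \<open>reflection_le\<close> asks
  for.\<close>

lemma reflection_difference_le:
  assumes X: "flat_solution \<xi> X K" and Y: "flat_solution \<zeta> Y K'" and "0 \<le> t" "0 \<le> D"
    and bound: "\<And>s. s \<in> {0..t} \<Longrightarrow> (\<integral>\<^sup>+\<omega>. ennreal ((X s \<omega> - K s - (Y s \<omega> - K' s))\<^sup>2) \<partial>M) \<le> ennreal D"
  shows "m * (K t - K' t) \<le> M' * sqrt D"
proof -
  have flat: "(\<integral>\<^sup>+ s\<in>{0..t}. ennreal (\<integral>\<omega>. h (X s \<omega>) \<partial>M) \<partial>(interval_measure (\<lambda>s. K (max 0 s)))) = 0"
    using X \<open>0 \<le> t\<close> unfolding deterministic_flat_solution_def by blast
  have h_meas[measurable]: "h \<in> borel_measurable borel"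
    using mono_h by (rule borel_measurable_mono)
  have h_int: "integrable M (\<lambda>\<omega>. h (V \<omega>))"
    if [measurable]: "V \<in> borel_measurable M" and V: "integrable M (\<lambda>\<omega>. (V \<omega>)\<^sup>2)" for V
  proof (rule Bochner_Integration.integrable_bound)
    show "integrable M (\<lambda>\<omega>. \<bar>h 0\<bar> + M' * \<bar>V \<omega>\<bar>)"
      using square_integrable_imp_integrable[OF that] by simp
    have "\<bar>h x\<bar> \<le> \<bar>h 0\<bar> + M' * \<bar>x\<bar>" for x using bi_lipschitz[of x 0] by auto
    then show "AE \<omega> in M. norm (h (V \<omega>)) \<le> norm (\<bar>h 0\<bar> + M' * \<bar>V \<omega>\<bar>)"
      by (intro AE_I2) (simp add: order_trans[OF _ abs_ge_self])
  qed measurable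
  show ?thesis
  proof (rule reflection_le[OF flat_solution_paths(5-7)[OF X] flat_solution_paths(5-7)[OF Y] flat _ m_pos _ \<open>0 \<le> t\<close>])
    show "0 \<le> M' * sqrt D" using m_pos m_le \<open>0 \<le> D\<close> by simp
    fix s assume s: "s \<in> {0..t}" and K: "K' s \<le> K s"
    have s0: "0 \<le> s" using s by simp
    note [measurable] = flat_solution_paths(1)[OF X s0] flat_solution_paths(1)[OF Y s0]
    define U where "U \<omega> = X s \<omega> - K s - (Y s \<omega> - K' s)" for \<omega>
    have [measurable]: "U \<in> borel_measurable M" unfolding U_def[abs_def] by measurable
    have U_nn: "(\<integral>\<^sup>+\<omega>. ennreal ((U \<omega>)\<^sup>2) \<partial>M) \<le> ennreal D" using bound[OF s] by (simp add: U_def)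
    have U2: "integrable M (\<lambda>\<omega>. (U \<omega>)\<^sup>2)"
    proof (rule integrableI_nonneg)
      show "(\<integral>\<^sup>+\<omega>. ennreal ((U \<omega>)\<^sup>2) \<partial>M) < \<infinity>" using U_nn by (rule le_less_trans) simp
    qed auto
    have U1: "integrable M U" by (rule square_integrable_imp_integrable[OF _ U2]) measurable
    have "ennreal (\<integral>\<omega>. (U \<omega>)\<^sup>2 \<partial>M) \<le> ennreal D"
      using U_nn U2 by (subst nn_integral_eq_integral[symmetric]) auto
    then have U_D: "(\<integral>\<omega>. (U \<omega>)\<^sup>2 \<partial>M) \<le> D" using \<open>0 \<le> D\<close> by (simp add: ennreal_le_iff)
    \<comment> \<open>Jensen's inequality, read off from the nonnegativity of the variance.\<close>
    have "(\<integral>\<omega>. \<bar>U \<omega>\<bar> \<partial>M)\<^sup>2 \<le> (\<integral>\<omega>. \<bar>U \<omega>\<bar>\<^sup>2 \<partial>M)"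
    proof -
      have "0 \<le> variance (\<lambda>\<omega>. \<bar>U \<omega>\<bar>)" by (rule variance_positive)
      also have "variance (\<lambda>\<omega>. \<bar>U \<omega>\<bar>) = (\<integral>\<omega>. \<bar>U \<omega>\<bar>\<^sup>2 \<partial>M) - (\<integral>\<omega>. \<bar>U \<omega>\<bar> \<partial>M)\<^sup>2"
        using U1 U2 by (intro variance_eq) auto
      finally show ?thesis by simp
    qed
    then have "(\<integral>\<omega>. \<bar>U \<omega>\<bar> \<partial>M)\<^sup>2 \<le> D" using U_D by simp
    then have EU: "(\<integral>\<omega>. \<bar>U \<omega>\<bar> \<partial>M) \<le> sqrt D" by (rule real_le_rsqrt)
    have point: "h (Y s \<omega>) + m * (K s - K' s) - M' * \<bar>U \<omega>\<bar> \<le> h (X s \<omega>)" for \<omega>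
    proof -
      let ?v = "Y s \<omega> + (K s - K' s)"
      have "h (Y s \<omega>) \<le> h ?v" using K by (intro monoD[OF mono_h]) simp
      then have "m * (K s - K' s) \<le> h ?v - h (Y s \<omega>)"
        using bi_lipschitz[of ?v "Y s \<omega>"] K by simp
      moreover have "X s \<omega> - ?v = U \<omega>" by (simp add: U_def)
      then have "\<bar>h (X s \<omega>) - h ?v\<bar> \<le> M' * \<bar>U \<omega>\<bar>" using bi_lipschitz[of "X s \<omega>" ?v] by simp
      ultimately show ?thesis by linarith
    qed
    have hX: "integrable M (\<lambda>\<omega>. h (X s \<omega>))" "integrable M (\<lambda>\<omega>. h (Y s \<omega>))"
      using flat_solution_paths(4)[OF X s0] flat_solution_paths(4)[OF Y s0] by (auto intro!: h_int)
    have hY_nonneg: "0 \<le> (\<integral>\<omega>. h (Y s \<omega>) \<partial>M)" using Y s0 unfolding deterministic_flat_solution_def by blast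
    have "m * (K s - K' s) - M' * sqrt D \<le> (\<integral>\<omega>. h (Y s \<omega>) \<partial>M) + m * (K s - K' s) - M' * (\<integral>\<omega>. \<bar>U \<omega>\<bar> \<partial>M)"
    proof -
      have "M' * (\<integral>\<omega>. \<bar>U \<omega>\<bar> \<partial>M) \<le> M' * sqrt D" using m_pos m_le by (intro mult_left_mono EU) simp
      then show ?thesis using hY_nonneg by linarith
    qed
    also have "\<dots> = (\<integral>\<omega>. h (Y s \<omega>) + m * (K s - K' s) - M' * \<bar>U \<omega>\<bar> \<partial>M)"
      using hX U1 by (simp add: prob_space)
    also have "\<dots> \<le> (\<integral>\<omega>. h (X s \<omega>) \<partial>M)"
      using hX U1 by (intro integral_mono point) auto
    finally show "m * (K s - K' s) - M' * sqrt D \<le> (\<integral>\<omega>. h (X s \<omega>) \<partial>M)" .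
  qed
qed

text \<open>The unreflected bound controls its own maximal function and, through flatness, the
  reflection gap with the extra factor \<open>(M' / m)\<^sup>2\<close>. This is the origin of
  \<open>\<rho>\<close>; the factor 2 in front of it comes from squaring the sum of the two
  parts.\<close>

lemma difference_integral_bound:
  assumes X: "flat_solution \<xi> X K" and Y: "flat_solution \<zeta> Y K'"
    and t: "t \<in> {0..T}" and d: "range d \<subseteq> {0..t}"
  defines "g \<equiv> \<lambda>s. \<integral>\<^sup>+\<omega>. ennreal ((X s \<omega> - Y s \<omega>)\<^sup>2) \<partial>M"
    and "\<rho> \<equiv> 1 + (M' / m)\<^sup>2"
  shows "(\<integral>\<^sup>+\<omega>. (SUP n::nat. ennreal ((X (d n) \<omega> - Y (d n) \<omega>)\<^sup>2)) \<partial>M)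
    \<le> ennreal (6 * \<rho> * (\<xi> - \<zeta>)\<^sup>2) + ennreal (2 * \<rho> * (L\<^sup>2 * (12 * T + 48))) * (\<integral>\<^sup>+s\<in>{0..t}. g s \<partial>lborel)"
proof (cases "(\<integral>\<^sup>+s\<in>{0..t}. g s \<partial>lborel)")
  case top
  define k where "k = 2 * \<rho> * (L\<^sup>2 * (12 * T + 48))"
  have "0 < \<rho>" by (simp add: \<rho>_def add_pos_nonneg)
  then have "0 < k" unfolding k_def using L_pos t by (intro mult_pos_pos) auto
  then show ?thesis unfolding k_def[symmetric] using top by (simp add: ennreal_mult_top)
next
  case (real q)
  \<comment> \<open>\<open>T\<close> replaces \<open>t\<close> in the coefficient, so that the
    constants stay the same for all \<open>t\<close> when Gronwall's inequality is applied.\<close>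
  define \<psi> where "\<psi> = 3 * (\<xi> - \<zeta>)\<^sup>2 + L\<^sup>2 * (12 * T + 48) * q"
  have \<psi>: "0 \<le> \<psi>" using real t by (simp add: \<psi>_def)
  have U: "(\<integral>\<^sup>+\<omega>. (SUP n::nat. ennreal ((X (e n) \<omega> - K (e n) - (Y (e n) \<omega> - K' (e n)))\<^sup>2)) \<partial>M) \<le> ennreal \<psi>"
    if "range e \<subseteq> {0..t}" for e
  proof -
    have "(\<integral>\<^sup>+\<omega>. (SUP n::nat. ennreal ((X (e n) \<omega> - K (e n) - (Y (e n) \<omega> - K' (e n)))\<^sup>2)) \<partial>M)
        \<le> ennreal (3 * (\<xi> - \<zeta>)\<^sup>2) + ennreal (L\<^sup>2 * (12 * t + 48)) * ennreal q"
      using unreflected_difference_bound[OF X Y _ that] t unfolding real(2)[symmetric] g_def by simp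
    also have "\<dots> \<le> ennreal (3 * (\<xi> - \<zeta>)\<^sup>2) + ennreal (L\<^sup>2 * (12 * T + 48)) * ennreal q"
      using t by (intro add_left_mono mult_right_mono ennreal_leI mult_left_mono) auto
    also have "\<dots> = ennreal \<psi>"
      using real t by (simp add: \<psi>_def ennreal_mult)
    finally show ?thesis .
  qed
  \<comment> \<open>A constant sequence of times specialises the maximal bound to a single
    time.\<close>
  have U_s: "(\<integral>\<^sup>+\<omega>. ennreal ((X s \<omega> - K s - (Y s \<omega> - K' s))\<^sup>2) \<partial>M) \<le> ennreal \<psi>" if "s \<in> {0..t}" for s
    using U[of "\<lambda>_. s"] that by simp
  have K_le: "(K s - K' s)\<^sup>2 \<le> (M' / m)\<^sup>2 * \<psi>" if s: "s \<in> {0..t}" for s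
  proof -
    \<comment> \<open>Flatness of \<open>K\<close> bounds the gap from above. The roles are then
      exchanged, and flatness of \<open>K'\<close> bounds it from below.\<close>
    have "m * (K s - K' s) \<le> M' * sqrt \<psi>"
      using s by (intro reflection_difference_le[OF X Y _ \<psi>] U_s) auto
    moreover have "m * (K' s - K s) \<le> M' * sqrt \<psi>"
    proof (intro reflection_difference_le[OF Y X _ \<psi>])
      fix r assume "r \<in> {0..s}"
      moreover have "(Y r \<omega> - K' r - (X r \<omega> - K r))\<^sup>2 = (X r \<omega> - K r - (Y r \<omega> - K' r))\<^sup>2" for \<omega>
        by (rule power2_commute)
      ultimately show "(\<integral>\<^sup>+\<omega>. ennreal ((Y r \<omega> - K' r - (X r \<omega> - K r))\<^sup>2) \<partial>M) \<le> ennreal \<psi>"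
        using U_s[of r] s by simp
    qed (use s in simp)
    ultimately have "m * \<bar>K s - K' s\<bar> \<le> M' * sqrt \<psi>"
      by (cases "K s \<le> K' s") simp_all
    then have "\<bar>K s - K' s\<bar> \<le> M' / m * sqrt \<psi>" using m_pos by (simp add: field_simps)
    then have "\<bar>K s - K' s\<bar>\<^sup>2 \<le> (M' / m * sqrt \<psi>)\<^sup>2" by (intro power_mono) auto
    also have "(M' / m * sqrt \<psi>)\<^sup>2 = (M' / m)\<^sup>2 * \<psi>"
      using \<psi> by (simp only: power_mult_distrib real_sqrt_pow2)
    finally show ?thesis by simp
  qed
  let ?U = "\<lambda>s \<omega>. X s \<omega> - K s - (Y s \<omega> - K' s)"
  have [measurable]: "X (d n) \<in> borel_measurable M" "Y (d n) \<in> borel_measurable M" for n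
    using flat_solution_paths(1)[OF X] flat_solution_paths(1)[OF Y] d by (auto simp: image_subset_iff)
  have "(\<integral>\<^sup>+\<omega>. (SUP n::nat. ennreal ((X (d n) \<omega> - Y (d n) \<omega>)\<^sup>2)) \<partial>M)
      \<le> (\<integral>\<^sup>+\<omega>. 2 * (SUP n::nat. ennreal ((?U (d n) \<omega>)\<^sup>2)) + ennreal (2 * (M' / m)\<^sup>2 * \<psi>) \<partial>M)"
  proof (intro nn_integral_mono SUP_least)
    fix \<omega> n
    have dn: "d n \<in> {0..t}" using d by (auto simp: image_subset_iff)
    have "(x + y)\<^sup>2 \<le> 2 * x\<^sup>2 + 2 * y\<^sup>2" for x y :: real
      using zero_le_power2[of "x - y"] by (simp add: power2_sum power2_diff)
    from this[of "?U (d n) \<omega>" "K (d n) - K' (d n)"]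
    have "(X (d n) \<omega> - Y (d n) \<omega>)\<^sup>2 \<le> 2 * (?U (d n) \<omega>)\<^sup>2 + 2 * (K (d n) - K' (d n))\<^sup>2" by simp
    also have "\<dots> \<le> 2 * (?U (d n) \<omega>)\<^sup>2 + 2 * (M' / m)\<^sup>2 * \<psi>" using K_le[OF dn] by simp
    finally have "ennreal ((X (d n) \<omega> - Y (d n) \<omega>)\<^sup>2) \<le> ennreal (2 * (?U (d n) \<omega>)\<^sup>2 + 2 * (M' / m)\<^sup>2 * \<psi>)"
      by (rule ennreal_leI)
    also have "\<dots> = 2 * ennreal ((?U (d n) \<omega>)\<^sup>2) + ennreal (2 * (M' / m)\<^sup>2 * \<psi>)"
      using \<psi> by (subst ennreal_plus) (simp_all add: ennreal_mult)
    also have "\<dots> \<le> 2 * (SUP n::nat. ennreal ((?U (d n) \<omega>)\<^sup>2)) + ennreal (2 * (M' / m)\<^sup>2 * \<psi>)"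
      by (intro add_right_mono mult_left_mono SUP_upper) auto
    finally show "ennreal ((X (d n) \<omega> - Y (d n) \<omega>)\<^sup>2)
        \<le> 2 * (SUP n::nat. ennreal ((?U (d n) \<omega>)\<^sup>2)) + ennreal (2 * (M' / m)\<^sup>2 * \<psi>)" .
  qed
  also have "\<dots> = 2 * (\<integral>\<^sup>+\<omega>. (SUP n::nat. ennreal ((?U (d n) \<omega>)\<^sup>2)) \<partial>M) + ennreal (2 * (M' / m)\<^sup>2 * \<psi>)"
    by (subst nn_integral_add) (simp_all add: nn_integral_cmult emeasure_space_1)
  also have "\<dots> \<le> 2 * ennreal \<psi> + ennreal (2 * (M' / m)\<^sup>2 * \<psi>)"
    by (intro add_right_mono mult_left_mono U d) simp
  also have "\<dots> = ennreal (2 * \<rho> * \<psi>)"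
  proof -
    have "2 * \<rho> * \<psi> = 2 * \<psi> + 2 * (M' / m)\<^sup>2 * \<psi>" by (simp add: \<rho>_def algebra_simps)
    then show ?thesis using \<psi> by (simp add: ennreal_mult)
  qed
  also have "\<dots> = ennreal (6 * \<rho> * (\<xi> - \<zeta>)\<^sup>2) + ennreal (2 * \<rho> * (L\<^sup>2 * (12 * T + 48))) * ennreal q"
  proof -
    have "0 \<le> \<rho>" by (simp add: \<rho>_def)
    moreover have "2 * \<rho> * \<psi> = 6 * \<rho> * (\<xi> - \<zeta>)\<^sup>2 + 2 * \<rho> * (L\<^sup>2 * (12 * T + 48)) * q"
      by (simp add: \<psi>_def algebra_simps)
    ultimately show ?thesis
      using real t by (simp only:) (subst ennreal_plus, simp_all add: ennreal_mult)
  qed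
  finally show ?thesis by (simp only: real(2))
qed

text \<open>Gronwall's inequality is applied to the second moments at single times; the result is
  inserted once more into the maximal estimate to reach the supremum. The constant is chosen before
  the solutions, so that the bound is uniform in the initial values.\<close>

lemma flat_solution_stability:
  assumes "0 \<le> T"
  shows "\<exists>C\<ge>0. \<forall>\<xi> X K \<zeta> Y K'. flat_solution \<xi> X K \<longrightarrow> flat_solution \<zeta> Y K' \<longrightarrow>
    (\<forall>d :: nat \<Rightarrow> real. range d \<subseteq> {0..T} \<longrightarrow>
      (\<integral>\<^sup>+\<omega>. (SUP n. ennreal ((X (d n) \<omega> - Y (d n) \<omega>)\<^sup>2)) \<partial>M) \<le> ennreal (C * (\<xi> - \<zeta>)\<^sup>2))"
proof -
  define \<rho> where "\<rho> = 1 + (M' / m)\<^sup>2"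
  define c where "c = 2 * \<rho> * (L\<^sup>2 * (12 * T + 48))"
  have \<rho>: "0 < \<rho>" by (simp add: \<rho>_def add_pos_nonneg)
  have c: "0 < c" using \<rho> L_pos assms by (simp add: c_def mult_pos_pos)
  \<comment> \<open>With a = 6 \<rho> (\<xi> - \<zeta>)^2, Gronwall bounds the second moment by 2 a
    exp (2 c T) on [0,T]. \<open>C\<close> is the coefficient of (\<xi> - \<zeta>)^2 in a + c T * 2
    a exp (2 c T).\<close>
  define C where "C = 6 * \<rho> + c * (12 * \<rho> * exp (2 * c * T)) * T"
  have bound: "(\<integral>\<^sup>+\<omega>. (SUP n. ennreal ((X (d n) \<omega> - Y (d n) \<omega>)\<^sup>2)) \<partial>M) \<le> ennreal (C * (\<xi> - \<zeta>)\<^sup>2)"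
    if X: "flat_solution \<xi> X K" and Y: "flat_solution \<zeta> Y K'" and d: "range d \<subseteq> {0..T}"
    for \<xi> X K \<zeta> Y K' and d :: "nat \<Rightarrow> real"
  proof -
    define a where "a = 6 * \<rho> * (\<xi> - \<zeta>)\<^sup>2"
    have a: "0 \<le> a" using \<rho> by (simp add: a_def)
    define g where "g s = (\<integral>\<^sup>+\<omega>. ennreal ((X s \<omega> - Y s \<omega>)\<^sup>2) \<partial>M)" for s
    have step: "(\<integral>\<^sup>+\<omega>. (SUP n. ennreal ((X (e n) \<omega> - Y (e n) \<omega>)\<^sup>2)) \<partial>M)
        \<le> ennreal a + ennreal c * (\<integral>\<^sup>+s\<in>{0..t}. g s \<partial>lborel)"
      if "t \<in> {0..T}" "range e \<subseteq> {0..t}" for t and e :: "nat \<Rightarrow> real"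
      using difference_integral_bound[OF X Y that] unfolding a_def c_def g_def \<rho>_def .
    have g_step: "g t \<le> ennreal a + ennreal c * (\<integral>\<^sup>+s\<in>{0..t}. g s \<partial>lborel)" if "t \<in> {0..T}" for t
      using step[OF that, of "\<lambda>_. t"] that by (simp add: g_def)
    obtain e :: "nat \<Rightarrow> real" where e: "range e \<subseteq> {0..T}" "closure (range e) = {0..T}"
      using dense_times[OF assms] by blast
    \<comment> \<open>\<open>S\<close> is finite by the moment bounds of the two solutions and
      provides the a priori bound for Gronwall; its size does not enter the conclusion.\<close>
    define S where "S = (\<integral>\<^sup>+\<omega>. (SUP n. ennreal ((X (e n) \<omega>)\<^sup>2)) \<partial>M) + (\<integral>\<^sup>+\<omega>. (SUP n. ennreal ((Y (e n) \<omega>)\<^sup>2)) \<partial>M)"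
    have S_fin: "2 * S < \<infinity>"
      using flat_solution_second_moment[OF X assms e(1)] flat_solution_second_moment[OF Y assms e(1)]
      by (simp add: S_def ennreal_mult_less_top)
    have [measurable]: "X (e n) \<in> borel_measurable M" "Y (e n) \<in> borel_measurable M" for n
      using flat_solution_paths(1)[OF X] flat_solution_paths(1)[OF Y] e(1) by (auto simp: image_subset_iff)
    have g_le: "g t \<le> 2 * S" if t: "t \<in> {0..T}" for t
    proof -
      have "g t \<le> (\<integral>\<^sup>+\<omega>. 2 * ((SUP n. ennreal ((X (e n) \<omega>)\<^sup>2)) + (SUP n. ennreal ((Y (e n) \<omega>)\<^sup>2))) \<partial>M)"
        unfolding g_def
      proof (rule nn_integral_mono)
        fix \<omega> assume \<omega>: "\<omega> \<in> space M"
        have "(X t \<omega> - Y t \<omega>)\<^sup>2 \<le> 2 * ((X t \<omega>)\<^sup>2 + (Y t \<omega>)\<^sup>2)"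
          using zero_le_power2[of "X t \<omega> + Y t \<omega>"] by (simp add: power2_sum power2_diff)
        then have "ennreal ((X t \<omega> - Y t \<omega>)\<^sup>2) \<le> ennreal (2 * ((X t \<omega>)\<^sup>2 + (Y t \<omega>)\<^sup>2))"
          by (rule ennreal_leI)
        also have "\<dots> = 2 * (ennreal ((X t \<omega>)\<^sup>2) + ennreal ((Y t \<omega>)\<^sup>2))"
          by (subst ennreal_mult) simp_all
        also have "\<dots> \<le> 2 * ((SUP n. ennreal ((X (e n) \<omega>)\<^sup>2)) + (SUP n. ennreal ((Y (e n) \<omega>)\<^sup>2)))"
          by (intro mult_left_mono add_mono dense_power2_le[OF flat_solution_paths(2)[OF X \<omega>] e(2) t]
              dense_power2_le[OF flat_solution_paths(2)[OF Y \<omega>] e(2) t]) simp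
        finally show "ennreal ((X t \<omega> - Y t \<omega>)\<^sup>2)
            \<le> 2 * ((SUP n. ennreal ((X (e n) \<omega>)\<^sup>2)) + (SUP n. ennreal ((Y (e n) \<omega>)\<^sup>2)))" .
      qed
      also have "\<dots> = 2 * S"
        unfolding S_def by (subst nn_integral_cmult, measurable) (simp add: nn_integral_add)
      finally show ?thesis .
    qed
    have g_exp: "g s \<le> ennreal (2 * a * exp (2 * c * T))" if s: "s \<in> {0..T}" for s
    proof -
      have "g s \<le> ennreal (2 * a * exp (2 * c * s))"
      proof (rule gronwall[OF a c _ _ g_step s])
        show "g t \<le> ennreal (enn2real (2 * S))" if "t \<in> {0..T}" for t
          using g_le[OF that] S_fin by simp
      qed simp
      also have "\<dots> \<le> ennreal (2 * a * exp (2 * c * T))"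
        using s c a by (intro ennreal_leI mult_left_mono) auto
      finally show ?thesis .
    qed
    have "(\<integral>\<^sup>+s\<in>{0..T}. g s \<partial>lborel) \<le> (\<integral>\<^sup>+s. ennreal (2 * a * exp (2 * c * T)) * indicator {0..T} s \<partial>lborel)"
      using g_exp by (intro nn_integral_mono) (auto split: split_indicator)
    also have "\<dots> = ennreal (2 * a * exp (2 * c * T)) * ennreal T"
      using assms by (subst nn_integral_cmult_indicator) auto
    finally have "ennreal a + ennreal c * (\<integral>\<^sup>+s\<in>{0..T}. g s \<partial>lborel)
        \<le> ennreal a + ennreal c * (ennreal (2 * a * exp (2 * c * T)) * ennreal T)"
      by (intro add_left_mono mult_left_mono) auto
    also have "\<dots> = ennreal (C * (\<xi> - \<zeta>)\<^sup>2)"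
    proof -
      have "C * (\<xi> - \<zeta>)\<^sup>2 = a + c * (2 * a * exp (2 * c * T) * T)"
        by (simp add: C_def a_def algebra_simps)
      then show ?thesis using a c assms by (simp add: ennreal_mult)
    qed
    finally show ?thesis
      using step[of T d] d assms by (auto intro: order_trans)
  qed
  show ?thesis
    using bound \<rho> c assms by (intro exI[of _ C]) (auto simp: C_def)
qed

end

theorem theorem5p1:
  fixes M :: "'a measure" and F :: "real \<Rightarrow> 'a measure" and B :: "real \<Rightarrow> 'a \<Rightarrow> real"
    and b \<sigma> :: "real \<Rightarrow> real measure \<Rightarrow> real" and h :: "real \<Rightarrow> real"
    and T L m M' :: real
    and X :: "real \<Rightarrow> real \<Rightarrow> 'a \<Rightarrow> real" and K :: "real \<Rightarrow> real \<Rightarrow> real"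
  assumes "complete_filtered_prob_space M F"
    and "brownian_motion M F B"
    and "T > 0"
    and "L > 0"
    and "\<And>x y \<mu> \<nu>. \<mu> \<in> P2 \<Longrightarrow> \<nu> \<in> P2 \<Longrightarrow>
           \<bar>b x \<mu> - b y \<nu>\<bar> + \<bar>\<sigma> x \<mu> - \<sigma> y \<nu>\<bar> \<le> L * (\<bar>x - y\<bar> + W2 \<mu> \<nu>)"
    and "mono h"
    and "0 < m" and "m \<le> M'"
    and "\<And>x y. m * \<bar>x - y\<bar> \<le> \<bar>h x - h y\<bar> \<and> \<bar>h x - h y\<bar> \<le> M' * \<bar>x - y\<bar>"
    and "\<And>\<xi>. h \<xi> \<ge> 0 \<Longrightarrow> deterministic_flat_solution M F B b \<sigma> h \<xi> (X \<xi>) (K \<xi>)"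
  shows "(\<forall>\<xi>\<in>{\<xi>. h \<xi> \<ge> 0}. X \<xi> \<in> L2C M T) \<and>
    (\<forall>\<xi>\<in>{\<xi>. h \<xi> \<ge> 0}. \<forall>\<epsilon>>0. \<exists>\<delta>>0. \<forall>\<zeta>\<in>{\<xi>. h \<xi> \<ge> 0}. \<bar>\<zeta> - \<xi>\<bar> < \<delta> \<longrightarrow>
       L2C_norm M T (\<lambda>t \<omega>. X \<zeta> t \<omega> - X \<xi> t \<omega>) < \<epsilon>)"
proof -
  interpret complete_filtered_prob_space M F by fact
  interpret mean_reflected M F B b \<sigma> h L m M'
    by unfold_locales (use assms in auto)
  have T: "0 \<le> T" using \<open>T > 0\<close> by simp
  note sol = assms(10)
  obtain d :: "nat \<Rightarrow> real" where d: "range d \<subseteq> {0..T}" "closure (range d) = {0..T}"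
    using dense_times[OF T] by blast
  from flat_solution_stability[OF T] obtain C where C: "0 \<le> C"
    and stable: "\<forall>\<xi> X K \<zeta> Y K'. flat_solution \<xi> X K \<longrightarrow> flat_solution \<zeta> Y K' \<longrightarrow>
      (\<forall>d :: nat \<Rightarrow> real. range d \<subseteq> {0..T} \<longrightarrow>
        (\<integral>\<^sup>+\<omega>. (SUP n. ennreal ((X (d n) \<omega> - Y (d n) \<omega>)\<^sup>2)) \<partial>M) \<le> ennreal (C * (\<xi> - \<zeta>)\<^sup>2))"
    by blast
  have L2C: "X \<xi> \<in> L2C M T" if "h \<xi> \<ge> 0" for \<xi>
  proof (rule L2C_of_dense[OF _ _ T d])
    note s = sol[OF that]
    show "X \<xi> t \<in> borel_measurable M" if "t \<in> {0..T}" for t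
      using flat_solution_paths(1)[OF s] that by simp
    show "continuous_on {0..T} (\<lambda>t. X \<xi> t \<omega>)" if "\<omega> \<in> space M" for \<omega>
      by (rule flat_solution_paths(2)[OF s that])
    show "(\<integral>\<^sup>+\<omega>. (SUP n. ennreal ((X \<xi> (d n) \<omega>)\<^sup>2)) \<partial>M)
        \<le> ennreal (enn2real (\<integral>\<^sup>+\<omega>. (SUP n. ennreal ((X \<xi> (d n) \<omega>)\<^sup>2)) \<partial>M))"
      using flat_solution_second_moment[OF s T d(1)] by simp
  qed simp
  have norm_le: "L2C_norm M T (\<lambda>t \<omega>. X \<zeta> t \<omega> - X \<xi> t \<omega>) \<le> sqrt C * \<bar>\<zeta> - \<xi>\<bar>"
    if "h \<xi> \<ge> 0" "h \<zeta> \<ge> 0" for \<xi> \<zeta>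
  proof -
    note s = sol[OF that(2)] sol[OF that(1)]
    have "L2C_norm M T (\<lambda>t \<omega>. X \<zeta> t \<omega> - X \<xi> t \<omega>) \<le> sqrt (C * (\<zeta> - \<xi>)\<^sup>2)"
    proof (rule L2C_of_dense(2)[OF _ _ T d stable[rule_format, OF s d(1)]])
      show "(\<lambda>\<omega>. X \<zeta> t \<omega> - X \<xi> t \<omega>) \<in> borel_measurable M" if "t \<in> {0..T}" for t
        using flat_solution_paths(1)[OF s(1)] flat_solution_paths(1)[OF s(2)] that by simp
      show "continuous_on {0..T} (\<lambda>t. X \<zeta> t \<omega> - X \<xi> t \<omega>)" if "\<omega> \<in> space M" for \<omega>
        by (intro continuous_intros flat_solution_paths(2)[OF s(1) that] flat_solution_paths(2)[OF s(2) that])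
    qed (use C in simp)
    then show ?thesis by (simp add: real_sqrt_mult)
  qed
  have "\<exists>\<delta>>0. \<forall>\<zeta>\<in>{\<xi>. h \<xi> \<ge> 0}. \<bar>\<zeta> - \<xi>\<bar> < \<delta> \<longrightarrow> L2C_norm M T (\<lambda>t \<omega>. X \<zeta> t \<omega> - X \<xi> t \<omega>) < \<epsilon>"
    if "h \<xi> \<ge> 0" "0 < \<epsilon>" for \<xi> \<epsilon>
  proof (intro exI[of _ "\<epsilon> / (sqrt C + 1)"] conjI ballI impI)
    \<comment> \<open>\<open>C\<close> is only known to be nonnegative; adding 1 to its root keeps
      the denominator positive.\<close>
    have pos: "0 < sqrt C + 1" using C by (simp add: add_nonneg_pos)
    then show "0 < \<epsilon> / (sqrt C + 1)" using that by simp
    fix \<zeta> assume \<zeta>: "\<zeta> \<in> {\<xi>. h \<xi> \<ge> 0}" "\<bar>\<zeta> - \<xi>\<bar> < \<epsilon> / (sqrt C + 1)"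
    have "L2C_norm M T (\<lambda>t \<omega>. X \<zeta> t \<omega> - X \<xi> t \<omega>) \<le> sqrt C * \<bar>\<zeta> - \<xi>\<bar>"
      using \<zeta>(1) that by (intro norm_le) auto
    also have "\<dots> \<le> (sqrt C + 1) * \<bar>\<zeta> - \<xi>\<bar>" by (intro mult_right_mono) auto
    also have "\<dots> < \<epsilon>" using \<zeta>(2) pos by (simp add: pos_less_divide_eq mult.commute)
    finally show "L2C_norm M T (\<lambda>t \<omega>. X \<zeta> t \<omega> - X \<xi> t \<omega>) < \<epsilon>" .
  qed
  then show ?thesis using L2C by blast
qed

end
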